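(* Let $M$ be a compact connected oriented Riemannian manifold, $F\to M$ a $C^\infty$ Hermitian vector bundle, and $\nabla$ a flat Hermitian connection on $F$. Let $\nabla_t=\nabla+{\mathcal E}(t)$, $t\ge 0$, be a curve of Hermitian connections on $F$ with $E(t)\in{\mathscr A}^1({\mathfrak u}(F))$, $E(0)=0$, and $E(t)=tE_1+t^2E_2+O(t^3)$, where $E_1:=\lim_{t\to0}E(t)/t$ and $E_2:=\lim_{t\to0}(E(t)-tE_1)/t^2$. Set $C_E:=\nabla E_2+E_1\wedge E_1\in{\mathscr A}^2({\mathfrak u}(F))$. If $\nabla_t$ is a curve of Yang-Mills connections, then (1) $E_1$ determines an element $[E_1]\in H^1(M,{\mathscr P})$; (2) $C_E$ defines an element of $H^2(M,{\mathscr P})$. Here a form in ${\mathscr A}^i({\mathfrak u}(F))$ determines an element of $H^i(M,{\mathscr P})$ when it is $\nabla$-closed, via the identification $H^i(M,{\mathscr P})=H^i({\mathscr A}^\bullet({\mathfrak u}(F)))$.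
   Context: ${\mathscr F}$ is the sheaf of sections of $F$, ${\mathscr A}$ the sheaf of differentiable functions on $M$, ${\mathscr R}$ the sheaf of real-valued $C^\infty$ functions, ${\mathscr A}^k$ the sheaf of differential $k$-forms (real-valued when tensored over ${\mathscr R}$), ${\mathfrak u}({\mathscr F})$ the sheaf of antihermitian endomorphisms of $F$, and ${\mathscr A}^k({\mathfrak u}(F)):=\Gamma(M,{\mathscr A}^k\otimes_{\mathscr R}{\mathfrak u}({\mathscr F}))$. If locally $E=\sum_a\eta_a\otimes e_a$, the associated morphism ${\mathcal E}:{\mathscr F}\to{\mathscr A}^1\otimes_{\mathscr A}{\mathscr F}$ is ${\mathcal E}(\sigma)=\sum_a\eta_a\otimes e_a(\sigma)$, and $E\wedge E:=\sum_{a,b}(\eta_a\wedge\eta_b)\otimes(e_a\circ e_b)$. A connection is Hermitian if $\langle\nabla\sigma,\tau\rangle+\langle\sigma,\nabla\tau\rangle=d\langle\sigma,\tau\rangle$. It induces $\nabla:{\mathscr A}^k({\mathfrak u}(F))\to{\mathscr A}^{k+1}({\mathfrak u}(F))$, $\nabla(\beta\otimes h)=d\beta\otimes h+(-1)^k\beta\wedge(\nabla\circ h-h\circ\nabla)$. Its curvature $K_\nabla\in{\mathscr A}^2({\mathfrak u}(F))$ corresponds to $\nabla^1\circ\nabla$, where $\nabla^1(\beta\otimes\sigma)=d\beta\otimes\sigma-\beta\wedge\nabla\sigma$; flat means $K_\nabla=0$. For flat $\nabla$, ${\mathscr A}^\bullet({\mathfrak u}(F))$ with differential $\nabla$ is a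 complex, and ${\mathscr P}={\mathscr Ker}(\nabla:{\mathfrak u}({\mathscr F})\to{\mathscr A}^1\otimes_{\mathscr R}{\mathfrak u}({\mathscr F}))$ is the sheaf of parallel sections of ${\mathfrak u}({\mathscr F})$; one has $H^i(M,{\mathscr P})=H^i({\mathscr A}^\bullet({\mathfrak u}(F)))$. The Hermitian metric on $F$ induces an ad-invariant metric $\langle\cdot,\cdot\rangle$ on ${\mathfrak u}(F)$, and $\langle\langle\xi\otimes\sigma,\xi'\otimes\sigma'\rangle\rangle=\int_M(\xi\wedge\star\xi')\langle\sigma,\sigma'\rangle$ defines a norm $\|\cdot\|$ on ${\mathscr A}^k({\mathfrak u}(F))$. A Yang-Mills connection is a Hermitian connection at which ${\sf YM}(\nabla)=\|K_\nabla\|^2$ is stationary, i.e. $\frac{d}{d\epsilon}\big|_{\epsilon=0}\|K_{\nabla+\epsilon{\mathcal B}}\|^2=0$ for all $B\in{\mathscr A}^1({\mathfrak u}(F))$. *)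

theory Defs
  imports "HOL-Analysis.Analysis" "HOL-Library.Landau_Symbols"
begin

section \<open>Smooth maps between normed spaces\<close>

fun C_k :: "nat \<Rightarrow> 'a::real_normed_vector set \<Rightarrow> ('a \<Rightarrow> 'b::real_normed_vector) \<Rightarrow> bool" where
  "C_k 0 S f \<longleftrightarrow> continuous_on S f"
| "C_k (Suc k) S f \<longleftrightarrow>
     (\<forall>x\<in>S. f differentiable (at x)) \<and> (\<forall>v. C_k k S (\<lambda>x. frechet_derivative f (at x) v))"

text \<open>Only used for open \<open>S\<close>.\<close>

definition smooth_on :: "'a::real_normed_vector set \<Rightarrow> ('a \<Rightarrow> 'b::real_normed_vector) \<Rightarrow> bool" where
  "smooth_on S f \<longleftrightarrow> (\<forall>k. C_k k S f)"

fun iter_deriv :: "'a::real_normed_vector list \<Rightarrow> ('a \<Rightarrow> 'b::real_normed_vector) \<Rightarrow> 'a \<Rightarrow> 'b" where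
  "iter_deriv [] f = f"
| "iter_deriv (w # ws) f = (\<lambda>y. frechet_derivative (iter_deriv ws f) (at y) w)"


section \<open>Oriented Riemannian manifolds\<close>

text \<open>The manifold is the whole topological space \<open>'m\<close>. A chart is a pair of its domain and
  the coordinate map. A tangent vector at \<open>x\<close> is the directional derivative operator it
  induces on functions; it is set to \<open>0\<close> on functions which are not smooth near \<open>x\<close>, so that
  equal tangent vectors are equal as functions.\<close>

type_synonym ('m, 'n) chart = "'m set \<times> ('m \<Rightarrow> real ^ 'n)"
type_synonym 'm tangent = "('m \<Rightarrow> real) \<Rightarrow> real"

record ('m, 'n) riem =
  atlas :: "('m, 'n) chart set"
  rmetric :: "'m \<Rightarrow> 'm tangent \<Rightarrow> 'm tangent \<Rightarrow> real"

definition chart_inv :: "('m, 'n::finite) chart \<Rightarrow> real ^ 'n \<Rightarrow> 'm" where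
  "chart_inv c = inv_into (fst c) (snd c)"

definition is_chart :: "('m::topological_space, 'n::finite) chart \<Rightarrow> bool" where
  "is_chart c \<longleftrightarrow> open (fst c) \<and> open (snd c ` fst c) \<and>
     homeomorphism (fst c) (snd c ` fst c) (snd c) (chart_inv c)"

definition oriented_atlas :: "('m::topological_space, 'n::finite) chart set \<Rightarrow> bool" where
  "oriented_atlas A \<longleftrightarrow> (\<forall>c\<in>A. is_chart c) \<and> (\<Union>c\<in>A. fst c) = UNIV \<and>
     (\<forall>c\<in>A. \<forall>c'\<in>A.
        smooth_on (snd c ` (fst c \<inter> fst c')) (snd c' \<circ> chart_inv c) \<and>
        (\<forall>y \<in> snd c ` (fst c \<inter> fst c').
           det (matrix (frechet_derivative (snd c' \<circ> chart_inv c) (at y))) > 0))"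

definition smooth_fun ::
  "('m, 'n::finite) riem \<Rightarrow> 'm set \<Rightarrow> ('m \<Rightarrow> 'b::real_normed_vector) \<Rightarrow> bool" where
  "smooth_fun M W f \<longleftrightarrow> (\<forall>c\<in>atlas M. smooth_on (snd c ` (W \<inter> fst c)) (f \<circ> chart_inv c))"

definition smooth_near ::
  "('m::topological_space, 'n::finite) riem \<Rightarrow> 'm \<Rightarrow> ('m \<Rightarrow> 'b::real_normed_vector) \<Rightarrow> bool" where
  "smooth_near M x f \<longleftrightarrow> (\<exists>W. open W \<and> x \<in> W \<and> smooth_fun M W f)"

text \<open>The tangent vector at \<open>x\<close> with coordinates \<open>w\<close> in the chart \<open>c\<close>; for fixed \<open>w\<close>, the
  coordinate vector field of \<open>c\<close> with constant coefficients \<open>w\<close>.\<close>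

definition coord_vec ::
  "('m::topological_space, 'n::finite) riem \<Rightarrow> ('m, 'n) chart \<Rightarrow> 'm \<Rightarrow> real ^ 'n \<Rightarrow> 'm tangent" where
  "coord_vec M c x w = (\<lambda>f. if smooth_near M x f
     then frechet_derivative (f \<circ> chart_inv c) (at (snd c x)) w else 0)"

definition tangent_space ::
  "('m::topological_space, 'n::finite) riem \<Rightarrow> 'm \<Rightarrow> 'm tangent set" where
  "tangent_space M x = {coord_vec M c x w | c w. c \<in> atlas M \<and> x \<in> fst c}"

definition tcomb :: "real \<Rightarrow> 'm tangent \<Rightarrow> real \<Rightarrow> 'm tangent \<Rightarrow> 'm tangent" where
  "tcomb a u b v = (\<lambda>f. a * u f + b * v f)"

text \<open>The value \<open>df(v) = v(f)\<close> for complex-valued \<open>f\<close>.\<close>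

definition cdiff :: "('m \<Rightarrow> complex) \<Rightarrow> 'm tangent \<Rightarrow> complex" where
  "cdiff f v = Complex (v (\<lambda>y. Re (f y))) (v (\<lambda>y. Im (f y)))"

definition riemannian_metric :: "('m::topological_space, 'n::finite) riem \<Rightarrow> bool" where
  "riemannian_metric M \<longleftrightarrow>
     (\<forall>x. \<forall>u\<in>tangent_space M x. \<forall>v\<in>tangent_space M x.
        rmetric M x u v = rmetric M x v u \<and>
        (\<forall>w\<in>tangent_space M x. \<forall>a b.
           rmetric M x (tcomb a u b v) w = a * rmetric M x u w + b * rmetric M x v w) \<and>
        (u \<noteq> (\<lambda>f. 0) \<longrightarrow> rmetric M x u u > 0)) \<and>
     (\<forall>c\<in>atlas M. \<forall>w w'.
        smooth_fun M (fst c) (\<lambda>x. rmetric M x (coord_vec M c x w) (coord_vec M c x w')))"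

definition oriented_riemannian_manifold ::
  "('m::t2_space, 'n::finite) riem \<Rightarrow> bool" where
  "oriented_riemannian_manifold M \<longleftrightarrow> oriented_atlas (atlas M) \<and> riemannian_metric M"

definition tangent_onb ::
  "('m::topological_space, 'n::finite) riem \<Rightarrow> 'm \<Rightarrow> ('n \<Rightarrow> 'm tangent) \<Rightarrow> bool" where
  "tangent_onb M x e \<longleftrightarrow> (\<forall>i. e i \<in> tangent_space M x) \<and>
     (\<forall>i j. rmetric M x (e i) (e j) = (if i = j then 1 else 0))"

text \<open>In a positively oriented chart the Riemannian volume form is this density times
  \<open>dx\<^sub>1 \<and> \<dots> \<and> dx\<^sub>n\<close>.\<close>

definition vol_density ::
  "('m::topological_space, 'n::finite) riem \<Rightarrow> ('m, 'n) chart \<Rightarrow> 'm \<Rightarrow> real" where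
  "vol_density M c x = sqrt (det (\<chi> i j.
     rmetric M x (coord_vec M c x (axis i 1)) (coord_vec M c x (axis j 1))))"

text \<open>Continuous weights suffice to integrate continuous densities on a compact manifold.\<close>

definition partition_of_unity ::
  "('m::topological_space, 'n::finite) riem \<Rightarrow> ('m, 'n) chart set \<Rightarrow>
   (('m, 'n) chart \<Rightarrow> 'm \<Rightarrow> real) \<Rightarrow> bool" where
  "partition_of_unity M C \<rho> \<longleftrightarrow> finite C \<and> C \<subseteq> atlas M \<and>
     (\<forall>c\<in>C. continuous_on UNIV (\<rho> c) \<and> (\<forall>x. \<rho> c x \<ge> 0) \<and> closure {x. \<rho> c x \<noteq> 0} \<subseteq> fst c) \<and>
     (\<forall>x. (\<Sum>c\<in>C. \<rho> c x) = 1)"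

text \<open>The integral of \<open>f\<close> times the Riemannian volume form. For continuous \<open>f\<close> it does not depend
  on the partition of unity chosen.\<close>

definition vol_integral ::
  "('m::topological_space, 'n::finite) riem \<Rightarrow> ('m \<Rightarrow> real) \<Rightarrow> real" where
  "vol_integral M f =
     (case (SOME (C, \<rho>). partition_of_unity M C \<rho>) of (C, \<rho>) \<Rightarrow>
        \<Sum>c\<in>C. LINT y : snd c ` fst c | lborel.
          (let x = chart_inv c y in \<rho> c x * f x * vol_density M c x))"


section \<open>Hermitian vector bundles\<close>

text \<open>The fibres are subspaces of one complex vector space \<open>'v\<close> without further structure
  (for an arbitrary bundle, the direct sum of all fibres). The smooth structure is given by local
  frames, that is, by local trivialisations; a frame is a pair of its domain and the
  sections \<open>e\<^sub>i\<close>, \<open>i < r\<close>, with \<open>r\<close> the rank.\<close>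

type_synonym ('m, 'v) frame = "'m set \<times> (nat \<Rightarrow> 'm \<Rightarrow> 'v)"

record ('m, 'v) hbundle =
  fscale :: "complex \<Rightarrow> 'v \<Rightarrow> 'v"
  fibre :: "'m \<Rightarrow> 'v set"
  frank :: nat
  frames :: "('m, 'v) frame set"
  hmetric :: "'m \<Rightarrow> 'v \<Rightarrow> 'v \<Rightarrow> complex"

definition is_coord ::
  "('m, 'v::ab_group_add) hbundle \<Rightarrow> ('m, 'v) frame \<Rightarrow> 'm \<Rightarrow> 'v \<Rightarrow> (nat \<Rightarrow> complex) \<Rightarrow> bool" where
  "is_coord F e x z a \<longleftrightarrow>
     a \<in> extensional {..<frank F} \<and> z = (\<Sum>i<frank F. fscale F (a i) (snd e i x))"

definition frame_coord ::
  "('m, 'v::ab_group_add) hbundle \<Rightarrow> ('m, 'v) frame \<Rightarrow> 'm \<Rightarrow> 'v \<Rightarrow> nat \<Rightarrow> complex" where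
  "frame_coord F e x z = (THE a. is_coord F e x z a)"

definition vector_bundle ::
  "('m::topological_space, 'n::finite) riem \<Rightarrow> ('m, 'v::ab_group_add) hbundle \<Rightarrow> bool" where
  "vector_bundle M F \<longleftrightarrow> vector_space (fscale F) \<and>
     (\<forall>x. module.subspace (fscale F) (fibre F x)) \<and>
     (\<forall>e\<in>frames F. open (fst e)) \<and> (\<Union>e\<in>frames F. fst e) = UNIV \<and>
     (\<forall>e\<in>frames F. \<forall>x\<in>fst e. (\<forall>i<frank F. snd e i x \<in> fibre F x) \<and>
        (\<forall>z\<in>fibre F x. \<exists>!a. is_coord F e x z a)) \<and>
     (\<forall>e\<in>frames F. \<forall>e'\<in>frames F. \<forall>i<frank F. \<forall>j<frank F.
        smooth_fun M (fst e \<inter> fst e') (\<lambda>x. frame_coord F e x (snd e' j x) i))"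

definition hermitian_vector_bundle ::
  "('m::topological_space, 'n::finite) riem \<Rightarrow> ('m, 'v::ab_group_add) hbundle \<Rightarrow> bool" where
  "hermitian_vector_bundle M F \<longleftrightarrow> vector_bundle M F \<and>
     (\<forall>x. \<forall>z\<in>fibre F x. \<forall>w\<in>fibre F x.
        hmetric F x z w = cnj (hmetric F x w z) \<and>
        (\<forall>u\<in>fibre F x. hmetric F x (z + w) u = hmetric F x z u + hmetric F x w u) \<and>
        (\<forall>a. hmetric F x (fscale F a z) w = a * hmetric F x z w) \<and>
        (z \<noteq> 0 \<longrightarrow> Re (hmetric F x z z) > 0)) \<and>
     (\<forall>e\<in>frames F. \<forall>i<frank F. \<forall>j<frank F.
        smooth_fun M (fst e) (\<lambda>x. hmetric F x (snd e i x) (snd e j x)))"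

text \<open>Sections over an open set \<open>W\<close> are total functions of which only the values on \<open>W\<close> matter.\<close>

definition smooth_section ::
  "('m, 'n::finite) riem \<Rightarrow> ('m, 'v::ab_group_add) hbundle \<Rightarrow> 'm set \<Rightarrow> ('m \<Rightarrow> 'v) \<Rightarrow> bool" where
  "smooth_section M F W \<sigma> \<longleftrightarrow> (\<forall>x\<in>W. \<sigma> x \<in> fibre F x) \<and>
     (\<forall>e\<in>frames F. \<forall>i<frank F. smooth_fun M (W \<inter> fst e) (\<lambda>x. frame_coord F e x (\<sigma> x) i))"

definition antihermitian :: "('m, 'v::ab_group_add) hbundle \<Rightarrow> 'm \<Rightarrow> ('v \<Rightarrow> 'v) \<Rightarrow> bool" where
  "antihermitian F x h \<longleftrightarrow>
     (\<forall>z\<in>fibre F x. h z \<in> fibre F x \<and>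
        (\<forall>a. h (fscale F a z) = fscale F a (h z)) \<and>
        (\<forall>w\<in>fibre F x. h (z + w) = h z + h w \<and> hmetric F x (h z) w + hmetric F x z (h w) = 0))"


section \<open>Forms with values in the antihermitian endomorphisms\<close>

text \<open>A \<open>k\<close>-form is evaluated at a point, a list of \<open>k\<close> tangent vectors and an element of the fibre.
  Values at other arguments are irrelevant, so equality of forms is \<open>form_eq\<close>.\<close>

type_synonym ('m, 'v) eform = "'m \<Rightarrow> 'm tangent list \<Rightarrow> 'v \<Rightarrow> 'v"

definition form_eq ::
  "('m::topological_space, 'n::finite) riem \<Rightarrow> ('m, 'v::ab_group_add) hbundle \<Rightarrow> nat \<Rightarrow>
   ('m, 'v) eform \<Rightarrow> ('m, 'v) eform \<Rightarrow> bool" where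
  "form_eq M F k \<omega> \<eta> \<longleftrightarrow>
     (\<forall>x vs. \<forall>z\<in>fibre F x. length vs = k \<and> set vs \<subseteq> tangent_space M x \<longrightarrow> \<omega> x vs z = \<eta> x vs z)"

definition form_zero :: "('m, 'v::ab_group_add) eform" where
  "form_zero = (\<lambda>x vs z. 0)"

definition form_add :: "('m, 'v::ab_group_add) eform \<Rightarrow> ('m, 'v) eform \<Rightarrow> ('m, 'v) eform" where
  "form_add \<omega> \<eta> = (\<lambda>x vs z. \<omega> x vs z + \<eta> x vs z)"

definition form_diff :: "('m, 'v::ab_group_add) eform \<Rightarrow> ('m, 'v) eform \<Rightarrow> ('m, 'v) eform" where
  "form_diff \<omega> \<eta> = (\<lambda>x vs z. \<omega> x vs z - \<eta> x vs z)"

definition form_scale ::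
  "('m, 'v::ab_group_add) hbundle \<Rightarrow> real \<Rightarrow> ('m, 'v) eform \<Rightarrow> ('m, 'v) eform" where
  "form_scale F t \<omega> = (\<lambda>x vs z. fscale F (of_real t) (\<omega> x vs z))"

definition uform ::
  "('m::topological_space, 'n::finite) riem \<Rightarrow> ('m, 'v::ab_group_add) hbundle \<Rightarrow> nat \<Rightarrow>
   ('m, 'v) eform \<Rightarrow> bool" where
  "uform M F k \<omega> \<longleftrightarrow>
     (\<forall>x vs. length vs = k \<and> set vs \<subseteq> tangent_space M x \<longrightarrow>
        antihermitian F x (\<omega> x vs) \<and>
        (\<forall>z\<in>fibre F x.
          (\<forall>i<k. \<forall>u\<in>tangent_space M x. \<forall>v\<in>tangent_space M x. \<forall>a b.
             \<omega> x (vs[i := tcomb a u b v]) z =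
               fscale F (of_real a) (\<omega> x (vs[i := u]) z) +
               fscale F (of_real b) (\<omega> x (vs[i := v]) z)) \<and>
          (\<forall>i<k. \<forall>j<k. i \<noteq> j \<and> vs ! i = vs ! j \<longrightarrow> \<omega> x vs z = 0))) \<and>
     (\<forall>c\<in>atlas M. \<forall>ws W \<sigma>.
        length ws = k \<and> open W \<and> W \<subseteq> fst c \<and> smooth_section M F W \<sigma> \<longrightarrow>
        smooth_section M F W (\<lambda>x. \<omega> x (map (coord_vec M c x) ws) (\<sigma> x)))"

text \<open>\<open>E \<and> E = \<Sum>\<^sub>a\<^sub>b (\<eta>\<^sub>a \<and> \<eta>\<^sub>b) \<otimes> (e\<^sub>a \<circ> e\<^sub>b)\<close> for a 1-form \<open>E = \<Sum>\<^sub>a \<eta>\<^sub>a \<otimes> e\<^sub>a\<close>,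
  with \<open>(\<alpha> \<and> \<beta>)(u, v) = \<alpha>(u) \<beta>(v) - \<alpha>(v) \<beta>(u)\<close>.\<close>

definition wedge_square :: "('m, 'v::ab_group_add) eform \<Rightarrow> ('m, 'v) eform" where
  "wedge_square E = (\<lambda>x vs z.
     E x [vs ! 0] (E x [vs ! 1] z) - E x [vs ! 1] (E x [vs ! 0] z))"


section \<open>Connections\<close>

text \<open>A connection is a morphism of sheaves; \<open>D \<sigma> x v\<close> is the derivative of the local section
  \<open>\<sigma>\<close> at \<open>x\<close> in direction \<open>v\<close> and depends only on the germ of \<open>\<sigma>\<close> at \<open>x\<close>.\<close>

type_synonym ('m, 'v) conn = "('m \<Rightarrow> 'v) \<Rightarrow> 'm \<Rightarrow> 'm tangent \<Rightarrow> 'v"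

definition connection ::
  "('m::topological_space, 'n::finite) riem \<Rightarrow> ('m, 'v::ab_group_add) hbundle \<Rightarrow>
   ('m, 'v) conn \<Rightarrow> bool" where
  "connection M F D \<longleftrightarrow> (\<forall>W \<sigma>. open W \<and> smooth_section M F W \<sigma> \<longrightarrow>
     (\<forall>x\<in>W. \<forall>u\<in>tangent_space M x. D \<sigma> x u \<in> fibre F x \<and>
        (\<forall>v\<in>tangent_space M x. \<forall>a b. D \<sigma> x (tcomb a u b v) =
           fscale F (of_real a) (D \<sigma> x u) + fscale F (of_real b) (D \<sigma> x v))) \<and>
     (\<forall>c\<in>atlas M. \<forall>w. smooth_section M F (W \<inter> fst c) (\<lambda>x. D \<sigma> x (coord_vec M c x w))) \<and>
     (\<forall>\<tau>. smooth_section M F W \<tau> \<longrightarrow> (\<forall>x\<in>W. \<forall>v\<in>tangent_space M x.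
        ((\<forall>y\<in>W. \<sigma> y = \<tau> y) \<longrightarrow> D \<sigma> x v = D \<tau> x v) \<and>
        D (\<lambda>y. \<sigma> y + \<tau> y) x v = D \<sigma> x v + D \<tau> x v)) \<and>
     (\<forall>f. smooth_fun M W f \<longrightarrow> (\<forall>x\<in>W. \<forall>v\<in>tangent_space M x.
        D (\<lambda>y. fscale F (f y) (\<sigma> y)) x v =
          fscale F (cdiff f v) (\<sigma> x) + fscale F (f x) (D \<sigma> x v))))"

definition hermitian_connection ::
  "('m::topological_space, 'n::finite) riem \<Rightarrow> ('m, 'v::ab_group_add) hbundle \<Rightarrow>
   ('m, 'v) conn \<Rightarrow> bool" where
  "hermitian_connection M F D \<longleftrightarrow> connection M F D \<and>
     (\<forall>W \<sigma> \<tau>. open W \<and> smooth_section M F W \<sigma> \<and> smooth_section M F W \<tau> \<longrightarrow>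
        (\<forall>x\<in>W. \<forall>v\<in>tangent_space M x.
           hmetric F x (D \<sigma> x v) (\<tau> x) + hmetric F x (\<sigma> x) (D \<tau> x v) =
             cdiff (\<lambda>y. hmetric F y (\<sigma> y) (\<tau> y)) v))"

text \<open>The connection \<open>D + \<E>\<close> for a 1-form \<open>E\<close>.\<close>

definition conn_add :: "('m, 'v::ab_group_add) conn \<Rightarrow> ('m, 'v) eform \<Rightarrow> ('m, 'v) conn" where
  "conn_add D E = (\<lambda>\<sigma> x v. D \<sigma> x v + E x [v] (\<sigma> x))"

text \<open>To evaluate tensorial expressions at a point, elements of the fibre and tangent vectors are
  extended to a neighbourhood: the former by any smooth local section, the latter by a coordinate
  vector field with constant coefficients. The results do not depend on the extensions (nor on the
  chart).\<close>

definition section_through ::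
  "('m::topological_space, 'n::finite) riem \<Rightarrow> ('m, 'v::ab_group_add) hbundle \<Rightarrow>
   'm \<Rightarrow> 'v \<Rightarrow> 'm \<Rightarrow> 'v" where
  "section_through M F x z =
     (SOME \<sigma>. (\<exists>W. open W \<and> x \<in> W \<and> smooth_section M F W \<sigma>) \<and> \<sigma> x = z)"

definition chart_at :: "('m, 'n::finite) riem \<Rightarrow> 'm \<Rightarrow> ('m, 'n) chart" where
  "chart_at M x = (SOME c. c \<in> atlas M \<and> x \<in> fst c)"

definition field_through ::
  "('m::topological_space, 'n::finite) riem \<Rightarrow> 'm \<Rightarrow> 'm tangent \<Rightarrow> 'm \<Rightarrow> 'm tangent" where
  "field_through M x v =
     (let c = chart_at M x; w = (THE w. coord_vec M c x w = v) in (\<lambda>y. coord_vec M c y w))"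

text \<open>\<open>\<nabla>\<^sup>1(\<beta> \<otimes> \<sigma>) = d\<beta> \<otimes> \<sigma> - \<beta> \<and> \<nabla>\<sigma>\<close> on 1-forms \<open>\<theta> = \<Sum>\<^sub>i dx\<^sub>i \<otimes> \<theta>\<^sub>i\<close> with values in the bundle:
  since \<open>d(dx\<^sub>i) = 0\<close>, its value on \<open>(u, v)\<close> is \<open>\<nabla>\<^sub>u(\<theta>(V)) - \<nabla>\<^sub>v(\<theta>(U))\<close> with \<open>U\<close>, \<open>V\<close> constant in
  the coordinates \<open>x\<close>.\<close>

definition nabla1 ::
  "('m::topological_space, 'n::finite) riem \<Rightarrow> ('m, 'v::ab_group_add) conn \<Rightarrow>
   ('m \<Rightarrow> 'm tangent \<Rightarrow> 'v) \<Rightarrow> 'm \<Rightarrow> 'm tangent \<Rightarrow> 'm tangent \<Rightarrow> 'v" where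
  "nabla1 M D \<theta> x u v =
     D (\<lambda>y. \<theta> y (field_through M x v y)) x u - D (\<lambda>y. \<theta> y (field_through M x u y)) x v"

definition curvature ::
  "('m::topological_space, 'n::finite) riem \<Rightarrow> ('m, 'v::ab_group_add) hbundle \<Rightarrow>
   ('m, 'v) conn \<Rightarrow> ('m, 'v) eform" where
  "curvature M F D = (\<lambda>x vs z. nabla1 M D (D (section_through M F x z)) x (vs ! 0) (vs ! 1))"

definition flat ::
  "('m::topological_space, 'n::finite) riem \<Rightarrow> ('m, 'v::ab_group_add) hbundle \<Rightarrow>
   ('m, 'v) conn \<Rightarrow> bool" where
  "flat M F D \<longleftrightarrow> form_eq M F 2 (curvature M F D) form_zero"

text \<open>The value of \<open>\<nabla> \<circ> h - h \<circ> \<nabla>\<close> at \<open>x\<close> in direction \<open>v\<close>, applied to \<open>z\<close>.\<close>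

definition nabla_end ::
  "('m::topological_space, 'n::finite) riem \<Rightarrow> ('m, 'v::ab_group_add) hbundle \<Rightarrow>
   ('m, 'v) conn \<Rightarrow> ('m \<Rightarrow> 'v \<Rightarrow> 'v) \<Rightarrow> 'm \<Rightarrow> 'm tangent \<Rightarrow> 'v \<Rightarrow> 'v" where
  "nabla_end M F D h x v z =
     (let \<sigma> = section_through M F x z in D (\<lambda>y. h y (\<sigma> y)) x v - h x (D \<sigma> x v))"

text \<open>\<open>\<nabla>(\<beta> \<otimes> h) = d\<beta> \<otimes> h + (-1)\<^sup>k \<beta> \<and> (\<nabla> \<circ> h - h \<circ> \<nabla>)\<close> applied to \<open>\<omega> = \<Sum>\<^sub>I dx\<^sub>I \<otimes> \<omega>\<^sub>I\<close>:
  the terms \<open>d(dx\<^sub>I)\<close> vanish, and expanding the wedge products gives an alternating sum over the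
  arguments.\<close>

definition nabla_form ::
  "('m::topological_space, 'n::finite) riem \<Rightarrow> ('m, 'v::ab_group_add) hbundle \<Rightarrow>
   ('m, 'v) conn \<Rightarrow> ('m, 'v) eform \<Rightarrow> ('m, 'v) eform" where
  "nabla_form M F D \<omega> = (\<lambda>x vs z.
     \<Sum>j<length vs. fscale F ((-1) ^ j)
       (nabla_end M F D
         (\<lambda>y. \<omega> y (map (\<lambda>u. field_through M x u y) (take j vs @ drop (Suc j) vs)))
         x (vs ! j) z))"

text \<open>Cohomology of the complex of forms with differential \<open>nabla_form\<close>, which for flat \<open>D\<close> is the
  cohomology of the sheaf of parallel sections.\<close>

definition cocycles ::
  "('m::topological_space, 'n::finite) riem \<Rightarrow> ('m, 'v::ab_group_add) hbundle \<Rightarrow>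
   ('m, 'v) conn \<Rightarrow> nat \<Rightarrow> ('m, 'v) eform set" where
  "cocycles M F D k =
     {\<omega>. uform M F k \<omega> \<and> form_eq M F (Suc k) (nabla_form M F D \<omega>) form_zero}"

definition coboundary ::
  "('m::topological_space, 'n::finite) riem \<Rightarrow> ('m, 'v::ab_group_add) hbundle \<Rightarrow>
   ('m, 'v) conn \<Rightarrow> nat \<Rightarrow> ('m, 'v) eform \<Rightarrow> bool" where
  "coboundary M F D k \<omega> \<longleftrightarrow> (case k of
       0 \<Rightarrow> form_eq M F 0 \<omega> form_zero
     | Suc l \<Rightarrow> \<exists>\<eta>. uform M F l \<eta> \<and> form_eq M F k \<omega> (nabla_form M F D \<eta>))"

definition cohomologous ::
  "('m::topological_space, 'n::finite) riem \<Rightarrow> ('m, 'v::ab_group_add) hbundle \<Rightarrow>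
   ('m, 'v) conn \<Rightarrow> nat \<Rightarrow> (('m, 'v) eform \<times> ('m, 'v) eform) set" where
  "cohomologous M F D k =
     {(\<omega>, \<eta>). \<omega> \<in> cocycles M F D k \<and> \<eta> \<in> cocycles M F D k \<and>
        coboundary M F D k (form_diff \<eta> \<omega>)}"

definition cohomology ::
  "('m::topological_space, 'n::finite) riem \<Rightarrow> ('m, 'v::ab_group_add) hbundle \<Rightarrow>
   ('m, 'v) conn \<Rightarrow> nat \<Rightarrow> ('m, 'v) eform set set" where
  "cohomology M F D k = cocycles M F D k // cohomologous M F D k"


section \<open>Yang-Mills connections\<close>

text \<open>The ad-invariant metric \<open>-tr(A B) = tr(A B\<^sup>*)\<close> on antihermitian endomorphisms of a fibre,
  computed in a unitary basis.\<close>

definition fibre_onb ::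
  "('m, 'v::ab_group_add) hbundle \<Rightarrow> 'm \<Rightarrow> (nat \<Rightarrow> 'v) \<Rightarrow> bool" where
  "fibre_onb F x e \<longleftrightarrow> (\<forall>i<frank F. e i \<in> fibre F x) \<and>
     (\<forall>i<frank F. \<forall>j<frank F. hmetric F x (e i) (e j) = (if i = j then 1 else 0))"

definition end_inner ::
  "('m, 'v::ab_group_add) hbundle \<Rightarrow> 'm \<Rightarrow> ('v \<Rightarrow> 'v) \<Rightarrow> ('v \<Rightarrow> 'v) \<Rightarrow> real" where
  "end_inner F x A B =
     (let e = (SOME e. fibre_onb F x e) in \<Sum>i<frank F. Re (hmetric F x (A (e i)) (B (e i))))"

text \<open>The pointwise inner product for which \<open>e\<^sup>I \<otimes> h\<close>, \<open>I\<close> increasing, has the norm of \<open>h\<close> if \<open>e\<close> is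
  orthonormal. The Hodge star is defined by \<open>\<xi> \<and> \<star>\<xi>' = \<langle>\<xi>, \<xi>'\<rangle> vol\<close>, so integrating this inner
  product against the volume form gives the inner product of forms.\<close>

definition form_inner_at ::
  "('m::topological_space, 'n::finite) riem \<Rightarrow> ('m, 'v::ab_group_add) hbundle \<Rightarrow> nat \<Rightarrow>
   ('m, 'v) eform \<Rightarrow> ('m, 'v) eform \<Rightarrow> 'm \<Rightarrow> real" where
  "form_inner_at M F k \<omega> \<eta> x = (let e = (SOME e. tangent_onb M x e) in
     (\<Sum>I | length I = k. end_inner F x (\<omega> x (map e I)) (\<eta> x (map e I))) / fact k)"

definition form_inner ::
  "('m::topological_space, 'n::finite) riem \<Rightarrow> ('m, 'v::ab_group_add) hbundle \<Rightarrow> nat \<Rightarrow>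
   ('m, 'v) eform \<Rightarrow> ('m, 'v) eform \<Rightarrow> real" where
  "form_inner M F k \<omega> \<eta> = vol_integral M (form_inner_at M F k \<omega> \<eta>)"

definition YM ::
  "('m::topological_space, 'n::finite) riem \<Rightarrow> ('m, 'v::ab_group_add) hbundle \<Rightarrow>
   ('m, 'v) conn \<Rightarrow> real" where
  "YM M F D = form_inner M F 2 (curvature M F D) (curvature M F D)"

definition yang_mills_connection ::
  "('m::topological_space, 'n::finite) riem \<Rightarrow> ('m, 'v::ab_group_add) hbundle \<Rightarrow>
   ('m, 'v) conn \<Rightarrow> bool" where
  "yang_mills_connection M F D \<longleftrightarrow> hermitian_connection M F D \<and>
     (\<forall>B. uform M F 1 B \<longrightarrow>
        ((\<lambda>\<epsilon>. YM M F (conn_add D (form_scale F \<epsilon> B))) has_real_derivative 0) (at 0))"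


section \<open>The smooth topology on forms\<close>

text \<open>The seminorms of the Frechet topology: suprema, over compact subsets of the domain of a
  chart and a frame, of iterated partial derivatives of the matrix entries of the components.\<close>

definition form_component ::
  "('m::topological_space, 'n::finite) riem \<Rightarrow> ('m, 'v::ab_group_add) hbundle \<Rightarrow>
   ('m, 'n) chart \<Rightarrow> ('m, 'v) frame \<Rightarrow> (real ^ 'n) list \<Rightarrow> nat \<Rightarrow> nat \<Rightarrow>
   ('m, 'v) eform \<Rightarrow> real ^ 'n \<Rightarrow> complex" where
  "form_component M F c e us i j \<omega> = (\<lambda>y. let x = chart_inv c y in
     frame_coord F e x (\<omega> x (map (coord_vec M c x) us) (snd e j x)) i)"

definition smooth_seminorms ::
  "('m::topological_space, 'n::finite) riem \<Rightarrow> ('m, 'v::ab_group_add) hbundle \<Rightarrow> nat \<Rightarrow>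
   (('m, 'v) eform \<Rightarrow> real) set" where
  "smooth_seminorms M F k =
     {(\<lambda>\<omega>. SUP x\<in>K. norm (iter_deriv ws (form_component M F c e us i j \<omega>) (snd c x)))
       | c e us i j ws K.
         c \<in> atlas M \<and> e \<in> frames F \<and> length us = k \<and> i < frank F \<and> j < frank F \<and>
         compact K \<and> K \<noteq> {} \<and> K \<subseteq> fst c \<inter> fst e}"

definition form_tendsto ::
  "('m::topological_space, 'n::finite) riem \<Rightarrow> ('m, 'v::ab_group_add) hbundle \<Rightarrow> nat \<Rightarrow>
   (real \<Rightarrow> ('m, 'v) eform) \<Rightarrow> ('m, 'v) eform \<Rightarrow> real filter \<Rightarrow> bool" where
  "form_tendsto M F k \<omega> \<eta> T \<longleftrightarrow>
     (\<forall>p\<in>smooth_seminorms M F k. ((\<lambda>t. p (form_diff (\<omega> t) \<eta>)) \<longlongrightarrow> 0) T)"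

definition form_bigo ::
  "('m::topological_space, 'n::finite) riem \<Rightarrow> ('m, 'v::ab_group_add) hbundle \<Rightarrow> nat \<Rightarrow>
   (real \<Rightarrow> ('m, 'v) eform) \<Rightarrow> (real \<Rightarrow> real) \<Rightarrow> real filter \<Rightarrow> bool" where
  "form_bigo M F k \<omega> g T \<longleftrightarrow> (\<forall>p\<in>smooth_seminorms M F k. (\<lambda>t. p (\<omega> t)) \<in> O[T](g))"

end

theory Submission
  imports Defs
begin

text \<open>
  For flat \<open>\<nabla>\<close> the curvature of \<open>\<nabla> + sE\<close> is \<open>s\<nabla>E + s\<^sup>2 E \<and> E\<close>. Stationarity of the Yang-Mills
  functional at \<open>\<nabla> + E(t)\<close> in the direction \<open>B = E(t)\<close> gives, with \<open>e = E(t)/t\<close>,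
  \<open>\<parallel>\<nabla>e\<parallel>\<^sup>2 + 3t\<langle>\<langle>\<nabla>e, e \<and> e\<rangle>\<rangle> + 2t\<^sup>2\<parallel>e \<and> e\<parallel>\<^sup>2 = 0\<close>. As \<open>t \<rightarrow> 0\<close>, \<open>e\<close> converges to \<open>E\<^sub>1\<close> together with its
  first derivatives, so \<open>\<parallel>\<nabla>E\<^sub>1\<parallel>\<^sup>2 = 0\<close>. Closedness of \<open>C\<^sub>E\<close> is then algebraic: \<open>\<nabla>\<nabla>E\<^sub>2 = 0\<close> by
  flatness, and \<open>\<nabla>(E\<^sub>1 \<and> E\<^sub>1)\<close> only involves \<open>\<nabla>E\<^sub>1\<close>. No integration by parts is needed.
\<close>

section \<open>Smooth maps\<close>

text \<open>Several definitions make a choice at every point: \<open>curvature\<close> and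
  \<open>nabla_form\<close> choose a chart and a section through the given vector,
  \<open>form_inner_at\<close> chooses orthonormal bases of the tangent space and of the fibre.
  Nothing makes these choices continuous in the point, so most of the work rewrites the values by
  formulas in a fixed chart and frame. Derivatives lose the choice by tensoriality. Traces over
  orthonormal bases lose it by contraction with an inverse Gram matrix, whose entries are continuous
  by Gram-Schmidt.

  The coefficients 1, 3, 2 come from the polynomial s^2 P + 2 s^3 Q + s^4 R, the value of
  \<open>YM\<close> at \<open>D\<close> + s e: differentiate at s = t, multiply by t and divide by 2
  t^2. The limit needs convergence of first derivatives because \<open>nabla_form\<close> is a
  first-order operator. Definiteness of the integrated inner product then turns norm zero into
  closedness.\<close>

lemma frechet_derivative_eqI: "(f has_derivative f') (at x) \<Longrightarrow> frechet_derivative f (at x) = f'"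
  using frechet_derivative_at by metis

section \<open>Calculus of \<open>C_k\<close>: locality, algebra, composition\<close>

lemma C_k_subset: "C_k k S f \<Longrightarrow> T \<subseteq> S \<Longrightarrow> C_k k T f"
  by (induction k arbitrary: f) (auto intro: continuous_on_subset)

lemma C_k_Suc_imp: "C_k (Suc k) S f \<Longrightarrow> C_k k S f"
proof (induction k arbitrary: f)
  case 0
  then show ?case
    by (auto intro!: differentiable_imp_continuous_on differentiable_at_imp_differentiable_on)
next
  case (Suc k)
  then show ?case by (metis C_k.simps(2))
qed

text \<open>Frechet derivatives are taken \<open>at x\<close> in the whole space, so agreement on
  \<open>S\<close> passes to them only because \<open>S\<close> is open.\<close>

lemma C_k_cong:
  assumes "open S" "\<And>x. x \<in> S \<Longrightarrow> f x = g x" "C_k k S f"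
  shows "C_k k S g"
  using assms
proof (induction k arbitrary: f g)
  case 0
  then show ?case by (auto cong: continuous_on_cong)
next
  case (Suc k)
  have fd: "(g has_derivative frechet_derivative f (at x)) (at x)" if "x \<in> S" for x
    using Suc.prems that has_derivative_transform_within_open[OF _ Suc.prems(1) that, of f _ UNIV g]
    by (auto simp: frechet_derivative_works)
  have eq: "frechet_derivative g (at x) = frechet_derivative f (at x)" if "x \<in> S" for x
    using fd[OF that] by (rule frechet_derivative_eqI)
  have "C_k k S (\<lambda>x. frechet_derivative g (at x) v)" for v
    by (rule Suc.IH[OF Suc.prems(1), of "\<lambda>x. frechet_derivative f (at x) v"])
       (use eq Suc.prems in auto)
  then show ?case
    using fd by (auto simp: differentiable_def)
qed

text \<open>The neighbourhood may vary with the point: differentiability and continuity at a point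
  of an open set see only a neighbourhood of that point.\<close>

lemma C_k_local:
  assumes "open S" "\<And>x. x \<in> S \<Longrightarrow> \<exists>T. open T \<and> x \<in> T \<and> C_k k (S \<inter> T) f"
  shows "C_k k S f"
  using assms(2)
proof (induction k arbitrary: f)
  case 0
  show ?case unfolding C_k.simps continuous_on_eq_continuous_at[OF assms(1)]
  proof
    fix x assume x: "x \<in> S"
    then obtain T where "open T" "x \<in> T" "continuous_on (S \<inter> T) f"
      using 0 by auto
    then show "continuous (at x) f"
      using assms(1) x continuous_on_eq_continuous_at[of "S \<inter> T" f] by auto
  qed
next
  case (Suc k)
  show ?case unfolding C_k.simps
  proof (intro conjI ballI allI)
    fix x assume "x \<in> S" then show "f differentiable at x" using Suc.prems[of x] by auto
  next
    fix v show "C_k k S (\<lambda>x. frechet_derivative f (at x) v)"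
    proof (rule Suc.IH)
      fix x assume "x \<in> S"
      then show "\<exists>T. open T \<and> x \<in> T \<and> C_k k (S \<inter> T) (\<lambda>x. frechet_derivative f (at x) v)"
        using Suc.prems[of x] by auto
    qed
  qed
qed

lemma C_k_const: "C_k k S (\<lambda>x. c)"
  by (induction k arbitrary: c) auto

lemma C_k_linear:
  assumes "open S" "bounded_linear L" "C_k k S f"
  shows "C_k k S (\<lambda>x. L (f x))"
  using assms(3)
proof (induction k arbitrary: f)
  case 0
  then show ?case using assms(2) by (auto intro: bounded_linear.continuous_on)
next
  case (Suc k)
  have d: "((\<lambda>x. L (f x)) has_derivative (\<lambda>v. L (frechet_derivative f (at x) v))) (at x)"
    if "x \<in> S" for x
    using Suc.prems that bounded_linear.has_derivative[OF assms(2)]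
    by (auto simp: frechet_derivative_works)
  have "C_k k S (\<lambda>x. frechet_derivative (\<lambda>x. L (f x)) (at x) v)" for v
    by (rule C_k_cong[OF assms(1), of "\<lambda>x. L (frechet_derivative f (at x) v)"])
       (use Suc frechet_derivative_eqI[OF d] in auto)
  then show ?case using d by (auto simp: differentiable_def)
qed

lemma C_k_add:
  assumes "open S" "C_k k S f" "C_k k S g"
  shows "C_k k S (\<lambda>x. f x + g x)"
  using assms(2,3)
proof (induction k arbitrary: f g)
  case 0
  then show ?case by (auto intro: continuous_on_add)
next
  case (Suc k)
  have d: "((\<lambda>x. f x + g x) has_derivative
      (\<lambda>v. frechet_derivative f (at x) v + frechet_derivative g (at x) v)) (at x)"
    if "x \<in> S" for x
    using Suc.prems that by (auto simp: frechet_derivative_works intro!: has_derivative_add)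
  have "C_k k S (\<lambda>x. frechet_derivative (\<lambda>x. f x + g x) (at x) v)" for v
    by (rule C_k_cong[OF assms(1),
          of "\<lambda>x. frechet_derivative f (at x) v + frechet_derivative g (at x) v"])
       (use Suc frechet_derivative_eqI[OF d] in auto)
  then show ?case using d by (auto simp: differentiable_def)
qed

lemma C_k_sum:
  assumes "open S" "\<And>i. i \<in> I \<Longrightarrow> C_k k S (f i)"
  shows "C_k k S (\<lambda>x. \<Sum>i\<in>I. f i x)"
  using assms(2)
  by (induction I rule: infinite_finite_induct) (auto intro: C_k_const C_k_add[OF assms(1)])

text \<open>By the Leibniz rule the derivative is a sum of two terms of the same shape, each pairing
  one derivative with one undifferentiated factor. The latter drops one order by
  \<open>C_k_Suc_imp\<close>, so the induction hypothesis applies to both.\<close>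

lemma C_k_bilinear:
  assumes "open S" "bounded_bilinear B" "C_k k S f" "C_k k S g"
  shows "C_k k S (\<lambda>x. B (f x) (g x))"
  using assms(3,4)
proof (induction k arbitrary: f g)
  case 0
  then show ?case using assms(2) by (auto intro: bounded_bilinear.continuous_on)
next
  case (Suc k)
  have d: "((\<lambda>x. B (f x) (g x)) has_derivative
      (\<lambda>v. B (f x) (frechet_derivative g (at x) v) + B (frechet_derivative f (at x) v) (g x))) (at x)"
    if "x \<in> S" for x
    using Suc.prems that by (auto simp: frechet_derivative_works intro!:
        bounded_bilinear.FDERIV[OF assms(2)])
  have "C_k k S (\<lambda>x. frechet_derivative (\<lambda>x. B (f x) (g x)) (at x) v)" for v
  proof (rule C_k_cong[OF assms(1), of
      "\<lambda>x. B (f x) (frechet_derivative g (at x) v) + B (frechet_derivative f (at x) v) (g x)"])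
    show "C_k k S (\<lambda>x. B (f x) (frechet_derivative g (at x) v) + B (frechet_derivative f (at x) v)
        (g x))"
      using Suc.prems Suc.prems[THEN C_k_Suc_imp] by (intro C_k_add assms(1) Suc.IH) auto
  qed (use frechet_derivative_eqI[OF d] in auto)
  then show ?case using d by (auto simp: differentiable_def)
qed

text \<open>\<open>C_k\<close> differentiates along fixed directions, but the chain rule evaluates
  the derivative of \<open>f\<close> in the direction \<open>frechet_derivative g (at x) v\<close>,
  which moves with \<open>x\<close>. Expanding this direction in \<open>Basis\<close> leaves a
  finite sum of scalar coefficients times derivatives of \<open>f\<close> along fixed vectors, which
  is why the middle space is Euclidean.\<close>

lemma C_k_compose:
  fixes f :: "'b::euclidean_space \<Rightarrow> 'c::real_normed_vector" and g :: "'a::real_normed_vector \<Rightarrow> 'b"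
  assumes "open S" "g ` S \<subseteq> T" "C_k k T f" "C_k k S g"
  shows "C_k k S (\<lambda>x. f (g x))"
  using assms(3,4)
proof (induction k arbitrary: f)
  case 0
  then show ?case using assms(2) by (auto intro: continuous_on_compose2)
next
  case (Suc k)
  have d: "((\<lambda>x. f (g x)) has_derivative
      (\<lambda>v. \<Sum>b\<in>Basis. (frechet_derivative g (at x) v \<bullet> b) *\<^sub>R frechet_derivative f (at (g x)) b)) (at x)"
    if "x \<in> S" for x
  proof -
    have g: "(g has_derivative frechet_derivative g (at x)) (at x)"
      and f: "(f has_derivative frechet_derivative f (at (g x))) (at (g x))"
      using Suc.prems that assms(2) by (auto simp: frechet_derivative_works)
    have L: "linear (frechet_derivative f (at (g x)))"
      using f has_derivative_bounded_linear bounded_linear.linear by blast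
    have "(\<Sum>b\<in>Basis. (frechet_derivative g (at x) v \<bullet> b) *\<^sub>R frechet_derivative f (at (g x)) b)
       = frechet_derivative f (at (g x)) (frechet_derivative g (at x) v)" for v
      by (subst (3) euclidean_representation[symmetric]) (simp only: linear_sum[OF L] linear_scale[OF L])
    then show ?thesis using diff_chain_at[OF g f] by (simp add: o_def)
  qed
  have "C_k k S (\<lambda>x. frechet_derivative (\<lambda>x. f (g x)) (at x) v)" for v
  proof (rule C_k_cong[OF assms(1), of
      "\<lambda>x. \<Sum>b\<in>Basis. (frechet_derivative g (at x) v \<bullet> b) *\<^sub>R frechet_derivative f (at (g x)) b"])
    have "C_k k S (\<lambda>x. frechet_derivative f (at (g x)) b)" for b
      by (rule Suc.IH) (use Suc.prems C_k_Suc_imp in auto)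
    moreover have "C_k k S (\<lambda>x. frechet_derivative g (at x) v \<bullet> b)" for b
      by (rule C_k_linear[OF assms(1) bounded_linear_inner_left]) (use Suc.prems in auto)
    ultimately show "C_k k S (\<lambda>x. \<Sum>b\<in>Basis. (frechet_derivative g (at x) v \<bullet> b) *\<^sub>R
        frechet_derivative f (at (g x)) b)"
      by (intro C_k_sum assms(1) C_k_bilinear[OF assms(1) bounded_bilinear_scaleR])
  qed (use frechet_derivative_eqI[OF d] in auto)
  then show ?case using d by (auto simp: differentiable_def)
qed

lemma smooth_on_subset: "smooth_on S f \<Longrightarrow> T \<subseteq> S \<Longrightarrow> smooth_on T f"
  unfolding smooth_on_def using C_k_subset by blast

lemma smooth_on_cong:
  "open S \<Longrightarrow> (\<And>x. x \<in> S \<Longrightarrow> f x = g x) \<Longrightarrow> smooth_on S f \<Longrightarrow> smooth_on S g"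
  unfolding smooth_on_def using C_k_cong by blast

lemma smooth_on_local:
  assumes "open S" "\<And>x. x \<in> S \<Longrightarrow> \<exists>T. open T \<and> x \<in> T \<and> smooth_on (S \<inter> T) f"
  shows "smooth_on S f"
  unfolding smooth_on_def
proof
  fix k show "C_k k S f"
    by (rule C_k_local[OF assms(1)]) (use assms(2) in \<open>auto simp: smooth_on_def\<close>)
qed

lemma smooth_on_const: "smooth_on S (\<lambda>x. c)"
  by (simp add: smooth_on_def C_k_const)

lemma smooth_on_linear:
  "open S \<Longrightarrow> bounded_linear L \<Longrightarrow> smooth_on S f \<Longrightarrow> smooth_on S (\<lambda>x. L (f x))"
  by (simp add: smooth_on_def C_k_linear)

lemma smooth_on_add:
  "open S \<Longrightarrow> smooth_on S f \<Longrightarrow> smooth_on S g \<Longrightarrow> smooth_on S (\<lambda>x. f x + g x)"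
  by (simp add: smooth_on_def C_k_add)

lemma smooth_on_bilinear:
  "open S \<Longrightarrow> bounded_bilinear B \<Longrightarrow> smooth_on S f \<Longrightarrow> smooth_on S g \<Longrightarrow> smooth_on S (\<lambda>x. B (f x) (g x))"
  by (simp add: smooth_on_def C_k_bilinear)

lemma smooth_on_compose:
  fixes f :: "'b::euclidean_space \<Rightarrow> 'c::real_normed_vector" and g :: "'a::real_normed_vector \<Rightarrow> 'b"
  shows "open S \<Longrightarrow> smooth_on T f \<Longrightarrow> smooth_on S g \<Longrightarrow> g ` S \<subseteq> T \<Longrightarrow> smooth_on S (\<lambda>x. f (g x))"
  by (simp add: smooth_on_def C_k_compose)

lemma smooth_on_differentiable: "smooth_on S f \<Longrightarrow> x \<in> S \<Longrightarrow> f differentiable at x"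
  unfolding smooth_on_def by (metis C_k.simps(2))

lemma smooth_on_has_derivative:
  "smooth_on S f \<Longrightarrow> x \<in> S \<Longrightarrow> (f has_derivative frechet_derivative f (at x)) (at x)"
  using smooth_on_differentiable frechet_derivative_works by blast

lemma smooth_on_continuous: "smooth_on S f \<Longrightarrow> continuous_on S f"
  unfolding smooth_on_def by (metis C_k.simps(1))

lemma smooth_on_frechet_derivative:
  "smooth_on S f \<Longrightarrow> smooth_on S (\<lambda>x. frechet_derivative f (at x) v)"
  unfolding smooth_on_def by (metis C_k.simps(2))

section \<open>Symmetry of second derivatives\<close>

lemma second_difference_mean_value:
  fixes f :: "'a::real_normed_vector \<Rightarrow> real"
  assumes h: "h > 0"
    and S: "\<And>s t. 0 \<le> s \<Longrightarrow> s \<le> h \<Longrightarrow> 0 \<le> t \<Longrightarrow> t \<le> h \<Longrightarrow> x + s *\<^sub>R u + t *\<^sub>R v \<in> S"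
    and f: "smooth_on S f"
  shows "\<exists>s t. 0 < s \<and> s < h \<and> 0 < t \<and> t < h \<and>
    f (x + h *\<^sub>R u + h *\<^sub>R v) - f (x + h *\<^sub>R u) - f (x + h *\<^sub>R v) + f x =
    h^2 * frechet_derivative (\<lambda>y. frechet_derivative f (at y) u) (at (x + s *\<^sub>R u + t *\<^sub>R v)) v"
proof -
  define f1 where "f1 = (\<lambda>y. frechet_derivative f (at y) u)"
  have f1: "smooth_on S f1" unfolding f1_def by (rule smooth_on_frechet_derivative[OF f])
  have d: "((\<lambda>s. g (x + s *\<^sub>R u + t *\<^sub>R v)) has_real_derivative frechet_derivative g (at (x + s
      *\<^sub>R u + t *\<^sub>R v)) u) (at s)"
    and d': "((\<lambda>t. g (x + s *\<^sub>R u + t *\<^sub>R v)) has_real_derivative frechet_derivative g (at (x + s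
        *\<^sub>R u + t *\<^sub>R v)) v) (at t)"
    if "0 \<le> s" "s \<le> h" "0 \<le> t" "t \<le> h" "smooth_on S g" for g :: "'a \<Rightarrow> real" and s t
  proof -
    have D: "(g has_derivative frechet_derivative g (at (x + s *\<^sub>R u + t *\<^sub>R v))) (at (x + s *\<^sub>R u
        + t *\<^sub>R v))"
      by (rule smooth_on_has_derivative[OF that(5) S]) (use that in auto)
    then have L: "linear (frechet_derivative g (at (x + s *\<^sub>R u + t *\<^sub>R v)))"
      using has_derivative_bounded_linear bounded_linear.linear by blast
    show "((\<lambda>s. g (x + s *\<^sub>R u + t *\<^sub>R v)) has_real_derivative frechet_derivative g (at (x + s *\<^sub>R
        u + t *\<^sub>R v)) u) (at s)"
      unfolding has_field_derivative_def
      by (rule has_derivative_eq_rhs, rule has_derivative_compose[where g=g and f="\<lambda>s. x + s *\<^sub>R u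
          + t *\<^sub>R v", OF _ D])
         (auto intro!: derivative_eq_intros simp: linear_scale[OF L] mult.commute)
    show "((\<lambda>t. g (x + s *\<^sub>R u + t *\<^sub>R v)) has_real_derivative frechet_derivative g (at (x + s *\<^sub>R
        u + t *\<^sub>R v)) v) (at t)"
      unfolding has_field_derivative_def
      by (rule has_derivative_eq_rhs, rule has_derivative_compose[where g=g and f="\<lambda>t. x + s *\<^sub>R u
          + t *\<^sub>R v", OF _ D])
         (auto intro!: derivative_eq_intros simp: linear_scale[OF L] mult.commute)
  qed
  \<comment> \<open>The second difference is the increment, as s runs from 0 to h, of f(x + s u + h
    v) - f(x + s u). A second use of the mean value theorem, along \<open>v\<close> for
    \<open>f1\<close>, follows. The terms \<open>0 *\<^sub>R v\<close> are kept so that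
    \<open>d\<close> and \<open>d'\<close> match.\<close>
  have "\<exists>s. 0 < s \<and> s < h \<and>
     (f (x + h *\<^sub>R u + h *\<^sub>R v) - f (x + h *\<^sub>R u + 0 *\<^sub>R v)) - (f (x + 0 *\<^sub>R u + h *\<^sub>R v) - f (x +
         0 *\<^sub>R u + 0 *\<^sub>R v))
     = (h - 0) * (f1 (x + s *\<^sub>R u + h *\<^sub>R v) - f1 (x + s *\<^sub>R u + 0 *\<^sub>R v))"
    unfolding f1_def
    using MVT2[OF h, of "\<lambda>s. f (x + s *\<^sub>R u + h *\<^sub>R v) - f (x + s *\<^sub>R u + 0 *\<^sub>R v)"] h f
    by (simp add: d DERIV_diff del: scaleR_zero_left)
  then obtain s where s: "0 < s" "s < h" and e1:
     "(f (x + h *\<^sub>R u + h *\<^sub>R v) - f (x + h *\<^sub>R u + 0 *\<^sub>R v)) - (f (x + 0 *\<^sub>R u + h *\<^sub>R v) - f (x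
         + 0 *\<^sub>R u + 0 *\<^sub>R v))
     = (h - 0) * (f1 (x + s *\<^sub>R u + h *\<^sub>R v) - f1 (x + s *\<^sub>R u + 0 *\<^sub>R v))" by blast
  have "\<exists>t. 0 < t \<and> t < h \<and> f1 (x + s *\<^sub>R u + h *\<^sub>R v) - f1 (x + s *\<^sub>R u + 0 *\<^sub>R v)
     = (h - 0) * frechet_derivative f1 (at (x + s *\<^sub>R u + t *\<^sub>R v)) v"
    using MVT2[OF h, of "\<lambda>t. f1 (x + s *\<^sub>R u + t *\<^sub>R v)"] s f1
    by (simp add: d' del: scaleR_zero_left)
  then obtain t where t: "0 < t" "t < h" and e2: "f1 (x + s *\<^sub>R u + h *\<^sub>R v) - f1 (x + s *\<^sub>R u + 0 *\<^sub>R v)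
     = (h - 0) * frechet_derivative f1 (at (x + s *\<^sub>R u + t *\<^sub>R v)) v" by blast
  show ?thesis
    using s t e1 unfolding e2 by (intro exI[of _ s] exI[of _ t]) (simp add: f1_def power2_eq_square)
qed

text \<open>The second difference quotient is symmetric in \<open>u\<close> and \<open>v\<close>.
  The mean value theorem in either order writes it as a mixed derivative at a point that approaches
  \<open>x\<close> with \<open>h n\<close>, so by continuity it converges to both mixed derivatives
  at \<open>x\<close>.\<close>

lemma second_derivative_symmetric_real:
  fixes f :: "'a::real_normed_vector \<Rightarrow> real"
  assumes S: "open S" "x \<in> S" and f: "smooth_on S f"
  shows "frechet_derivative (\<lambda>y. frechet_derivative f (at y) u) (at x) v =
         frechet_derivative (\<lambda>y. frechet_derivative f (at y) v) (at x) u"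
proof -
  define G where "G = (\<lambda>u v y. frechet_derivative (\<lambda>y. frechet_derivative f (at y) u) (at y) v)"
  obtain r where r: "r > 0" "ball x r \<subseteq> S" using S open_contains_ball by metis
  \<comment> \<open>The summand 1 keeps \<open>m\<close> positive when both vectors vanish. The 2 in
    the definition of \<open>h\<close> makes \<open>h n * m < r\<close> strict already for
    \<open>n = 0\<close>.\<close>
  define m where "m = norm u + norm v + 1"
  have m: "m > 0" unfolding m_def by (smt (verit) norm_ge_zero)
  have key: "(\<lambda>n. (G a b) (y n)) \<longlonglongrightarrow> G a b x" if "y \<longlonglongrightarrow> x" for a b y
  proof -
    have "continuous_on S (G a b)"
      unfolding G_def by (intro smooth_on_continuous smooth_on_frechet_derivative f)
    then have "isCont (G a b) x" using S continuous_on_eq_continuous_at by blast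
    then show ?thesis using that isCont_tendsto_compose by blast
  qed
  define h where "h = (\<lambda>n. r / m / real (n + 2))"
  have h: "h n > 0" for n using r m by (simp add: h_def)
  have h0: "h \<longlonglongrightarrow> 0" unfolding h_def
    by (rule LIMSEQ_ignore_initial_segment) (rule lim_const_over_n)
  have hr: "h n * m < r" for n
  proof -
    have "h n * m = r / real (n + 2)" using m by (simp add: h_def)
    also have "\<dots> < r" using r by (simp add: divide_less_eq)
    finally show ?thesis .
  qed
  have inS: "x + s *\<^sub>R a + t *\<^sub>R b \<in> S" if "0 \<le> s" "s \<le> h n" "0 \<le> t" "t \<le> h n" "{a,b} = {u,v}" for
      s t n a b
  proof -
    have "norm (s *\<^sub>R a + t *\<^sub>R b) \<le> s * norm a + t * norm b"
      using norm_triangle_ineq[of "s *\<^sub>R a" "t *\<^sub>R b"] that by simp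
    also have "\<dots> \<le> h n * norm a + h n * norm b"
      using that by (intro add_mono mult_right_mono) auto
    also have "\<dots> = h n * (norm a + norm b)" by (simp add: algebra_simps)
    also have "\<dots> \<le> h n * m" using h[of n] that(5)
      unfolding m_def by (intro mult_left_mono) (auto simp: doubleton_eq_iff)
    also have "\<dots> < r" by (rule hr)
    finally have "x + (s *\<^sub>R a + t *\<^sub>R b) \<in> ball x r" by (simp add: dist_norm) (metis add.commute
        norm_minus_cancel minus_add_distrib uminus_add_conv_diff)
    then show ?thesis using r by (auto simp: add.assoc)
  qed
  have lim: "(\<lambda>n. x + s n *\<^sub>R a + t n *\<^sub>R b) \<longlonglongrightarrow> x"
    if "\<And>n. 0 < s n" "\<And>n. s n < h n" "\<And>n. 0 < t n" "\<And>n. t n < h n" for s t and a b :: 'a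
  proof -
    have "s \<longlonglongrightarrow> 0" "t \<longlonglongrightarrow> 0"
      using that
      by (auto intro!: real_tendsto_sandwich[OF _ _ tendsto_const h0] always_eventually less_imp_le)
    then have "(\<lambda>n. x + s n *\<^sub>R a + t n *\<^sub>R b) \<longlonglongrightarrow> x + 0 *\<^sub>R a + 0 *\<^sub>R b"
      by (intro tendsto_intros)
    then show ?thesis by simp
  qed
  define \<Delta> where "\<Delta> = (\<lambda>n. (f (x + h n *\<^sub>R u + h n *\<^sub>R v) - f (x + h n *\<^sub>R u) - f (x + h n *\<^sub>R v)
      + f x) / (h n)^2)"
  have "\<forall>n. \<exists>s t. 0 < s \<and> s < h n \<and> 0 < t \<and> t < h n \<and> \<Delta> n = G u v (x + s *\<^sub>R u + t *\<^sub>R v)"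
  proof
    fix n
    show "\<exists>s t. 0 < s \<and> s < h n \<and> 0 < t \<and> t < h n \<and> \<Delta> n = G u v (x + s *\<^sub>R u + t *\<^sub>R v)"
      using second_difference_mean_value[of "h n" x u v S f, OF h inS[of _ n _ u v] f] h[of n]
      unfolding \<Delta>_def G_def by (fastforce simp: insert_commute)
  qed
  then obtain s t where "\<And>n. 0 < s n" "\<And>n. s n < h n" "\<And>n. 0 < t n" "\<And>n. t n < h n"
     "\<And>n. \<Delta> n = G u v (x + s n *\<^sub>R u + t n *\<^sub>R v)" by metis
  then have 1: "\<Delta> \<longlonglongrightarrow> G u v x" using key[OF lim[of s t u v], of u v]
    by (subst ext[of \<Delta> "\<lambda>n. G u v (x + s n *\<^sub>R u + t n *\<^sub>R v)"]) auto
  have "\<forall>n. \<exists>s t. 0 < s \<and> s < h n \<and> 0 < t \<and> t < h n \<and> \<Delta> n = G v u (x + s *\<^sub>R v + t *\<^sub>R u)"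
  proof
    fix n
    show "\<exists>s t. 0 < s \<and> s < h n \<and> 0 < t \<and> t < h n \<and> \<Delta> n = G v u (x + s *\<^sub>R v + t *\<^sub>R u)"
      using second_difference_mean_value[of "h n" x v u S f, OF h inS[of _ n _ v u] f] h[of n]
      unfolding \<Delta>_def G_def by (fastforce simp: insert_commute algebra_simps)
  qed
  then obtain s t where "\<And>n. 0 < s n" "\<And>n. s n < h n" "\<And>n. 0 < t n" "\<And>n. t n < h n"
     "\<And>n. \<Delta> n = G v u (x + s n *\<^sub>R v + t n *\<^sub>R u)" by metis
  then have 2: "\<Delta> \<longlonglongrightarrow> G v u x" using key[OF lim[of s t v u], of v u]
    by (subst ext[of \<Delta> "\<lambda>n. G v u (x + s n *\<^sub>R v + t n *\<^sub>R u)"]) auto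
  show ?thesis using LIMSEQ_unique[OF 1 2] unfolding G_def .
qed

lemma second_derivative_symmetric:
  fixes f :: "'a::real_normed_vector \<Rightarrow> 'b::euclidean_space"
  assumes S: "open S" "x \<in> S" and f: "smooth_on S f"
  shows "frechet_derivative (\<lambda>y. frechet_derivative f (at y) u) (at x) v =
         frechet_derivative (\<lambda>y. frechet_derivative f (at y) v) (at x) u"
proof (rule euclidean_eqI)
  fix b :: 'b assume "b \<in> Basis"
  have comp: "frechet_derivative (\<lambda>y. g y \<bullet> b) (at y) w = frechet_derivative g (at y) w \<bullet> b"
    if "smooth_on S g" "y \<in> S" for g :: "'a \<Rightarrow> 'b" and y w
    using frechet_derivative_eqI[OF bounded_linear.has_derivative[OF bounded_linear_inner_left[of b]
      smooth_on_has_derivative[OF that]]] by simp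
  have two: "frechet_derivative (\<lambda>y. frechet_derivative f (at y) a) (at x) c \<bullet> b =
     frechet_derivative (\<lambda>y. frechet_derivative (\<lambda>y. f y \<bullet> b) (at y) a) (at x) c" for a c
  proof -
    have "frechet_derivative (\<lambda>y. frechet_derivative f (at y) a) (at x) c \<bullet> b =
       frechet_derivative (\<lambda>y. frechet_derivative f (at y) a \<bullet> b) (at x) c"
      using comp[OF smooth_on_frechet_derivative[OF f] S(2)] by simp
    also have "\<dots> = frechet_derivative (\<lambda>y. frechet_derivative (\<lambda>y. f y \<bullet> b) (at y) a) (at x) c"
      using comp[OF f]
      by (subst frechet_derivative_transform_within_open[OF _ S])
         (auto intro!: smooth_on_differentiable[OF smooth_on_linear[OF S(1)
             bounded_linear_inner_left smooth_on_frechet_derivative[OF f]] S(2)])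
    finally show ?thesis .
  qed
  show "frechet_derivative (\<lambda>y. frechet_derivative f (at y) u) (at x) v \<bullet> b =
        frechet_derivative (\<lambda>y. frechet_derivative f (at y) v) (at x) u \<bullet> b"
    unfolding two
    by (rule second_derivative_symmetric_real[OF S smooth_on_linear[OF S(1)
        bounded_linear_inner_left f]])
qed

section \<open>Charts and tangent vectors\<close>

text \<open>Coordinate derivative for functions with values in any normed space.
  \<open>coord_vec\<close> acts on real functions only, while charts and complex matrix entries have
  to be differentiated as well.\<close>

definition chart_deriv ::
  "('m, 'n::finite) chart \<Rightarrow> real ^ 'n \<Rightarrow> ('m \<Rightarrow> 'b::real_normed_vector) \<Rightarrow> 'm \<Rightarrow> 'b" where
  "chart_deriv c w f = (\<lambda>x. frechet_derivative (f \<circ> chart_inv c) (at (snd c x)) w)"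

locale manifold =
  fixes M :: "('m::t2_space, 'n::finite) riem"
  assumes oriented_riemannian_M: "oriented_riemannian_manifold M"
begin

lemma atlas: "oriented_atlas (atlas M)"
  using oriented_riemannian_M by (simp add: oriented_riemannian_manifold_def)

lemma is_chart: "c \<in> atlas M \<Longrightarrow> is_chart c"
  using atlas by (simp add: oriented_atlas_def)

lemma open_chart: "c \<in> atlas M \<Longrightarrow> open (fst c)"
  using is_chart by (simp add: is_chart_def)

lemma chart_inv_chart [simp]: "c \<in> atlas M \<Longrightarrow> x \<in> fst c \<Longrightarrow> chart_inv c (snd c x) = x"
  by (drule is_chart) (auto simp: is_chart_def homeomorphism_def)

lemma continuous_on_chart: "c \<in> atlas M \<Longrightarrow> continuous_on (fst c) (snd c)"
  by (drule is_chart) (auto simp: is_chart_def homeomorphism_def)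

lemma continuous_on_chart_inv: "c \<in> atlas M \<Longrightarrow> continuous_on (snd c ` fst c) (chart_inv c)"
  by (drule is_chart) (auto simp: is_chart_def homeomorphism_def)

lemma ex_chart: "\<exists>c\<in>atlas M. x \<in> fst c"
  using atlas by (auto simp: oriented_atlas_def)

lemma open_chart_image:
  assumes "c \<in> atlas M" "open W"
  shows "open (snd c ` (W \<inter> fst c))"
proof -
  have "snd c ` (W \<inter> fst c) = snd c ` fst c \<inter> chart_inv c -` W"
    using chart_inv_chart[OF assms(1)] by auto
  then show ?thesis
    using is_chart[OF assms(1)] continuous_on_chart_inv[OF assms(1)] assms(2)
    by (metis continuous_open_preimage is_chart_def)
qed

section \<open>Smooth functions on the manifold\<close>

lemma smooth_fun_subset: "smooth_fun M W f \<Longrightarrow> T \<subseteq> W \<Longrightarrow> smooth_fun M T f"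
  unfolding smooth_fun_def by (meson Int_mono image_mono order_refl smooth_on_subset)

lemma smooth_fun_cong:
  assumes "open W" "\<And>x. x \<in> W \<Longrightarrow> f x = g x" "smooth_fun M W f"
  shows "smooth_fun M W g"
  unfolding smooth_fun_def
proof
  fix c assume c: "c \<in> atlas M"
  show "smooth_on (snd c ` (W \<inter> fst c)) (g \<circ> chart_inv c)"
    by (rule smooth_on_cong[OF open_chart_image[OF c assms(1)], of "f \<circ> chart_inv c"])
       (use assms c in \<open>auto simp: smooth_fun_def\<close>)
qed

lemma smooth_fun_local:
  assumes "open W" "\<And>x. x \<in> W \<Longrightarrow> \<exists>T. open T \<and> x \<in> T \<and> smooth_fun M (W \<inter> T) f"
  shows "smooth_fun M W f"
  unfolding smooth_fun_def
proof
  fix c assume c: "c \<in> atlas M"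
  show "smooth_on (snd c ` (W \<inter> fst c)) (f \<circ> chart_inv c)"
  proof (rule smooth_on_local[OF open_chart_image[OF c assms(1)]])
    fix y assume "y \<in> snd c ` (W \<inter> fst c)"
    then obtain x where x: "x \<in> W" "x \<in> fst c" "y = snd c x" by auto
    then obtain T where T: "open T" "x \<in> T" "smooth_fun M (W \<inter> T) f" using assms(2) by blast
    have "snd c ` (W \<inter> fst c) \<inter> snd c ` (T \<inter> fst c) \<subseteq> snd c ` (W \<inter> T \<inter> fst c)"
      using chart_inv_chart[OF c] by (auto simp: image_iff) (metis IntI)
    then show "\<exists>T. open T \<and> y \<in> T \<and> smooth_on (snd c ` (W \<inter> fst c) \<inter> T) (f \<circ> chart_inv c)"
      using T x c open_chart_image[OF c T(1)]
      by (intro exI[of _ "snd c ` (T \<inter> fst c)"]) (auto simp: smooth_fun_def intro: smooth_on_subset)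
  qed
qed

lemma smooth_fun_const: "smooth_fun M W (\<lambda>x. a)"
  by (simp add: smooth_fun_def o_def smooth_on_const)

lemma smooth_fun_add:
  "open W \<Longrightarrow> smooth_fun M W f \<Longrightarrow> smooth_fun M W g \<Longrightarrow> smooth_fun M W (\<lambda>x. f x + g x)"
  by (simp add: smooth_fun_def o_def smooth_on_add open_chart_image)

lemma smooth_fun_linear:
  "open W \<Longrightarrow> bounded_linear L \<Longrightarrow> smooth_fun M W f \<Longrightarrow> smooth_fun M W (\<lambda>x. L (f x))"
  by (simp add: smooth_fun_def o_def smooth_on_linear[of _ L] open_chart_image)

lemma smooth_fun_mult:
  fixes f g :: "'m \<Rightarrow> 'b::real_normed_algebra"
  shows "open W \<Longrightarrow> smooth_fun M W f \<Longrightarrow> smooth_fun M W g \<Longrightarrow> smooth_fun M W (\<lambda>x. f x * g x)"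
  by (simp add: smooth_fun_def o_def smooth_on_bilinear[OF _ bounded_bilinear_mult] open_chart_image)

lemma smooth_fun_chart: "c \<in> atlas M \<Longrightarrow> smooth_fun M (fst c) (snd c)"
  unfolding smooth_fun_def
proof
  fix c' assume "c' \<in> atlas M" "c \<in> atlas M"
  then show "smooth_on (snd c' ` (fst c \<inter> fst c')) (snd c \<circ> chart_inv c')"
    using atlas unfolding oriented_atlas_def by (metis inf_commute)
qed

text \<open>Smoothness in one chart passes to every other chart by composition with the transition
  map, which is smooth by the atlas axioms.\<close>

lemma smooth_fun_comp_chart:
  assumes c: "c \<in> atlas M" and W: "open W" "W \<subseteq> fst c" and g: "smooth_on (snd c ` W) g"
  shows "smooth_fun M W (\<lambda>x. g (snd c x))"
  unfolding smooth_fun_def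
proof
  fix c' assume c': "c' \<in> atlas M"
  show "smooth_on (snd c' ` (W \<inter> fst c')) ((\<lambda>x. g (snd c x)) \<circ> chart_inv c')"
    unfolding o_def
  proof (rule smooth_on_compose[OF open_chart_image[OF c' W(1)] g])
    show "smooth_on (snd c' ` (W \<inter> fst c')) (\<lambda>x. snd c (chart_inv c' x))"
      using smooth_fun_subset[OF smooth_fun_chart[OF c] W(2)] c' by (simp add: smooth_fun_def o_def)
  qed (use c' in auto)
qed

lemma smooth_near_open: "open W \<Longrightarrow> x \<in> W \<Longrightarrow> smooth_fun M W f \<Longrightarrow> smooth_near M x f"
  unfolding smooth_near_def by blast

lemma smooth_near_cong:
  assumes "open W" "x \<in> W" "\<And>y. y \<in> W \<Longrightarrow> f y = g y" "smooth_near M x f"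
  shows "smooth_near M x g"
proof -
  obtain T where T: "open T" "x \<in> T" "smooth_fun M T f"
    using assms(4) unfolding smooth_near_def by blast
  have "smooth_fun M (T \<inter> W) g"
    by (rule smooth_fun_cong[of _ f]) (use T assms smooth_fun_subset[OF T(3)] in auto)
  then show ?thesis using T assms by (intro smooth_near_open[of "T \<inter> W"]) auto
qed

lemma smooth_near_differentiable:
  assumes "c \<in> atlas M" "x \<in> fst c" "smooth_near M x f"
  shows "((f \<circ> chart_inv c) has_derivative frechet_derivative (f \<circ> chart_inv c) (at (snd c x)))
      (at (snd c x))"
proof -
  obtain W where W: "open W" "x \<in> W" "smooth_fun M W f"
    using assms(3) unfolding smooth_near_def by blast
  then show ?thesis
    using assms(1,2)
    by (intro smooth_on_has_derivative[of "snd c ` (W \<inter> fst c)"]) (auto simp: smooth_fun_def)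
qed

section \<open>Derivatives along coordinate vectors\<close>

lemma chart_derivI:
  "((f \<circ> chart_inv c) has_derivative D) (at (snd c x)) \<Longrightarrow> chart_deriv c w f x = D w"
  unfolding chart_deriv_def by (simp add: frechet_derivative_eqI)

lemma chart_deriv_cong:
  assumes c: "c \<in> atlas M" "x \<in> fst c" and W: "open W" "x \<in> W" "\<And>y. y \<in> W \<Longrightarrow> f y = g y"
    and f: "smooth_near M x f"
  shows "chart_deriv c w g x = chart_deriv c w f x"
  unfolding chart_deriv_def[of _ _ f]
  by (rule chart_derivI, rule has_derivative_transform_within_open[OF smooth_near_differentiable[OF c f]
      open_chart_image[OF c(1) W(1)]])
     (use W c in auto)

lemma smooth_fun_chart_deriv:
  assumes c: "c \<in> atlas M" and W: "open W" "W \<subseteq> fst c" and f: "smooth_fun M W f"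
  shows "smooth_fun M W (chart_deriv c w f)"
proof -
  have "smooth_on (snd c ` (W \<inter> fst c)) (f \<circ> chart_inv c)"
    using f c by (simp add: smooth_fun_def)
  then show ?thesis
    unfolding chart_deriv_def Int_absorb2[OF W(2)]
    by (intro smooth_fun_comp_chart[OF c W, of "\<lambda>y. frechet_derivative (f \<circ> chart_inv c) (at y) w"]
        smooth_on_frechet_derivative)
qed

lemma chart_deriv_linear:
  assumes "c \<in> atlas M" "x \<in> fst c" "smooth_near M x f"
  shows "linear (\<lambda>w. chart_deriv c w f x)"
  using smooth_near_differentiable[OF assms] has_derivative_linear
  unfolding chart_deriv_def by blast

lemma chart_deriv_const: "chart_deriv c w (\<lambda>y. a) x = 0"
  by (rule chart_derivI[where D = "\<lambda>_. 0"]) (simp add: o_def)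

lemma chart_deriv_bounded_linear:
  assumes "c \<in> atlas M" "x \<in> fst c" "smooth_near M x f" "bounded_linear L"
  shows "chart_deriv c w (\<lambda>y. L (f y)) x = L (chart_deriv c w f x)"
  using bounded_linear.has_derivative[OF assms(4) smooth_near_differentiable[OF assms(1-3)]]
  unfolding chart_deriv_def[of _ _ f] by (intro chart_derivI) (simp add: o_def)

lemma chart_deriv_chart:
  assumes c: "c \<in> atlas M" "x \<in> fst c"
  shows "chart_deriv c w (snd c) x = w"
proof (rule chart_derivI[where D = "\<lambda>w. w"])
  show "(snd c \<circ> chart_inv c has_derivative (\<lambda>w. w)) (at (snd c x))"
    by (rule has_derivative_transform_within_open[OF has_derivative_ident open_chart_image[OF c(1)
        open_UNIV]])
       (use c in auto)
qed

text \<open>In the chart this is the symmetry of second derivatives. It later cancels the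
  derivatives of the Jacobian under a change of chart, and the second derivatives of a coefficient
  function in the curvature.\<close>

lemma chart_deriv_commute:
  fixes f :: "'m \<Rightarrow> 'b::euclidean_space"
  assumes c: "c \<in> atlas M" and W: "open W" "W \<subseteq> fst c" "x \<in> W" and f: "smooth_fun M W f"
  shows "chart_deriv c u (chart_deriv c v f) x = chart_deriv c v (chart_deriv c u f) x"
proof -
  have o: "open (snd c ` W)" using open_chart_image[OF c W(1)] W(2) by (simp add: Int_absorb2)
  have s: "smooth_on (snd c ` W) (f \<circ> chart_inv c)"
    using f c Int_absorb2[OF W(2)] by (metis smooth_fun_def)
  have e: "chart_deriv c u (chart_deriv c v f) x =
     frechet_derivative (\<lambda>y. frechet_derivative (f \<circ> chart_inv c) (at y) v) (at (snd c x)) u" for u v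
  proof (rule chart_derivI[where D = "\<lambda>u. frechet_derivative (\<lambda>y. frechet_derivative (f \<circ>
      chart_inv c) (at y) v) (at (snd c x)) u"])
    show "(chart_deriv c v f \<circ> chart_inv c has_derivative
      frechet_derivative (\<lambda>y. frechet_derivative (f \<circ> chart_inv c) (at y) v) (at (snd c x))) (at
          (snd c x))"
      by (rule has_derivative_transform_within_open[OF smooth_on_has_derivative[OF
            smooth_on_frechet_derivative[OF s]] o])
         (use W c in \<open>auto simp: chart_deriv_def subset_iff\<close>)
  qed
  show ?thesis unfolding e using W(3) by (intro second_derivative_symmetric[OF o _ s]) auto
qed

text \<open>Chain rule through the transition map; \<open>chart_deriv c' w (snd c) x\<close> is its
  Jacobian applied to \<open>w\<close>.\<close>

lemma chart_deriv_change:
  assumes c: "c \<in> atlas M" "x \<in> fst c" and c': "c' \<in> atlas M" "x \<in> fst c'"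
    and f: "smooth_near M x f"
  shows "chart_deriv c' w f x = chart_deriv c (chart_deriv c' w (snd c) x) f x"
proof -
  have 1: "(snd c \<circ> chart_inv c' has_derivative (\<lambda>w. chart_deriv c' w (snd c) x)) (at (snd c' x))"
    using smooth_near_differentiable[OF c' smooth_near_open[OF open_chart[OF c(1)] c(2)
        smooth_fun_chart[OF c(1)]]]
    by (simp add: chart_deriv_def)
  have x: "(snd c \<circ> chart_inv c') (snd c' x) = snd c x" using c' by simp
  have 2: "(f \<circ> chart_inv c has_derivative (\<lambda>v. chart_deriv c v f x)) (at ((snd c \<circ> chart_inv c')
      (snd c' x)))"
    unfolding x using smooth_near_differentiable[OF c f] by (simp add: chart_deriv_def)
  have "(f \<circ> chart_inv c' has_derivative (\<lambda>w. chart_deriv c (chart_deriv c' w (snd c) x) f x)) (at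
      (snd c' x))"
    by (rule has_derivative_transform_within_open[OF diff_chain_at[OF 1 2, unfolded o_def]
          open_chart_image[OF c'(1) open_chart[OF c(1)]]])
       (use c c' in \<open>auto simp: o_def\<close>)
  then show ?thesis by (rule chart_derivI)
qed

section \<open>Tangent vectors as operators on germs of functions\<close>

lemma coord_vec_apply: "smooth_near M x f \<Longrightarrow> coord_vec M c x w f = chart_deriv c w f x"
  by (simp add: coord_vec_def chart_deriv_def)

lemma coord_vec_not_smooth: "\<not> smooth_near M x f \<Longrightarrow> coord_vec M c x w f = 0"
  by (simp add: coord_vec_def)

lemma coord_vec_change:
  assumes c: "c \<in> atlas M" "x \<in> fst c" and c': "c' \<in> atlas M" "x \<in> fst c'"
  shows "coord_vec M c' x w = coord_vec M c x (chart_deriv c' w (snd c) x)"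
proof
  fix f show "coord_vec M c' x w f = coord_vec M c x (chart_deriv c' w (snd c) x) f"
    by (cases "smooth_near M x f")
       (simp_all add: coord_vec_apply coord_vec_not_smooth chart_deriv_change[OF c c'])
qed

text \<open>\<open>tangent_space\<close> collects the coordinate vectors of all charts around the
  point. By the change of coordinates each of them is a coordinate vector of any one chart, so
  linear combinations can be formed inside a single chart.\<close>

lemma tangent_space_chart:
  assumes "c \<in> atlas M" "x \<in> fst c"
  shows "tangent_space M x = range (coord_vec M c x)"
proof
  show "tangent_space M x \<subseteq> range (coord_vec M c x)"
  proof
    fix v assume "v \<in> tangent_space M x"
    then obtain c' w where c': "c' \<in> atlas M" "x \<in> fst c'" "v = coord_vec M c' x w"
      by (auto simp: tangent_space_def)
    show "v \<in> range (coord_vec M c x)"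
      unfolding c'(3) coord_vec_change[OF assms c'(1,2)] by (rule rangeI)
  qed
  show "range (coord_vec M c x) \<subseteq> tangent_space M x"
    unfolding tangent_space_def using assms by blast
qed

lemma coord_vec_tangent: "c \<in> atlas M \<Longrightarrow> x \<in> fst c \<Longrightarrow> coord_vec M c x w \<in> tangent_space M x"
  unfolding tangent_space_def by blast

lemma coord_vec_tcomb:
  assumes "c \<in> atlas M" "x \<in> fst c"
  shows "coord_vec M c x (a *\<^sub>R w + b *\<^sub>R w') = tcomb a (coord_vec M c x w) b (coord_vec M c x w')"
proof
  fix f
  show "coord_vec M c x (a *\<^sub>R w + b *\<^sub>R w') f = tcomb a (coord_vec M c x w) b (coord_vec M c x w') f"
  proof (cases "smooth_near M x f")
    case True
    then show ?thesis
      by (simp add: coord_vec_apply tcomb_def linear_add[OF chart_deriv_linear[OF assms]]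
          linear_scale[OF chart_deriv_linear[OF assms]])
  qed (simp add: coord_vec_not_smooth tcomb_def)
qed

text \<open>The components of \<open>w\<close> are the values on the coordinate functions.
  Injectivity makes the definite description in \<open>field_through\<close> return the expected
  coordinates.\<close>

lemma coord_vec_inject:
  assumes c: "c \<in> atlas M" "x \<in> fst c"
  shows "coord_vec M c x w = coord_vec M c x w' \<longleftrightarrow> w = w'"
proof
  assume eq: "coord_vec M c x w = coord_vec M c x w'"
  show "w = w'"
  proof (rule euclidean_eqI)
    fix b :: "real ^ 'n" assume "b \<in> Basis"
    have s: "smooth_near M x (snd c)" "smooth_near M x (\<lambda>y. snd c y \<bullet> b)"
      using c(2) open_chart[OF c(1)] smooth_fun_chart[OF c(1)]
      by (auto intro!: smooth_near_open[of "fst c"] smooth_fun_linear[OF _ bounded_linear_inner_left])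
    have "coord_vec M c x w (\<lambda>y. snd c y \<bullet> b) = w \<bullet> b" for w
      by (simp add: coord_vec_apply s chart_deriv_bounded_linear[OF c s(1) bounded_linear_inner_left]
          chart_deriv_chart[OF c])
    then show "w \<bullet> b = w' \<bullet> b" using eq by metis
  qed
qed auto

lemma smooth_near_Re_Im:
  assumes "smooth_near M x (f :: 'm \<Rightarrow> complex)"
  shows "smooth_near M x (\<lambda>y. Re (f y))" "smooth_near M x (\<lambda>y. Im (f y))"
  using assms unfolding smooth_near_def
  using smooth_fun_linear[OF _ bounded_linear_Re, of _ f] smooth_fun_linear[OF _
      bounded_linear_Im, of _ f]
  by auto

lemma cdiff_coord_vec:
  assumes c: "c \<in> atlas M" "x \<in> fst c" and f: "smooth_near M x f"
  shows "cdiff f (coord_vec M c x w) = chart_deriv c w f x"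
  by (simp add: cdiff_def coord_vec_apply smooth_near_Re_Im[OF f] complex_eq_iff
      chart_deriv_bounded_linear[OF c f bounded_linear_Re]
      chart_deriv_bounded_linear[OF c f bounded_linear_Im])

text \<open>Being smooth near a point is itself a property of the germ, so the default value 0 on
  other functions is consistent with it. This lets Hermitian products of sections be replaced by
  locally equal ones under \<open>cdiff\<close> without a discussion of their smoothness.\<close>

lemma tangent_cong:
  assumes v: "v \<in> tangent_space M x" and W: "open W" "x \<in> W" "\<And>y. y \<in> W \<Longrightarrow> f y = g y"
  shows "v f = v g"
proof -
  obtain c w where c: "c \<in> atlas M" "x \<in> fst c" "v = coord_vec M c x w"
    using v by (auto simp: tangent_space_def)
  show ?thesis
  proof (cases "smooth_near M x f")
    case True
    then show ?thesis
      using smooth_near_cong[OF W] chart_deriv_cong[OF c(1,2) W] by (simp add: c coord_vec_apply)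
  next
    case False
    then have "\<not> smooth_near M x g" using smooth_near_cong[OF W(1,2), of g f] W(3) by auto
    with False show ?thesis by (simp add: c coord_vec_not_smooth)
  qed
qed

text \<open>A function and its negative are smooth near the same points, and the default value 0 is
  its own negative.\<close>

lemma tangent_minus:
  assumes v: "v \<in> tangent_space M x"
  shows "v (\<lambda>y. - f y) = - v f"
proof -
  obtain c w where c: "c \<in> atlas M" "x \<in> fst c" "v = coord_vec M c x w"
    using v by (auto simp: tangent_space_def)
  have m: "bounded_linear (\<lambda>a::real. - a)" using bounded_linear_minus[OF bounded_linear_ident] .
  have s: "smooth_near M x f \<Longrightarrow> smooth_near M x (\<lambda>y. - f y)" for f :: "'m \<Rightarrow> real"
    unfolding smooth_near_def using smooth_fun_linear[OF _ m] by blast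
  show ?thesis
  proof (cases "smooth_near M x f")
    case True
    then show ?thesis using s[OF True] chart_deriv_bounded_linear[OF c(1,2) True m]
      by (simp add: c coord_vec_apply)
  next
    case False
    then have "\<not> smooth_near M x (\<lambda>y. - f y)" using s[of "\<lambda>y. - f y"] by auto
    with False show ?thesis by (simp add: c coord_vec_not_smooth)
  qed
qed

lemma chart_at: "chart_at M x \<in> atlas M" "x \<in> fst (chart_at M x)"
proof -
  have "chart_at M x \<in> atlas M \<and> x \<in> fst (chart_at M x)"
    unfolding chart_at_def by (rule someI_ex) (use ex_chart in blast)
  then show "chart_at M x \<in> atlas M" "x \<in> fst (chart_at M x)" by auto
qed

lemma field_through_coord_vec:
  "field_through M x (coord_vec M (chart_at M x) x w) = (\<lambda>y. coord_vec M (chart_at M x) y w)"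
  unfolding field_through_def Let_def using coord_vec_inject[OF chart_at] by simp

lemma tcomb_tangent:
  assumes "u \<in> tangent_space M x" "v \<in> tangent_space M x"
  shows "tcomb a u b v \<in> tangent_space M x"
proof -
  note c = chart_at[of x]
  obtain w w' where "u = coord_vec M (chart_at M x) x w" "v = coord_vec M (chart_at M x) x w'"
    using assms tangent_space_chart[OF c] by auto
  then have "tcomb a u b v = coord_vec M (chart_at M x) x (a *\<^sub>R w + b *\<^sub>R w')"
    by (simp add: coord_vec_tcomb[OF c])
  then show ?thesis using coord_vec_tangent[OF c] by simp
qed

end

section \<open>Germs of sections\<close>

locale hermitian_bundle = manifold M
  for M :: "('m::t2_space, 'n::finite) riem" +
  fixes F :: "('m, 'v::ab_group_add) hbundle"
  assumes hermitian_F: "hermitian_vector_bundle M F"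
begin

lemma vector_bundle_F: "vector_bundle M F"
  using hermitian_F by (simp add: hermitian_vector_bundle_def)

sublocale fs: vector_space "fscale F"
  using vector_bundle_F by (simp add: vector_bundle_def)

section \<open>Fibres and coordinates in a frame\<close>

lemma fibre_subspace: "fs.subspace (fibre F x)"
  using vector_bundle_F by (simp add: vector_bundle_def)

lemma fibre_add: "z \<in> fibre F x \<Longrightarrow> w \<in> fibre F x \<Longrightarrow> z + w \<in> fibre F x"
  using fs.subspace_add[OF fibre_subspace] .

lemma fibre_diff: "z \<in> fibre F x \<Longrightarrow> w \<in> fibre F x \<Longrightarrow> z - w \<in> fibre F x"
  using fs.subspace_diff[OF fibre_subspace] .

lemma fibre_scale: "z \<in> fibre F x \<Longrightarrow> fscale F a z \<in> fibre F x"
  using fs.subspace_scale[OF fibre_subspace] .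

lemma fibre_0: "0 \<in> fibre F x"
  using fs.subspace_0[OF fibre_subspace] .

lemma fibre_sum: "(\<And>i. i \<in> I \<Longrightarrow> z i \<in> fibre F x) \<Longrightarrow> (\<Sum>i\<in>I. z i) \<in> fibre F x"
  using fs.subspace_sum[OF fibre_subspace] .

lemma open_frame: "e \<in> frames F \<Longrightarrow> open (fst e)"
  using vector_bundle_F by (simp add: vector_bundle_def)

lemma ex_frame: "\<exists>e\<in>frames F. x \<in> fst e"
  using vector_bundle_F by (auto simp: vector_bundle_def)

lemma frame_fibre: "e \<in> frames F \<Longrightarrow> x \<in> fst e \<Longrightarrow> i < frank F \<Longrightarrow> snd e i x \<in> fibre F x"
  using vector_bundle_F unfolding vector_bundle_def by blast

lemma is_coord_frame_coord:
  assumes "e \<in> frames F" "x \<in> fst e" "z \<in> fibre F x"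
  shows "is_coord F e x z (frame_coord F e x z)"
proof -
  have "\<exists>!a. is_coord F e x z a" using vector_bundle_F assms unfolding vector_bundle_def by blast
  then show ?thesis unfolding frame_coord_def by (rule theI')
qed

lemma frame_expansion:
  assumes "e \<in> frames F" "x \<in> fst e" "z \<in> fibre F x"
  shows "(\<Sum>i<frank F. fscale F (frame_coord F e x z i) (snd e i x)) = z"
  using is_coord_frame_coord[OF assms] by (simp add: is_coord_def)

lemma frame_coord_unique:
  assumes e: "e \<in> frames F" "x \<in> fst e" and i: "i < frank F"
  shows "frame_coord F e x (\<Sum>i<frank F. fscale F (a i) (snd e i x)) i = a i"
proof -
  let ?z = "\<Sum>i<frank F. fscale F (a i) (snd e i x)"
  have z: "?z \<in> fibre F x" using e by (intro fibre_sum fibre_scale frame_fibre) auto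
  \<comment> \<open>\<open>is_coord\<close> asks for an extensional coefficient function, so
    \<open>a\<close> is cut off outside the index range before uniqueness applies.\<close>
  have "is_coord F e x ?z (restrict a {..<frank F})"
    by (auto simp: is_coord_def intro!: sum.cong)
  moreover have "\<exists>!a. is_coord F e x ?z a" using vector_bundle_F e z unfolding vector_bundle_def by blast
  ultimately have "frame_coord F e x ?z = restrict a {..<frank F}"
    unfolding frame_coord_def by (rule the1_equality[rotated])
  then show ?thesis using i by simp
qed

lemma frame_coord_add:
  assumes e: "e \<in> frames F" "x \<in> fst e" and i: "i < frank F"
    and z: "z \<in> fibre F x" "w \<in> fibre F x"
  shows "frame_coord F e x (z + w) i = frame_coord F e x z i + frame_coord F e x w i"
proof -
  have "(\<Sum>i<frank F. fscale F (frame_coord F e x z i + frame_coord F e x w i) (snd e i x)) = z + w"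
    by (simp add: fs.scale_left_distrib sum.distrib frame_expansion[OF e] z)
  then show ?thesis using frame_coord_unique[OF e i] by metis
qed

lemma frame_coord_scale:
  assumes e: "e \<in> frames F" "x \<in> fst e" and i: "i < frank F" and z: "z \<in> fibre F x"
  shows "frame_coord F e x (fscale F a z) i = a * frame_coord F e x z i"
proof -
  have "(\<Sum>i<frank F. fscale F (a * frame_coord F e x z i) (snd e i x)) =
     fscale F a (\<Sum>i<frank F. fscale F (frame_coord F e x z i) (snd e i x))"
    by (simp add: fs.scale_sum_right)
  also have "\<dots> = fscale F a z" by (simp add: frame_expansion[OF e z])
  finally show ?thesis using frame_coord_unique[OF e i] by metis
qed

lemma frame_coord_0:
  assumes e: "e \<in> frames F" "x \<in> fst e" and i: "i < frank F"
  shows "frame_coord F e x 0 i = 0"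
  using frame_coord_scale[OF e i fibre_0, of 0] by simp

lemma frame_coord_sum:
  assumes e: "e \<in> frames F" "x \<in> fst e" and i: "i < frank F" and z: "\<And>k. k \<in> I \<Longrightarrow> z k \<in> fibre F x"
  shows "frame_coord F e x (\<Sum>k\<in>I. z k) i = (\<Sum>k\<in>I. frame_coord F e x (z k) i)"
  using z
  by (induction I rule: infinite_finite_induct)
     (auto simp: frame_coord_0[OF e i] frame_coord_add[OF e i] fibre_sum)

section \<open>Smooth sections over open sets\<close>

lemma smooth_section_fibre: "smooth_section M F W \<sigma> \<Longrightarrow> x \<in> W \<Longrightarrow> \<sigma> x \<in> fibre F x"
  by (simp add: smooth_section_def)

lemma smooth_section_coord:
  "smooth_section M F W \<sigma> \<Longrightarrow> e \<in> frames F \<Longrightarrow> i < frank F \<Longrightarrow>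
   smooth_fun M (W \<inter> fst e) (\<lambda>x. frame_coord F e x (\<sigma> x) i)"
  unfolding smooth_section_def by blast

lemma smooth_section_subset: "smooth_section M F W \<sigma> \<Longrightarrow> T \<subseteq> W \<Longrightarrow> smooth_section M F T \<sigma>"
  unfolding smooth_section_def by (meson Int_mono order_refl smooth_fun_subset subset_iff)

lemma smooth_section_cong:
  assumes W: "open W" "\<And>x. x \<in> W \<Longrightarrow> \<sigma> x = \<tau> x" and \<sigma>: "smooth_section M F W \<sigma>"
  shows "smooth_section M F W \<tau>"
  unfolding smooth_section_def
proof (intro conjI ballI allI impI)
  fix e i assume e: "e \<in> frames F" "i < frank F"
  show "smooth_fun M (W \<inter> fst e) (\<lambda>x. frame_coord F e x (\<tau> x) i)"
    by (rule smooth_fun_cong[OF _ _ smooth_section_coord[OF \<sigma> e]])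
       (use W open_frame[OF e(1)] in auto)
qed (use W \<sigma> in \<open>auto simp: smooth_section_def\<close>)

lemma smooth_section_local:
  assumes W: "open W" "\<And>x. x \<in> W \<Longrightarrow> \<exists>T. open T \<and> x \<in> T \<and> smooth_section M F T \<sigma>"
  shows "smooth_section M F W \<sigma>"
  unfolding smooth_section_def
proof (intro conjI ballI allI impI)
  fix x assume "x \<in> W" then show "\<sigma> x \<in> fibre F x" using W(2) smooth_section_fibre by blast
next
  fix e i assume e: "e \<in> frames F" "i < frank F"
  show "smooth_fun M (W \<inter> fst e) (\<lambda>x. frame_coord F e x (\<sigma> x) i)"
  proof (rule smooth_fun_local)
    fix x assume "x \<in> W \<inter> fst e"
    then obtain T where "open T" "x \<in> T" "smooth_section M F T \<sigma>" using W by blast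
    then show "\<exists>T. open T \<and> x \<in> T \<and> smooth_fun M (W \<inter> fst e \<inter> T) (\<lambda>x. frame_coord F e x (\<sigma> x) i)"
      using smooth_section_coord[OF _ e] by (blast intro: smooth_fun_subset)
  qed (use W open_frame[OF e(1)] in auto)
qed

lemma smooth_section_add:
  assumes W: "open W" and \<sigma>: "smooth_section M F W \<sigma>" and \<tau>: "smooth_section M F W \<tau>"
  shows "smooth_section M F W (\<lambda>x. \<sigma> x + \<tau> x)"
  unfolding smooth_section_def
proof (intro conjI ballI allI impI)
  fix e i assume e: "e \<in> frames F" "i < frank F"
  have o: "open (W \<inter> fst e)" using W open_frame[OF e(1)] by auto
  show "smooth_fun M (W \<inter> fst e) (\<lambda>x. frame_coord F e x (\<sigma> x + \<tau> x) i)"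
    by (rule smooth_fun_cong[OF o _ smooth_fun_add[OF o smooth_section_coord[OF \<sigma> e]
        smooth_section_coord[OF \<tau> e]]])
       (use e \<sigma> \<tau> in \<open>auto simp: frame_coord_add smooth_section_fibre\<close>)
qed (use \<sigma> \<tau> in \<open>auto simp: smooth_section_fibre fibre_add\<close>)

lemma smooth_section_scale:
  assumes W: "open W" and f: "smooth_fun M W f" and \<sigma>: "smooth_section M F W \<sigma>"
  shows "smooth_section M F W (\<lambda>x. fscale F (f x) (\<sigma> x))"
  unfolding smooth_section_def
proof (intro conjI ballI allI impI)
  fix e i assume e: "e \<in> frames F" "i < frank F"
  have o: "open (W \<inter> fst e)" using W open_frame[OF e(1)] by auto
  show "smooth_fun M (W \<inter> fst e) (\<lambda>x. frame_coord F e x (fscale F (f x) (\<sigma> x)) i)"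
    by (rule smooth_fun_cong[OF o _ smooth_fun_mult[OF o smooth_fun_subset[OF f]
        smooth_section_coord[OF \<sigma> e]]])
       (use e \<sigma> in \<open>auto simp: frame_coord_scale smooth_section_fibre\<close>)
qed (use \<sigma> in \<open>auto simp: smooth_section_fibre fibre_scale\<close>)

lemma smooth_section_frame:
  assumes e: "e \<in> frames F" "i < frank F"
  shows "smooth_section M F (fst e) (snd e i)"
  unfolding smooth_section_def
proof (intro conjI ballI allI impI)
  fix e' j assume e': "e' \<in> frames F" "j < frank F"
  have "smooth_fun M (fst e' \<inter> fst e) (\<lambda>x. frame_coord F e' x (snd e i x) j)"
    using vector_bundle_F e e' unfolding vector_bundle_def by blast
  then show "smooth_fun M (fst e \<inter> fst e') (\<lambda>x. frame_coord F e' x (snd e i x) j)"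
    by (simp add: Int_commute)
qed (use e frame_fibre in auto)

text \<open>Statements about germs of sections at a point avoid the bookkeeping of their domains.\<close>

definition section_near :: "'m \<Rightarrow> ('m \<Rightarrow> 'v) \<Rightarrow> bool" where
  "section_near x \<sigma> \<longleftrightarrow> (\<exists>W. open W \<and> x \<in> W \<and> smooth_section M F W \<sigma>)"

lemma section_near_open: "open W \<Longrightarrow> x \<in> W \<Longrightarrow> smooth_section M F W \<sigma> \<Longrightarrow> section_near x \<sigma>"
  unfolding section_near_def by blast

lemma section_near_imp_smooth_section:
  "open W \<Longrightarrow> (\<And>x. x \<in> W \<Longrightarrow> section_near x \<sigma>) \<Longrightarrow> smooth_section M F W \<sigma>"
  unfolding section_near_def by (rule smooth_section_local)

lemma eventually_section_near: "section_near x \<sigma> \<Longrightarrow> \<forall>\<^sub>F y in nhds x. section_near y \<sigma>"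
  unfolding section_near_def eventually_nhds by blast

lemma eventually_smooth_near: "smooth_near M x f \<Longrightarrow> \<forall>\<^sub>F y in nhds x. smooth_near M y f"
  unfolding smooth_near_def eventually_nhds by blast

lemma section_near_fibre: "section_near x \<sigma> \<Longrightarrow> \<sigma> x \<in> fibre F x"
  unfolding section_near_def using smooth_section_fibre by blast

lemma section_near_cong:
  assumes "section_near x \<sigma>" "\<forall>\<^sub>F y in nhds x. \<sigma> y = \<tau> y"
  shows "section_near x \<tau>"
proof -
  obtain W where W: "open W" "x \<in> W" "smooth_section M F W \<sigma>"
    using assms(1) unfolding section_near_def by blast
  obtain T where T: "open T" "x \<in> T" "\<forall>y\<in>T. \<sigma> y = \<tau> y"
    using assms(2) unfolding eventually_nhds by blast
  have "smooth_section M F (W \<inter> T) \<tau>"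
    by (rule smooth_section_cong[of _ \<sigma>]) (use W T smooth_section_subset[OF W(3)] in auto)
  then show ?thesis using W T by (intro section_near_open[of "W \<inter> T"]) auto
qed

lemma section_near_add:
  assumes "section_near x \<sigma>" "section_near x \<tau>"
  shows "section_near x (\<lambda>y. \<sigma> y + \<tau> y)"
proof -
  obtain W T where "open W" "x \<in> W" "smooth_section M F W \<sigma>" "open T" "x \<in> T" "smooth_section M F T \<tau>"
    using assms unfolding section_near_def by blast
  then show ?thesis
    by (intro section_near_open[of "W \<inter> T"] smooth_section_add) (auto intro: smooth_section_subset)
qed

lemma section_near_scale:
  assumes "smooth_near M x f" "section_near x \<sigma>"
  shows "section_near x (\<lambda>y. fscale F (f y) (\<sigma> y))"
proof -
  obtain W T where "open W" "x \<in> W" "smooth_fun M W f" "open T" "x \<in> T" "smooth_section M F T \<sigma>"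
    using assms unfolding section_near_def smooth_near_def by blast
  then show ?thesis
    by (intro section_near_open[of "W \<inter> T"] smooth_section_scale)
       (auto intro: smooth_section_subset smooth_fun_subset)
qed

lemma smooth_near_const: "smooth_near M x (\<lambda>y. a)"
  by (rule smooth_near_open[of UNIV]) (auto intro: smooth_fun_const)

lemma section_near_scale_const:
  "section_near x \<sigma> \<Longrightarrow> section_near x (\<lambda>y. fscale F a (\<sigma> y))"
  by (rule section_near_scale[OF smooth_near_const])

lemma section_near_diff:
  assumes "section_near x \<sigma>" "section_near x \<tau>"
  shows "section_near x (\<lambda>y. \<sigma> y - \<tau> y)"
  using section_near_add[OF assms(1) section_near_scale_const[OF assms(2), of "-1"]] by simp

lemma section_near_zero: "section_near x (\<lambda>y. 0)"
proof -
  obtain e where e: "e \<in> frames F" "x \<in> fst e" using ex_frame by blast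
  have "smooth_section M F (fst e) (\<lambda>y. 0)"
    unfolding smooth_section_def
  proof (intro conjI ballI allI impI)
    fix e' i assume e': "e' \<in> frames F" "i < frank F"
    show "smooth_fun M (fst e \<inter> fst e') (\<lambda>x. frame_coord F e' x 0 i)"
      by (rule smooth_fun_cong[OF _ _ smooth_fun_const[of _ 0]])
         (use e e' open_frame[OF e(1)] open_frame[OF e'(1)] in \<open>auto simp: frame_coord_0\<close>)
  qed (simp add: fibre_0)
  then show ?thesis using e open_frame[OF e(1)] by (intro section_near_open) auto
qed

lemma section_near_sum:
  "(\<And>i. i \<in> I \<Longrightarrow> section_near x (\<sigma> i)) \<Longrightarrow> section_near x (\<lambda>y. \<Sum>i\<in>I. \<sigma> i y)"
  by (induction I rule: infinite_finite_induct) (auto intro: section_near_zero section_near_add)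

lemma section_near_frame: "e \<in> frames F \<Longrightarrow> x \<in> fst e \<Longrightarrow> i < frank F \<Longrightarrow> section_near x (snd e i)"
  using section_near_open[OF open_frame _ smooth_section_frame] .

lemma section_near_coord:
  assumes "section_near x \<sigma>" "e \<in> frames F" "x \<in> fst e" "i < frank F"
  shows "smooth_near M x (\<lambda>y. frame_coord F e y (\<sigma> y) i)"
proof -
  obtain W where W: "open W" "x \<in> W" "smooth_section M F W \<sigma>"
    using assms(1) unfolding section_near_def by blast
  show ?thesis
    by (rule smooth_near_open[OF _ _ smooth_section_coord[OF W(3) assms(2,4)]])
       (use W assms open_frame[OF assms(2)] in auto)
qed

text \<open>A combination of the sections of a local frame with constant coefficients passes through
  any given vector.\<close>

lemma ex_section_near:
  assumes "z \<in> fibre F x"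
  shows "\<exists>\<sigma>. section_near x \<sigma> \<and> \<sigma> x = z"
proof -
  obtain e where e: "e \<in> frames F" "x \<in> fst e" using ex_frame by blast
  show ?thesis
    using section_near_sum[of "{..<frank F}" x "\<lambda>i y. fscale F (frame_coord F e x z i) (snd e i y)"]
      frame_expansion[OF e assms] section_near_frame[OF e] section_near_scale_const
    by (intro exI[of _ "\<lambda>y. \<Sum>i<frank F. fscale F (frame_coord F e x z i) (snd e i y)"]) auto
qed

lemma section_through:
  assumes "z \<in> fibre F x"
  shows "section_near x (section_through M F x z)" "section_through M F x z x = z"
  using someI_ex[OF ex_section_near[OF assms]]
  unfolding section_through_def section_near_def by auto

text \<open>Expand the section in a frame and pull the coefficients out, evaluated at
  \<open>x\<close>: only the value at \<open>x\<close> is left. The expansion holds only near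
  \<open>x\<close>, hence the assumption on equal germs. The principle removes the dependence on the
  section chosen by \<open>section_through\<close>, both in the curvature and in
  \<open>nabla_end\<close>.\<close>

lemma tensorial_eq:
  assumes add: "\<And>\<sigma> \<tau>. section_near x \<sigma> \<Longrightarrow> section_near x \<tau> \<Longrightarrow> T (\<lambda>y. \<sigma> y + \<tau> y) = T \<sigma> + T \<tau>"
    and cong: "\<And>\<sigma> \<tau>. section_near x \<sigma> \<Longrightarrow> \<forall>\<^sub>F y in nhds x. \<sigma> y = \<tau> y \<Longrightarrow> T \<sigma> = T \<tau>"
    and scale: "\<And>f \<sigma>. smooth_near M x f \<Longrightarrow> section_near x \<sigma> \<Longrightarrow>
      T (\<lambda>y. fscale F (f y) (\<sigma> y)) = fscale F (f x) (T \<sigma>)"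
    and \<sigma>: "section_near x \<sigma>" and \<tau>: "section_near x \<tau>" and eq: "\<sigma> x = \<tau> x"
  shows "T \<sigma> = T \<tau>"
proof -
  obtain e where e: "e \<in> frames F" "x \<in> fst e" using ex_frame by blast
  have zero: "T (\<lambda>y. 0) = 0"
    using scale[OF smooth_near_const[of x 0] section_near_zero] by simp
  have sum: "T (\<lambda>y. \<Sum>i\<in>I. \<rho> i y) = (\<Sum>i\<in>I. T (\<rho> i))"
    if "\<And>i. i \<in> I \<Longrightarrow> section_near x (\<rho> i)" for I :: "nat set" and \<rho>
    using that
    by (induction I rule: infinite_finite_induct) (auto simp: zero add section_near_sum)
  have "T \<rho> = (\<Sum>i<frank F. fscale F (frame_coord F e x (\<rho> x) i) (T (snd e i)))"
    if \<rho>: "section_near x \<rho>" for \<rho>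
  proof -
    have s: "section_near x (\<lambda>y. fscale F (frame_coord F e y (\<rho> y) i) (snd e i y))" if "i < frank
        F" for i
      using that e by (intro section_near_scale section_near_coord \<rho> section_near_frame) auto
    have "T (\<lambda>y. \<Sum>i<frank F. fscale F (frame_coord F e y (\<rho> y) i) (snd e i y)) = T \<rho>"
    proof (rule cong)
      have "\<forall>\<^sub>F y in nhds x. y \<in> fst e" using e open_frame[OF e(1)] by (auto intro:
          eventually_nhds_in_open)
      then show "\<forall>\<^sub>F y in nhds x. (\<Sum>i<frank F. fscale F (frame_coord F e y (\<rho> y) i) (snd e i y)) = \<rho> y"
        using eventually_section_near[OF \<rho>]
        by eventually_elim (use e in \<open>simp add: frame_expansion section_near_fibre\<close>)
    qed (use s in \<open>auto intro: section_near_sum\<close>)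
    then have "T \<rho> = T (\<lambda>y. \<Sum>i<frank F. fscale F (frame_coord F e y (\<rho> y) i) (snd e i y))" ..
    also have "\<dots> = (\<Sum>i<frank F. T (\<lambda>y. fscale F (frame_coord F e y (\<rho> y) i) (snd e i y)))"
      by (rule sum) (use s in auto)
    also have "\<dots> = (\<Sum>i<frank F. fscale F (frame_coord F e x (\<rho> x) i) (T (snd e i)))"
      by (rule sum.cong) (auto intro!: scale section_near_coord[OF \<rho> e] section_near_frame[OF e])
    finally show ?thesis .
  qed
  then show ?thesis using \<sigma> \<tau> eq by simp
qed

section \<open>Algebra of the Hermitian metric\<close>

lemma hmetric_sym: "z \<in> fibre F x \<Longrightarrow> w \<in> fibre F x \<Longrightarrow> hmetric F x z w = cnj (hmetric F x w z)"
  using hermitian_F unfolding hermitian_vector_bundle_def by blast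

lemma hmetric_add_left:
  "z \<in> fibre F x \<Longrightarrow> w \<in> fibre F x \<Longrightarrow> u \<in> fibre F x \<Longrightarrow>
   hmetric F x (z + w) u = hmetric F x z u + hmetric F x w u"
  using hermitian_F unfolding hermitian_vector_bundle_def by blast

lemma hmetric_scale_left:
  "z \<in> fibre F x \<Longrightarrow> w \<in> fibre F x \<Longrightarrow> hmetric F x (fscale F a z) w = a * hmetric F x z w"
  using hermitian_F unfolding hermitian_vector_bundle_def by blast

lemma hmetric_pos: "z \<in> fibre F x \<Longrightarrow> z \<noteq> 0 \<Longrightarrow> Re (hmetric F x z z) > 0"
  using hermitian_F unfolding hermitian_vector_bundle_def by blast

lemma hmetric_add_right:
  "z \<in> fibre F x \<Longrightarrow> w \<in> fibre F x \<Longrightarrow> u \<in> fibre F x \<Longrightarrow>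
   hmetric F x u (z + w) = hmetric F x u z + hmetric F x u w"
  using hmetric_sym[of u x "z + w"] hmetric_sym[of u x z] hmetric_sym[of u x w]
  by (simp add: hmetric_add_left fibre_add)

lemma hmetric_scale_right:
  "z \<in> fibre F x \<Longrightarrow> w \<in> fibre F x \<Longrightarrow> hmetric F x z (fscale F a w) = cnj a * hmetric F x z w"
  using hmetric_sym[of z x "fscale F a w"] hmetric_sym[of z x w]
  by (simp add: hmetric_scale_left fibre_scale)

lemma hmetric_diff_left:
  assumes "z \<in> fibre F x" "w \<in> fibre F x" "u \<in> fibre F x"
  shows "hmetric F x (z - w) u = hmetric F x z u - hmetric F x w u"
  using hmetric_add_left[OF fibre_diff[OF assms(1,2)] assms(2,3)] by simp

lemma hmetric_diff_right:
  assumes "z \<in> fibre F x" "w \<in> fibre F x" "u \<in> fibre F x"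
  shows "hmetric F x u (z - w) = hmetric F x u z - hmetric F x u w"
  using hmetric_add_right[OF fibre_diff[OF assms(1,2)] assms(2,3)] by simp

lemma hmetric_zero: "z \<in> fibre F x \<Longrightarrow> hmetric F x 0 z = 0" "z \<in> fibre F x \<Longrightarrow> hmetric F x z 0 = 0"
  using hmetric_scale_left[OF fibre_0, of z x 0] hmetric_scale_right[OF _ fibre_0, of z x 0] by auto

lemma hmetric_sum_left:
  "(\<And>i. i \<in> I \<Longrightarrow> z i \<in> fibre F x) \<Longrightarrow> w \<in> fibre F x \<Longrightarrow>
   hmetric F x (\<Sum>i\<in>I. z i) w = (\<Sum>i\<in>I. hmetric F x (z i) w)"
  by (induction I rule: infinite_finite_induct) (auto simp: hmetric_zero hmetric_add_left fibre_sum)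

lemma hmetric_sum_right:
  "(\<And>i. i \<in> I \<Longrightarrow> z i \<in> fibre F x) \<Longrightarrow> w \<in> fibre F x \<Longrightarrow>
   hmetric F x w (\<Sum>i\<in>I. z i) = (\<Sum>i\<in>I. hmetric F x w (z i))"
  by (induction I rule: infinite_finite_induct) (auto simp: hmetric_zero hmetric_add_right fibre_sum)

end

section \<open>Forms and connections\<close>

context hermitian_bundle
begin

section \<open>Antihermitian endomorphisms of a fibre\<close>

lemma antihermitian_fibre: "antihermitian F x h \<Longrightarrow> z \<in> fibre F x \<Longrightarrow> h z \<in> fibre F x"
  by (simp add: antihermitian_def)

lemma antihermitian_scale:
  "antihermitian F x h \<Longrightarrow> z \<in> fibre F x \<Longrightarrow> h (fscale F a z) = fscale F a (h z)"
  by (simp add: antihermitian_def)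

lemma antihermitian_add:
  "antihermitian F x h \<Longrightarrow> z \<in> fibre F x \<Longrightarrow> w \<in> fibre F x \<Longrightarrow> h (z + w) = h z + h w"
  by (simp add: antihermitian_def)

lemma antihermitian_diff:
  assumes "antihermitian F x h" "z \<in> fibre F x" "w \<in> fibre F x"
  shows "h (z - w) = h z - h w"
  using antihermitian_add[OF assms(1) fibre_diff[OF assms(2,3)] assms(3)] by (simp add: algebra_simps)

lemma antihermitian_zero: "antihermitian F x h \<Longrightarrow> h 0 = 0"
  using antihermitian_scale[OF _ fibre_0, of x h 0] by simp

lemma antihermitian_sum:
  "antihermitian F x h \<Longrightarrow> (\<And>i. i \<in> I \<Longrightarrow> z i \<in> fibre F x) \<Longrightarrow> h (\<Sum>i\<in>I. z i) = (\<Sum>i\<in>I. h (z i))"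
  by (induction I rule: infinite_finite_induct)
     (auto simp: antihermitian_zero antihermitian_add fibre_sum)

lemma antihermitian_hmetric:
  "antihermitian F x h \<Longrightarrow> z \<in> fibre F x \<Longrightarrow> w \<in> fibre F x \<Longrightarrow>
   hmetric F x (h z) w = - hmetric F x z (h w)"
  unfolding antihermitian_def by (metis eq_neg_iff_add_eq_0)

lemma antihermitian_plus:
  assumes "antihermitian F x h" "antihermitian F x k"
  shows "antihermitian F x (\<lambda>z. h z + k z)"
  using assms antihermitian_hmetric[OF assms(1)] antihermitian_hmetric[OF assms(2)]
  by (auto simp: antihermitian_def fibre_add hmetric_add_left hmetric_add_right fs.scale_right_distrib
      algebra_simps)

lemma antihermitian_minus:
  assumes "antihermitian F x h" "antihermitian F x k"
  shows "antihermitian F x (\<lambda>z. h z - k z)"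
  using assms antihermitian_hmetric[OF assms(1)] antihermitian_hmetric[OF assms(2)]
  by (auto simp: antihermitian_def fibre_diff hmetric_diff_left hmetric_diff_right
      fs.scale_right_diff_distrib
      algebra_simps)

lemma antihermitian_scale_real:
  assumes "antihermitian F x h"
  shows "antihermitian F x (\<lambda>z. fscale F (of_real a) (h z))"
  using assms antihermitian_hmetric[OF assms(1)]
  by (auto simp: antihermitian_def fibre_scale hmetric_scale_left hmetric_scale_right
      fs.scale_right_distrib
      algebra_simps)

text \<open>Taking adjoints reverses the order in each product, while the signs of the two factors
  cancel; so the commutator changes sign. This is what makes \<open>wedge_square\<close> take values
  in the antihermitian endomorphisms.\<close>

lemma antihermitian_commutator:
  assumes h: "antihermitian F x h" and k: "antihermitian F x k"
  shows "antihermitian F x (\<lambda>z. h (k z) - k (h z))"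
  unfolding antihermitian_def
proof (intro ballI conjI allI)
  fix z w a assume z: "z \<in> fibre F x" and w: "w \<in> fibre F x"
  note mem = z w antihermitian_fibre[OF h] antihermitian_fibre[OF k]
  show "h (k z) - k (h z) \<in> fibre F x" by (simp add: mem fibre_diff)
  show "h (k (fscale F a z)) - k (h (fscale F a z)) = fscale F a (h (k z) - k (h z))"
    by (simp add: mem antihermitian_scale[OF h] antihermitian_scale[OF k] fs.scale_right_diff_distrib)
  show "h (k (z + w)) - k (h (z + w)) = h (k z) - k (h z) + (h (k w) - k (h w))"
    by (simp add: mem antihermitian_add[OF h] antihermitian_add[OF k])
  show "hmetric F x (h (k z) - k (h z)) w + hmetric F x z (h (k w) - k (h w)) = 0"
    by (simp add: mem hmetric_diff_left hmetric_diff_right antihermitian_hmetric[OF h]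
        antihermitian_hmetric[OF k])
qed

section \<open>Forms with antihermitian values\<close>

lemma uform_antihermitian:
  "uform M F k \<omega> \<Longrightarrow> length vs = k \<Longrightarrow> set vs \<subseteq> tangent_space M x \<Longrightarrow> antihermitian F x (\<omega> x vs)"
  unfolding uform_def by blast

lemma uform_tcomb:
  "uform M F k \<omega> \<Longrightarrow> length vs = k \<Longrightarrow> set vs \<subseteq> tangent_space M x \<Longrightarrow> z \<in> fibre F x \<Longrightarrow> i < k \<Longrightarrow>
   u \<in> tangent_space M x \<Longrightarrow> v \<in> tangent_space M x \<Longrightarrow>
   \<omega> x (vs[i := tcomb a u b v]) z =
     fscale F (of_real a) (\<omega> x (vs[i := u]) z) + fscale F (of_real b) (\<omega> x (vs[i := v]) z)"
  unfolding uform_def by blast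

lemma uform_alternating:
  "uform M F k \<omega> \<Longrightarrow> length vs = k \<Longrightarrow> set vs \<subseteq> tangent_space M x \<Longrightarrow> z \<in> fibre F x \<Longrightarrow>
   i < k \<Longrightarrow> j < k \<Longrightarrow> i \<noteq> j \<Longrightarrow> vs ! i = vs ! j \<Longrightarrow> \<omega> x vs z = 0"
  unfolding uform_def by blast

lemma uform_section_near:
  assumes \<omega>: "uform M F k \<omega>" "length ws = k" and c: "c \<in> atlas M" "x \<in> fst c" and \<sigma>: "section_near x \<sigma>"
  shows "section_near x (\<lambda>y. \<omega> y (map (coord_vec M c y) ws) (\<sigma> y))"
proof -
  obtain W where W: "open W" "x \<in> W" "smooth_section M F W \<sigma>"
    using \<sigma> unfolding section_near_def by blast
  have W': "open (W \<inter> fst c)" "W \<inter> fst c \<subseteq> fst c" "smooth_section M F (W \<inter> fst c) \<sigma>"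
    using W open_chart[OF c(1)] smooth_section_subset by auto
  then have "smooth_section M F (W \<inter> fst c) (\<lambda>y. \<omega> y (map (coord_vec M c y) ws) (\<sigma> y))"
    using \<omega>(1)[unfolded uform_def, THEN conjunct2, rule_format, OF c(1), of ws "W \<inter> fst c" \<sigma>] \<omega>(2)
    by blast
  then show ?thesis using W' W c by (intro section_near_open[of "W \<inter> fst c"]) auto
qed

lemma uform_1_antihermitian: "uform M F 1 E \<Longrightarrow> v \<in> tangent_space M x \<Longrightarrow> antihermitian F x (E x [v])"
  by (rule uform_antihermitian) auto

lemma uform_1_tcomb:
  "uform M F 1 E \<Longrightarrow> z \<in> fibre F x \<Longrightarrow> u \<in> tangent_space M x \<Longrightarrow> v \<in> tangent_space M x \<Longrightarrow>
   E x [tcomb a u b v] z = fscale F (of_real a) (E x [u] z) + fscale F (of_real b) (E x [v] z)"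
  using uform_tcomb[of 1 E "[u]" x z 0 u v a b] by simp

lemma uform_1_section_near:
  "uform M F 1 E \<Longrightarrow> c \<in> atlas M \<Longrightarrow> x \<in> fst c \<Longrightarrow> section_near x \<sigma> \<Longrightarrow>
   section_near x (\<lambda>y. E y [coord_vec M c y w] (\<sigma> y))"
  using uform_section_near[of 1 E "[w]" c x \<sigma>] by simp

lemma uform_2_antihermitian:
  "uform M F 2 E \<Longrightarrow> u \<in> tangent_space M x \<Longrightarrow> v \<in> tangent_space M x \<Longrightarrow> antihermitian F x (E x [u, v])"
  by (rule uform_antihermitian[of 2]) simp_all

lemma uform_2_section_near:
  "uform M F 2 E \<Longrightarrow> c \<in> atlas M \<Longrightarrow> x \<in> fst c \<Longrightarrow> section_near x \<sigma> \<Longrightarrow>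
   section_near x (\<lambda>y. E y [coord_vec M c y w, coord_vec M c y w'] (\<sigma> y))"
  using uform_section_near[of 2 E "[w, w']" c x \<sigma>] by simp

text \<open>Antisymmetry carries linearity from the first argument to the second, and smoothness is
  asked for germs of sections, so that a verification never has to handle the open set in
  \<open>uform\<close>.\<close>

lemma uform_2I:
  assumes ah: "\<And>x u v. u \<in> tangent_space M x \<Longrightarrow> v \<in> tangent_space M x \<Longrightarrow> antihermitian F x (\<omega> x [u, v])"
    and lin: "\<And>x u v u' a b z. u \<in> tangent_space M x \<Longrightarrow> u' \<in> tangent_space M x \<Longrightarrow> v \<in> tangent_space M x \<Longrightarrow>
       z \<in> fibre F x \<Longrightarrow>
       \<omega> x [tcomb a u b u', v] z = fscale F (of_real a) (\<omega> x [u, v] z) + fscale F (of_real b) (\<omega> x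
           [u', v] z)"
    and alt: "\<And>x u v z. u \<in> tangent_space M x \<Longrightarrow> v \<in> tangent_space M x \<Longrightarrow> z \<in> fibre F x \<Longrightarrow>
       \<omega> x [u, v] z = - \<omega> x [v, u] z"
    and same: "\<And>x u z. u \<in> tangent_space M x \<Longrightarrow> z \<in> fibre F x \<Longrightarrow> \<omega> x [u, u] z = 0"
    and smooth: "\<And>c w w' x \<sigma>. c \<in> atlas M \<Longrightarrow> x \<in> fst c \<Longrightarrow> section_near x \<sigma> \<Longrightarrow>
       section_near x (\<lambda>y. \<omega> y [coord_vec M c y w, coord_vec M c y w'] (\<sigma> y))"
  shows "uform M F 2 \<omega>"
  unfolding uform_def
proof (rule conjI)
  show "\<forall>c\<in>atlas M. \<forall>ws W \<sigma>. length ws = 2 \<and> open W \<and> W \<subseteq> fst c \<and> smooth_section M F W \<sigma> \<longrightarrow>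
        smooth_section M F W (\<lambda>x. \<omega> x (map (coord_vec M c x) ws) (\<sigma> x))"
  proof (intro ballI allI impI, elim conjE)
    fix c W \<sigma> and ws :: "(real ^ 'n) list"
    assume c: "c \<in> atlas M" and ws: "length ws = 2" and W: "open W" "W \<subseteq> fst c" "smooth_section M F W \<sigma>"
    from ws obtain w w' where [simp]: "ws = [w, w']"
      by (metis (no_types) One_nat_def Suc_1 length_0_conv length_Suc_conv)
    show "smooth_section M F W (\<lambda>x. \<omega> x (map (coord_vec M c x) ws) (\<sigma> x))"
      by (rule section_near_imp_smooth_section[OF W(1)])
         (use W c in \<open>auto intro!: smooth section_near_open[OF W(1) _ W(3)]\<close>)
  qed
  have lin2: "\<omega> x [v, tcomb a u b u'] z = fscale F (of_real a) (\<omega> x [v, u] z) + fscale F (of_real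
      b) (\<omega> x [v, u'] z)"
    if "u \<in> tangent_space M x" "u' \<in> tangent_space M x" "v \<in> tangent_space M x" "z \<in> fibre F x"
        for x u u' v a b z
    using that alt[of v x "tcomb a u b u'" z] alt[of v x u z] alt[of v x u' z]
    by (simp add: lin tcomb_tangent)
  show "\<forall>x vs. length vs = 2 \<and> set vs \<subseteq> tangent_space M x \<longrightarrow>
        antihermitian F x (\<omega> x vs) \<and>
        (\<forall>z\<in>fibre F x.
          (\<forall>i<2. \<forall>u\<in>tangent_space M x. \<forall>v\<in>tangent_space M x. \<forall>a b.
             \<omega> x (vs[i := tcomb a u b v]) z =
               fscale F (of_real a) (\<omega> x (vs[i := u]) z) + fscale F (of_real b) (\<omega> x (vs[i := v]) z)) \<and>
          (\<forall>i<2. \<forall>j<2. i \<noteq> j \<and> vs ! i = vs ! j \<longrightarrow> \<omega> x vs z = 0))"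
  proof (intro allI impI, elim conjE)
    fix x and vs :: "'m tangent list"
    assume l: "length vs = 2" and T: "set vs \<subseteq> tangent_space M x"
    from l obtain v w where vs: "vs = [v, w]"
      by (metis (no_types) One_nat_def Suc_1 length_0_conv length_Suc_conv)
    have vw: "v \<in> tangent_space M x" "w \<in> tangent_space M x" using T vs by auto
    show "antihermitian F x (\<omega> x vs) \<and>
        (\<forall>z\<in>fibre F x.
          (\<forall>i<2. \<forall>u\<in>tangent_space M x. \<forall>v\<in>tangent_space M x. \<forall>a b.
             \<omega> x (vs[i := tcomb a u b v]) z =
               fscale F (of_real a) (\<omega> x (vs[i := u]) z) + fscale F (of_real b) (\<omega> x (vs[i := v]) z)) \<and>
          (\<forall>i<2. \<forall>j<2. i \<noteq> j \<and> vs ! i = vs ! j \<longrightarrow> \<omega> x vs z = 0))"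
      using vw by (auto simp: vs ah less_2_cases_iff lin lin2 same)
  qed
qed

text \<open>The target has its scalar multiplication in \<open>fscale F\<close> and not in a type
  class, so linearity is put into one equation; its instance with zero coefficients yields the value
  at 0.\<close>

lemma linear_map_expansion:
  assumes lin: "\<And>a b w w'. f (a *\<^sub>R w + b *\<^sub>R w') = fscale F (of_real a) (f w) + fscale F (of_real
      b) (f w')"
  shows "f (w :: real ^ 'n) = (\<Sum>i\<in>UNIV. fscale F (of_real (w $ i)) (f (axis i 1)))"
proof -
  have zero: "f 0 = 0" using lin[of 0 0 0 0] by simp
  have "f (\<Sum>i\<in>I. w $ i *\<^sub>R axis i 1) = (\<Sum>i\<in>I. fscale F (of_real (w $ i)) (f (axis i 1)))" for I
  proof (induction I rule: infinite_finite_induct)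
    case (insert i I)
    then show ?case using lin[of "w $ i" "axis i 1" 1 "\<Sum>i\<in>I. w $ i *\<^sub>R axis i 1"] by simp
  qed (auto simp: zero)
  then have "f (\<Sum>i\<in>UNIV. w $ i *\<^sub>R axis i 1) = (\<Sum>i\<in>UNIV. fscale F (of_real (w $ i)) (f (axis i 1)))" .
  moreover have "(\<Sum>i\<in>UNIV. w $ i *\<^sub>R axis i 1) = w"
    using basis_expansion[of w] by (simp add: scalar_mult_eq_scaleR)
  ultimately show ?thesis by simp
qed

definition tangent_linear :: "'m \<Rightarrow> ('m tangent \<Rightarrow> 'v) \<Rightarrow> bool" where
  "tangent_linear x \<theta> \<longleftrightarrow> (\<forall>u\<in>tangent_space M x. \<forall>v\<in>tangent_space M x. \<forall>a b.
     \<theta> (tcomb a u b v) = fscale F (of_real a) (\<theta> u) + fscale F (of_real b) (\<theta> v))"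

lemma tangent_linear_expansion:
  assumes "tangent_linear x \<theta>" and c: "c \<in> atlas M" "x \<in> fst c"
  shows "\<theta> (coord_vec M c x w) = (\<Sum>i\<in>UNIV. fscale F (of_real (w $ i)) (\<theta> (coord_vec M c x (axis i 1))))"
  by (rule linear_map_expansion[where f = "\<lambda>w. \<theta> (coord_vec M c x w)"])
     (use assms in \<open>simp add: coord_vec_tcomb[OF c] tangent_linear_def coord_vec_tangent[OF c]\<close>)

text \<open>Germ at \<open>x\<close> of a smooth 1-form with values in the bundle, the kind of
  argument that \<open>nabla1\<close> takes. The two instances used are \<open>D \<sigma>\<close>
  and the form sending \<open>v\<close> to \<open>E y [v] (\<sigma> y)\<close>.\<close>

definition form_near :: "'m \<Rightarrow> ('m \<Rightarrow> 'm tangent \<Rightarrow> 'v) \<Rightarrow> bool" where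
  "form_near x \<theta> \<longleftrightarrow> (\<forall>\<^sub>F y in nhds x. tangent_linear y (\<theta> y)) \<and>
     (\<forall>c\<in>atlas M. x \<in> fst c \<longrightarrow> (\<forall>w. section_near x (\<lambda>y. \<theta> y (coord_vec M c y w))))"

lemma eventually_chart: "c \<in> atlas M \<Longrightarrow> x \<in> fst c \<Longrightarrow> \<forall>\<^sub>F y in nhds x. y \<in> fst c"
  by (rule eventually_nhds_in_open[OF open_chart])

lemma form_near_uform_1:
  assumes E: "uform M F 1 E" and \<sigma>: "section_near x \<sigma>"
  shows "form_near x (\<lambda>y v. E y [v] (\<sigma> y))"
  unfolding form_near_def
proof (intro conjI ballI impI allI)
  show "\<forall>\<^sub>F y in nhds x. tangent_linear y (\<lambda>v. E y [v] (\<sigma> y))"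
    using eventually_section_near[OF \<sigma>]
    by eventually_elim (auto simp: tangent_linear_def uform_1_tcomb[OF E] section_near_fibre)
qed (rule uform_1_section_near[OF E _ _ \<sigma>])

end

locale hermitian_bundle_connection = hermitian_bundle M F
  for M :: "('m::t2_space, 'n::finite) riem" and F :: "('m, 'v::ab_group_add) hbundle" +
  fixes D :: "('m, 'v) conn"
  assumes hermitian_D: "hermitian_connection M F D"
begin

section \<open>Connections on germs of sections\<close>

lemma connection_rules:
  assumes "open W" "smooth_section M F W \<sigma>"
  shows "\<And>x u. x \<in> W \<Longrightarrow> u \<in> tangent_space M x \<Longrightarrow> D \<sigma> x u \<in> fibre F x"
    and "\<And>x u v a b. x \<in> W \<Longrightarrow> u \<in> tangent_space M x \<Longrightarrow> v \<in> tangent_space M x \<Longrightarrow> D \<sigma> x (tcomb a u b v) =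
           fscale F (of_real a) (D \<sigma> x u) + fscale F (of_real b) (D \<sigma> x v)"
    and "\<And>c w. c \<in> atlas M \<Longrightarrow> smooth_section M F (W \<inter> fst c) (\<lambda>x. D \<sigma> x (coord_vec M c x w))"
    and "\<And>\<tau> x v. smooth_section M F W \<tau> \<Longrightarrow> x \<in> W \<Longrightarrow> v \<in> tangent_space M x \<Longrightarrow> \<forall>y\<in>W. \<sigma> y = \<tau> y \<Longrightarrow> D \<sigma> x
        v = D \<tau> x v"
    and "\<And>\<tau> x v. smooth_section M F W \<tau> \<Longrightarrow> x \<in> W \<Longrightarrow> v \<in> tangent_space M x \<Longrightarrow> D (\<lambda>y. \<sigma> y + \<tau> y) x v =
        D \<sigma> x v + D \<tau> x v"
    and "\<And>f x v. smooth_fun M W f \<Longrightarrow> x \<in> W \<Longrightarrow> v \<in> tangent_space M x \<Longrightarrow>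
       D (\<lambda>y. fscale F (f y) (\<sigma> y)) x v = fscale F (cdiff f v) (\<sigma> x) + fscale F (f x) (D \<sigma> x v)"
  using hermitian_D[unfolded hermitian_connection_def connection_def, THEN conjunct1, THEN spec[of _ W],
      THEN spec[of _ \<sigma>], THEN mp, OF conjI[OF assms]]
  by blast+

lemma D_fibre: "section_near x \<sigma> \<Longrightarrow> v \<in> tangent_space M x \<Longrightarrow> D \<sigma> x v \<in> fibre F x"
  unfolding section_near_def using connection_rules(1) by blast

lemma tangent_linear_D: "section_near x \<sigma> \<Longrightarrow> tangent_linear x (D \<sigma> x)"
  unfolding section_near_def tangent_linear_def using connection_rules(2) by blast

lemma D_tcomb: "section_near x \<sigma> \<Longrightarrow> u \<in> tangent_space M x \<Longrightarrow> v \<in> tangent_space M x \<Longrightarrow>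
  D \<sigma> x (tcomb a u b v) = fscale F (of_real a) (D \<sigma> x u) + fscale F (of_real b) (D \<sigma> x v)"
  using tangent_linear_D unfolding tangent_linear_def by blast

lemma section_near_D:
  assumes "section_near x \<sigma>" "c \<in> atlas M" "x \<in> fst c"
  shows "section_near x (\<lambda>y. D \<sigma> y (coord_vec M c y w))"
proof -
  obtain W where W: "open W" "x \<in> W" "smooth_section M F W \<sigma>"
    using assms(1) unfolding section_near_def by blast
  show ?thesis
    by (rule section_near_open[OF _ _ connection_rules(3)[OF W(1,3) assms(2)]]) (use W assms
        open_chart[OF assms(2)] in auto)
qed

lemma D_cong:
  assumes \<sigma>: "section_near x \<sigma>" and eq: "\<forall>\<^sub>F y in nhds x. \<sigma> y = \<tau> y" and v: "v \<in> tangent_space M x"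
  shows "D \<sigma> x v = D \<tau> x v"
proof -
  obtain W where W: "open W" "x \<in> W" "smooth_section M F W \<sigma>"
    using \<sigma> unfolding section_near_def by blast
  obtain T where T: "open T" "x \<in> T" "\<forall>y\<in>T. \<sigma> y = \<tau> y"
    using eq unfolding eventually_nhds by blast
  have s: "smooth_section M F (W \<inter> T) \<sigma>" by (rule smooth_section_subset[OF W(3)]) auto
  have "smooth_section M F (W \<inter> T) \<tau>"
    by (rule smooth_section_cong[OF _ _ s]) (use W T in auto)
  then show ?thesis by (intro connection_rules(4)[OF _ s _ _ v]) (use W T in auto)
qed

lemma D_add:
  assumes "section_near x \<sigma>" "section_near x \<tau>" "v \<in> tangent_space M x"
  shows "D (\<lambda>y. \<sigma> y + \<tau> y) x v = D \<sigma> x v + D \<tau> x v"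
proof -
  obtain W T where W: "open W" "x \<in> W" "smooth_section M F W \<sigma>" "open T" "x \<in> T" "smooth_section M F T \<tau>"
    using assms unfolding section_near_def by blast
  show ?thesis
    by (rule connection_rules(5)[of "W \<inter> T"]) (use W assms in \<open>auto intro: smooth_section_subset\<close>)
qed

lemma D_scale:
  assumes "smooth_near M x f" "section_near x \<sigma>" "v \<in> tangent_space M x"
  shows "D (\<lambda>y. fscale F (f y) (\<sigma> y)) x v = fscale F (cdiff f v) (\<sigma> x) + fscale F (f x) (D \<sigma> x v)"
proof -
  obtain W T where W: "open W" "x \<in> W" "smooth_fun M W f" "open T" "x \<in> T" "smooth_section M F T \<sigma>"
    using assms unfolding section_near_def smooth_near_def by blast
  show ?thesis
    by (rule connection_rules(6)[of "W \<inter> T"]) (use W assms in \<open>auto intro: smooth_section_subset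
        smooth_fun_subset\<close>)
qed

lemma D_scale_const:
  assumes "section_near x \<sigma>" "v \<in> tangent_space M x"
  shows "D (\<lambda>y. fscale F a (\<sigma> y)) x v = fscale F a (D \<sigma> x v)"
proof -
  obtain c w where c: "c \<in> atlas M" "x \<in> fst c" "v = coord_vec M c x w"
    using assms(2) by (auto simp: tangent_space_def)
  have "cdiff (\<lambda>y. a) v = 0"
    using cdiff_coord_vec[OF c(1,2) smooth_near_const] by (simp add: c(3) chart_deriv_const)
  then show ?thesis using D_scale[OF smooth_near_const assms, of a] by simp
qed

lemma D_diff:
  assumes "section_near x \<sigma>" "section_near x \<tau>" "v \<in> tangent_space M x"
  shows "D (\<lambda>y. \<sigma> y - \<tau> y) x v = D \<sigma> x v - D \<tau> x v"
  using D_add[OF assms(1) section_near_scale_const[OF assms(2), of "-1"] assms(3)]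
    D_scale_const[OF assms(2,3), of "-1"] by simp

lemma D_zero: "v \<in> tangent_space M x \<Longrightarrow> D (\<lambda>y. 0) x v = 0"
  using D_scale_const[OF section_near_zero, of v x 0] by simp

lemma D_sum:
  "(\<And>i. i \<in> I \<Longrightarrow> section_near x (\<sigma> i)) \<Longrightarrow> v \<in> tangent_space M x \<Longrightarrow>
   D (\<lambda>y. \<Sum>i\<in>I. \<sigma> i y) x v = (\<Sum>i\<in>I. D (\<sigma> i) x v)"
  by (induction I rule: infinite_finite_induct) (auto simp: D_zero D_add section_near_sum)

lemma form_near_D:
  assumes "section_near x \<sigma>"
  shows "form_near x (D \<sigma>)"
  unfolding form_near_def
  using eventually_section_near[OF assms] section_near_D[OF assms]
  by (auto elim!: eventually_mono simp: tangent_linear_D)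

section \<open>Independence of \<open>nabla1\<close> and of the curvature from chart and
  section\<close>

definition nabla1_chart ::
  "('m, 'n) chart \<Rightarrow> ('m \<Rightarrow> 'm tangent \<Rightarrow> 'v) \<Rightarrow> 'm \<Rightarrow> real ^ 'n \<Rightarrow> real ^ 'n \<Rightarrow> 'v" where
  "nabla1_chart c \<theta> x w w' =
     D (\<lambda>y. \<theta> y (coord_vec M c y w')) x (coord_vec M c x w) -
     D (\<lambda>y. \<theta> y (coord_vec M c y w)) x (coord_vec M c x w')"

lemma smooth_near_of_real_comp:
  assumes "smooth_near M x (f :: 'm \<Rightarrow> real ^ 'n)"
  shows "smooth_near M x (\<lambda>y. complex_of_real (f y $ i))"
proof -
  have "bounded_linear (\<lambda>v :: real ^ 'n. complex_of_real (v $ i))"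
    using bounded_linear_compose[OF bounded_linear_of_real bounded_linear_vec_nth] .
  then show ?thesis using assms smooth_fun_linear unfolding smooth_near_def by blast
qed

text \<open>The Jacobian of the coordinate change is differentiated twice, so the terms with its
  derivatives cancel by symmetry of second derivatives.\<close>

lemma nabla1_chart_change:
  assumes \<theta>: "form_near x \<theta>" and c: "c \<in> atlas M" "x \<in> fst c" and c': "c' \<in> atlas M" "x \<in> fst c'"
  shows "nabla1_chart c' \<theta> x w w' =
    nabla1_chart c \<theta> x (chart_deriv c' w (snd c) x) (chart_deriv c' w' (snd c) x)"
proof -
  define J where "J = (\<lambda>w y. chart_deriv c' w (snd c) y)"
  define \<theta>i where "\<theta>i = (\<lambda>i y. \<theta> y (coord_vec M c y (axis i 1)))"
  have W: "open (fst c \<inter> fst c')" "fst c \<inter> fst c' \<subseteq> fst c'" "x \<in> fst c \<inter> fst c'"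
    using c c' open_chart[OF c(1)] open_chart[OF c'(1)] by auto
  have sc: "smooth_fun M (fst c \<inter> fst c') (snd c)"
    using smooth_fun_subset[OF smooth_fun_chart[OF c(1)]] by auto
  have J: "smooth_near M x (J w)" for w
    unfolding J_def by (rule smooth_near_open[OF W(1,3) smooth_fun_chart_deriv[OF c'(1) W(1,2) sc]])
  have g: "smooth_near M x (\<lambda>y. complex_of_real (J w y $ i))" for w i
    by (rule smooth_near_of_real_comp[OF J])
  have \<theta>i: "section_near x (\<theta>i i)" for i
    using \<theta> c unfolding form_near_def \<theta>i_def by blast
  have T: "coord_vec M c' x w \<in> tangent_space M x" for w using coord_vec_tangent[OF c'] .
  have lin: "\<forall>\<^sub>F y in nhds x. tangent_linear y (\<theta> y)" using \<theta> unfolding form_near_def by blast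
  have ex: "\<forall>\<^sub>F y in nhds x. \<theta> y (coord_vec M c' y w) = (\<Sum>i\<in>UNIV. fscale F (of_real (J w y $ i))
      (\<theta>i i y))" for w
    using lin eventually_chart[OF c] eventually_chart[OF c']
  proof eventually_elim
    case (elim y)
    show ?case unfolding coord_vec_change[OF c(1) elim(2) c'(1) elim(3)] J_def \<theta>i_def
      by (rule tangent_linear_expansion[OF elim(1) c(1) elim(2)])
  qed
  have s: "section_near x (\<lambda>y. \<theta> y (coord_vec M c' y w))" for w
    using \<theta> c' unfolding form_near_def by blast
  have D': "D (\<lambda>y. \<theta> y (coord_vec M c' y w')) x (coord_vec M c' x w) =
     (\<Sum>i\<in>UNIV. fscale F (cdiff (\<lambda>y. of_real (J w' y $ i)) (coord_vec M c' x w)) (\<theta>i i x)) +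
     (\<Sum>i\<in>UNIV. fscale F (of_real (J w' x $ i)) (D (\<theta>i i) x (coord_vec M c' x w)))" for w w'
    unfolding D_cong[OF s ex T]
    by (subst D_sum[OF section_near_scale[OF g \<theta>i] T])
       (simp add: D_scale[OF g \<theta>i T] sum.distrib)
  have L: "bounded_linear (\<lambda>v :: real ^ 'n. complex_of_real (v $ i))" for i
    using bounded_linear_compose[OF bounded_linear_of_real bounded_linear_vec_nth] .
  have cd: "cdiff (\<lambda>y. of_real (J w' y $ i)) (coord_vec M c' x w) =
      of_real (chart_deriv c' w (J w') x $ i)" for w w' i
    by (subst cdiff_coord_vec[OF c' g]) (rule chart_deriv_bounded_linear[OF c' J L])
  have sym: "chart_deriv c' w (J w') x = chart_deriv c' w' (J w) x"
    unfolding J_def by (rule chart_deriv_commute[OF c'(1) W sc])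
  have eq': "nabla1_chart c' \<theta> x w w' =
     (\<Sum>i\<in>UNIV. fscale F (of_real (J w' x $ i)) (D (\<theta>i i) x (coord_vec M c' x w))) -
     (\<Sum>i\<in>UNIV. fscale F (of_real (J w x $ i)) (D (\<theta>i i) x (coord_vec M c' x w')))"
    unfolding nabla1_chart_def D' cd sym by simp
  have sc: "section_near x (\<lambda>y. \<theta> y (coord_vec M c y w))" for w
    using \<theta> c unfolding form_near_def by blast
  have exc: "\<forall>\<^sub>F y in nhds x. \<theta> y (coord_vec M c y w) = (\<Sum>i\<in>UNIV. fscale F (of_real (w $ i)) (\<theta>i i
      y))" for w
    using lin eventually_chart[OF c]
    by eventually_elim (auto simp: \<theta>i_def intro!: tangent_linear_expansion c)
  \<comment> \<open>Relative to \<open>c\<close> the coefficients are constant, so no derivatives of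
    the Jacobian appear. Freezing \<open>J\<close> at \<open>x\<close> as the constant vector
    produces the sums in \<open>eq'\<close>.\<close>
  have Dc: "D (\<lambda>y. \<theta> y (coord_vec M c y w')) x (coord_vec M c' x w) =
     (\<Sum>i\<in>UNIV. fscale F (of_real (w' $ i)) (D (\<theta>i i) x (coord_vec M c' x w)))" for w w'
    unfolding D_cong[OF sc exc T]
    by (subst D_sum[OF section_near_scale_const[OF \<theta>i] T])
       (simp add: D_scale_const[OF \<theta>i T])
  show ?thesis
    unfolding eq' unfolding nabla1_chart_def
    using Dc[of "J w' x" w] Dc[of "J w x" w'] coord_vec_change[OF c c']
    by (simp add: J_def)
qed

text \<open>Frees \<open>nabla1\<close> from the chart that \<open>field_through\<close> picks by
  itself.\<close>

lemma nabla1_eq: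
  assumes \<theta>: "form_near x \<theta>" and c: "c \<in> atlas M" "x \<in> fst c"
  shows "nabla1 M D \<theta> x (coord_vec M c x w) (coord_vec M c x w') = nabla1_chart c \<theta> x w w'"
proof -
  let ?c = "chart_at M x"
  have "nabla1 M D \<theta> x (coord_vec M ?c x w) (coord_vec M ?c x w') = nabla1_chart ?c \<theta> x w w'" for w w'
    by (simp add: nabla1_def nabla1_chart_def field_through_coord_vec)
  then show ?thesis
    using coord_vec_change[OF chart_at c] nabla1_chart_change[OF \<theta> chart_at c] by simp
qed

lemma eventually_eventually_nhds: "\<forall>\<^sub>F y in nhds x. P y \<Longrightarrow> \<forall>\<^sub>F y in nhds x. \<forall>\<^sub>F z in nhds y. P z"
  by (simp add: eventually_eventually)

text \<open>When \<sigma> is multiplied by \<open>f\<close>, the products of a first derivative of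
  \<open>f\<close> with a covariant derivative of \<sigma> enter symmetrically in \<open>w\<close>
  and \<open>w'\<close> and cancel. The second derivatives of \<open>f\<close> cancel by
  \<open>chart_deriv_commute\<close>.\<close>

lemma nabla1_D_tensorial:
  assumes \<sigma>: "section_near x \<sigma>" and \<tau>: "section_near x \<tau>" and eq: "\<sigma> x = \<tau> x"
    and c: "c \<in> atlas M" "x \<in> fst c"
  shows "nabla1_chart c (D \<sigma>) x w w' = nabla1_chart c (D \<tau>) x w w'"
proof (rule tensorial_eq[where T = "\<lambda>\<sigma>. nabla1_chart c (D \<sigma>) x w w'", OF _ _ _ \<sigma> \<tau> eq])
  have T: "coord_vec M c x w \<in> tangent_space M x" for w using coord_vec_tangent[OF c] .
  show "nabla1_chart c (D (\<lambda>y. \<sigma> y + \<tau> y)) x w w' = nabla1_chart c (D \<sigma>) x w w' + nabla1_chart c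
      (D \<tau>) x w w'"
    if s: "section_near x \<sigma>" "section_near x \<tau>" for \<sigma> \<tau>
  proof -
    have e: "\<forall>\<^sub>F y in nhds x. D (\<lambda>y. \<sigma> y + \<tau> y) y (coord_vec M c y w) =
        D \<sigma> y (coord_vec M c y w) + D \<tau> y (coord_vec M c y w)" for w
      using eventually_section_near[OF s(1)] eventually_section_near[OF s(2)] eventually_chart[OF c]
      by eventually_elim (simp add: D_add coord_vec_tangent c)
    have "D (\<lambda>y. D (\<lambda>y. \<sigma> y + \<tau> y) y (coord_vec M c y w)) x (coord_vec M c x w') =
       D (\<lambda>y. D \<sigma> y (coord_vec M c y w)) x (coord_vec M c x w') + D (\<lambda>y. D \<tau> y (coord_vec M c y
           w)) x (coord_vec M c x w')" for w w'
      unfolding D_cong[OF section_near_D[OF section_near_add[OF s] c] e T]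
      by (rule D_add[OF section_near_D[OF s(1) c] section_near_D[OF s(2) c] T])
    then show ?thesis by (simp add: nabla1_chart_def)
  qed
  show "nabla1_chart c (D \<sigma>) x w w' = nabla1_chart c (D \<tau>) x w w'"
    if s: "section_near x \<sigma>" and e: "\<forall>\<^sub>F y in nhds x. \<sigma> y = \<tau> y" for \<sigma> \<tau>
  proof -
    have e: "\<forall>\<^sub>F y in nhds x. D \<sigma> y (coord_vec M c y w) = D \<tau> y (coord_vec M c y w)" for w
      using eventually_section_near[OF s] eventually_chart[OF c] eventually_eventually_nhds[OF e]
      by eventually_elim (simp add: D_cong coord_vec_tangent c)
    show ?thesis unfolding nabla1_chart_def
      by (simp add: D_cong[OF section_near_D[OF s c] e T])
  qed
  show "nabla1_chart c (D (\<lambda>y. fscale F (f y) (\<sigma> y))) x w w' = fscale F (f x) (nabla1_chart c (D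
      \<sigma>) x w w')"
    if f: "smooth_near M x f" and s: "section_near x \<sigma>" for f \<sigma>
  proof -
    have f': "smooth_near M x (chart_deriv c w f)" for w
    proof -
      obtain W where W: "open W" "x \<in> W" "smooth_fun M W f" using f unfolding smooth_near_def by blast
      have "smooth_fun M (W \<inter> fst c) (chart_deriv c w f)"
        by (rule smooth_fun_chart_deriv[OF c(1)]) (use W open_chart[OF c(1)] smooth_fun_subset[OF
            W(3)] in auto)
      then show ?thesis using W c open_chart[OF c(1)] by (intro smooth_near_open[of "W \<inter> fst c"]) auto
    qed
    have e: "\<forall>\<^sub>F y in nhds x. D (\<lambda>y. fscale F (f y) (\<sigma> y)) y (coord_vec M c y w) =
        fscale F (chart_deriv c w f y) (\<sigma> y) + fscale F (f y) (D \<sigma> y (coord_vec M c y w))" for w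
      using eventually_section_near[OF s] eventually_smooth_near[OF f] eventually_chart[OF c]
      by eventually_elim (simp add: D_scale coord_vec_tangent c cdiff_coord_vec)
    have D2: "D (\<lambda>y. D (\<lambda>y. fscale F (f y) (\<sigma> y)) y (coord_vec M c y w)) x (coord_vec M c x w') =
       fscale F (chart_deriv c w' (chart_deriv c w f) x) (\<sigma> x) +
       fscale F (chart_deriv c w f x) (D \<sigma> x (coord_vec M c x w')) +
       (fscale F (chart_deriv c w' f x) (D \<sigma> x (coord_vec M c x w)) +
       fscale F (f x) (D (\<lambda>y. D \<sigma> y (coord_vec M c y w)) x (coord_vec M c x w')))" for w w'
      unfolding D_cong[OF section_near_D[OF section_near_scale[OF f s] c] e T]
      by (simp add: D_add[OF section_near_scale[OF f' s] section_near_scale[OF f section_near_D[OF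
          s c]] T]
          D_scale[OF f' s T] D_scale[OF f section_near_D[OF s c] T] cdiff_coord_vec[OF c f]
              cdiff_coord_vec[OF c f'])
    have "chart_deriv c w (chart_deriv c w' f) x = chart_deriv c w' (chart_deriv c w f) x"
    proof -
      obtain W where W: "open W" "x \<in> W" "smooth_fun M W f" using f unfolding smooth_near_def by blast
      show ?thesis
        by (rule chart_deriv_commute[OF c(1), of "W \<inter> fst c"])
           (use W c open_chart[OF c(1)] smooth_fun_subset[OF W(3)] in auto)
    qed
    then show ?thesis unfolding nabla1_chart_def D2 by (simp add: fs.scale_right_diff_distrib)
  qed
qed

text \<open>The curvature may be computed with any section and chart. This turns flatness into a
  commutation rule for all germs of sections.\<close>

lemma curvature_eq:
  assumes c: "c \<in> atlas M" "x \<in> fst c" and \<sigma>: "section_near x \<sigma>"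
  shows "curvature M F D x [coord_vec M c x w, coord_vec M c x w'] (\<sigma> x) = nabla1_chart c (D \<sigma>) x w w'"
  using section_through[OF section_near_fibre[OF \<sigma>]]
  by (simp add: curvature_def nabla1_eq[OF form_near_D c] nabla1_D_tensorial[OF _ \<sigma> _ c])

end

section \<open>Exterior covariant derivative\<close>

context hermitian_bundle
begin

definition endo_near :: "'m \<Rightarrow> ('m \<Rightarrow> 'v \<Rightarrow> 'v) \<Rightarrow> bool" where
  "endo_near x h \<longleftrightarrow> (\<forall>\<^sub>F y in nhds x. antihermitian F y (h y)) \<and>
     (\<forall>\<sigma>. section_near x \<sigma> \<longrightarrow> section_near x (\<lambda>y. h y (\<sigma> y)))"

lemma endo_near_uform_1:
  assumes "uform M F 1 E" "c \<in> atlas M" "x \<in> fst c"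
  shows "endo_near x (\<lambda>y. E y [coord_vec M c y w])"
  unfolding endo_near_def using eventually_chart[OF assms(2,3)] uform_1_section_near[OF assms]
  by (auto elim!: eventually_mono intro: uform_1_antihermitian[OF assms(1)] coord_vec_tangent[OF
      assms(2)])

lemma endo_near_uform_2:
  assumes "uform M F 2 E" "c \<in> atlas M" "x \<in> fst c"
  shows "endo_near x (\<lambda>y. E y [coord_vec M c y w, coord_vec M c y w'])"
  unfolding endo_near_def using eventually_chart[OF assms(2,3)] uform_2_section_near[OF assms]
  by (auto elim!: eventually_mono intro: uform_2_antihermitian[OF assms(1)] coord_vec_tangent[OF
      assms(2)])

lemma endo_near_antihermitian: "endo_near x h \<Longrightarrow> antihermitian F x (h x)"
  unfolding endo_near_def by (blast dest: eventually_nhds_x_imp_x)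

lemma endo_near_section_near: "endo_near x h \<Longrightarrow> section_near x \<sigma> \<Longrightarrow> section_near x (\<lambda>y. h y (\<sigma> y))"
  by (simp add: endo_near_def)

lemma endo_near_eventually: "endo_near x h \<Longrightarrow> \<forall>\<^sub>F y in nhds x. antihermitian F y (h y)"
  by (simp add: endo_near_def)

section \<open>Operations that stay within the forms with antihermitian values\<close>

lemma uform_scale:
  assumes \<omega>: "uform M F k \<omega>"
  shows "uform M F k (form_scale F s \<omega>)"
  unfolding uform_def
proof (intro conjI allI impI ballI; (elim conjE)?)
  fix x and vs :: "'m tangent list" assume vs: "length vs = k" "set vs \<subseteq> tangent_space M x"
  show "antihermitian F x (form_scale F s \<omega> x vs)"
    using antihermitian_scale_real[OF uform_antihermitian[OF \<omega> vs]] by (simp add: form_scale_def)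
  fix z assume z: "z \<in> fibre F x"
  show "form_scale F s \<omega> x (vs[i := tcomb a u b v]) z =
      fscale F (of_real a) (form_scale F s \<omega> x (vs[i := u]) z) +
      fscale F (of_real b) (form_scale F s \<omega> x (vs[i := v]) z)"
    if "i < k" "u \<in> tangent_space M x" "v \<in> tangent_space M x" for i u v a b
    by (simp add: form_scale_def uform_tcomb[OF \<omega> vs z that] fs.scale_right_distrib mult.commute)
  show "form_scale F s \<omega> x vs z = 0" if "i < k" "j < k" "i \<noteq> j" "vs ! i = vs ! j" for i j
    using that by (simp add: form_scale_def uform_alternating[OF \<omega> vs z])
next
  fix c W \<sigma> and ws :: "(real ^ 'n) list"
  assume c: "c \<in> atlas M" and ws: "length ws = k" and W: "open W" "W \<subseteq> fst c" "smooth_section M F W \<sigma>"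
  show "smooth_section M F W (\<lambda>x. form_scale F s \<omega> x (map (coord_vec M c x) ws) (\<sigma> x))"
    unfolding form_scale_def
    by (rule section_near_imp_smooth_section[OF W(1) section_near_scale_const[OF
        uform_section_near[OF \<omega> ws c]]])
       (use W in \<open>auto intro: section_near_open\<close>)
qed

lemma uform_2_form_add:
  assumes "uform M F 2 \<omega>" "uform M F 2 \<eta>"
  shows "uform M F 2 (form_add \<omega> \<eta>)"
proof (rule uform_2I)
  note tcomb = uform_tcomb[where k = 2 and vs = "[u, v]" and i = 0 for u v, simplified]
  fix x u v u' a b z assume T: "u \<in> tangent_space M x" "u' \<in> tangent_space M x" "v \<in> tangent_space M x"
    and z: "z \<in> fibre F x"
  show "form_add \<omega> \<eta> x [tcomb a u b u', v] z =
    fscale F (of_real a) (form_add \<omega> \<eta> x [u, v] z) + fscale F (of_real b) (form_add \<omega> \<eta> x [u', v] z)"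
    using T z tcomb[OF assms(1) conjI[OF T(1,3)] z T(1,2)] tcomb[OF assms(2) conjI[OF T(1,3)] z T(1,2)]
    by (simp add: form_add_def fs.scale_right_distrib)
next
  have alt: "\<omega> x [u, v] z = - \<omega> x [v, u] z"
    if \<omega>: "uform M F 2 \<omega>" and T: "u \<in> tangent_space M x" "v \<in> tangent_space M x" and z: "z \<in> fibre F x"
    for \<omega> x u v z
  proof -
    \<comment> \<open>Polarisation: the form vanishes on equal arguments, in particular on (u + v, u
      + v), and expanding both slots leaves the two mixed terms.\<close>
    let ?s = "tcomb 1 u 1 v"
    have s: "?s \<in> tangent_space M x" by (rule tcomb_tangent[OF T])
    have same: "\<omega> x [w, w] z = 0" if "w \<in> tangent_space M x" for w
      using uform_alternating[OF \<omega>, of "[w, w]" x z 0 1] that z by simp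
    have "\<omega> x [?s, ?s] z = \<omega> x [u, ?s] z + \<omega> x [v, ?s] z"
      using uform_tcomb[OF \<omega>, of "[u, ?s]" x z 0 u v 1 1] T z s by simp
    also have "\<omega> x [u, ?s] z = \<omega> x [u, u] z + \<omega> x [u, v] z"
      using uform_tcomb[OF \<omega>, of "[u, u]" x z 1 u v 1 1] T z by simp
    also have "\<omega> x [v, ?s] z = \<omega> x [v, u] z + \<omega> x [v, v] z"
      using uform_tcomb[OF \<omega>, of "[v, u]" x z 1 u v 1 1] T z by simp
    finally show ?thesis using same[OF s] same T by (simp add: eq_neg_iff_add_eq_0)
  qed
  fix x u v z assume "u \<in> tangent_space M x" "v \<in> tangent_space M x" and z: "z \<in> fibre F x"
  then show "form_add \<omega> \<eta> x [u, v] z = - form_add \<omega> \<eta> x [v, u] z"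
    using alt[OF assms(1), of u x v z] alt[OF assms(2), of u x v z] by (simp add: form_add_def)
next
  fix x u z assume "u \<in> tangent_space M x" "z \<in> fibre F x"
  then show "form_add \<omega> \<eta> x [u, u] z = 0"
    using uform_alternating[OF assms(1), of "[u, u]" x z 0 1] uform_alternating[OF assms(2), of
        "[u, u]" x z 0 1]
    by (simp add: form_add_def)
next
  fix x u v assume T: "u \<in> tangent_space M x" "v \<in> tangent_space M x"
  show "antihermitian F x (form_add \<omega> \<eta> x [u, v])"
    unfolding form_add_def by (rule antihermitian_plus[OF uform_2_antihermitian[OF assms(1) T]
        uform_2_antihermitian[OF assms(2) T]])
next
  fix c w w' x \<sigma> assume c: "c \<in> atlas M" "x \<in> fst c" and \<sigma>: "section_near x \<sigma>"
  show "section_near x (\<lambda>y. form_add \<omega> \<eta> y [coord_vec M c y w, coord_vec M c y w'] (\<sigma> y))"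
    unfolding form_add_def
    by (rule section_near_add[OF uform_2_section_near[OF assms(1) c \<sigma>] uform_2_section_near[OF
        assms(2) c \<sigma>]])
qed

lemma uform_wedge_square:
  assumes E: "uform M F 1 E"
  shows "uform M F 2 (wedge_square E)"
proof (rule uform_2I)
  fix x u v u' a b z assume T: "u \<in> tangent_space M x" "u' \<in> tangent_space M x" "v \<in> tangent_space M x"
    and z: "z \<in> fibre F x"
  note ah = uform_1_antihermitian[OF E T(3)]
  note mem = antihermitian_fibre[OF uform_1_antihermitian[OF E] z]
  show "wedge_square E x [tcomb a u b u', v] z =
    fscale F (of_real a) (wedge_square E x [u, v] z) + fscale F (of_real b) (wedge_square E x [u', v] z)"
    by (simp add: wedge_square_def uform_1_tcomb[OF E] T z mem fibre_scale antihermitian_add[OF ah]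
        antihermitian_scale[OF ah] fs.scale_right_diff_distrib algebra_simps)
next
  fix c w w' x \<sigma> assume c: "c \<in> atlas M" "x \<in> fst c" and \<sigma>: "section_near x \<sigma>"
  show "section_near x (\<lambda>y. wedge_square E y [coord_vec M c y w, coord_vec M c y w'] (\<sigma> y))"
    by (simp add: wedge_square_def section_near_diff uform_1_section_near[OF E c] \<sigma>)
qed (auto simp: wedge_square_def intro!: antihermitian_commutator uform_1_antihermitian[OF E])

end

context hermitian_bundle_connection
begin

text \<open>When the section is multiplied by \<open>f\<close>, the Leibniz term of \<open>D\<close>
  occurs in both parts of the commutator of \<open>D\<close> with \<open>h\<close> and cancels. The
  commutator is thus linear over functions, and \<open>tensorial_eq\<close> removes the choice of
  section.\<close>

lemma nabla_end_eq:
  assumes h: "endo_near x h" and \<sigma>: "section_near x \<sigma>" and u: "u \<in> tangent_space M x"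
  shows "nabla_end M F D h x u (\<sigma> x) = D (\<lambda>y. h y (\<sigma> y)) x u - h x (D \<sigma> x u)"
proof -
  note \<tau> = section_through[OF section_near_fibre[OF \<sigma>]]
  note ah = endo_near_antihermitian[OF h] and hs = endo_near_section_near[OF h]
    and hev = endo_near_eventually[OF h]
  show ?thesis
    unfolding nabla_end_def Let_def
  proof (rule tensorial_eq[where T = "\<lambda>\<sigma>. D (\<lambda>y. h y (\<sigma> y)) x u - h x (D \<sigma> x u)", OF _ _ _ \<tau>(1) \<sigma> \<tau>(2)])
    fix \<sigma> \<tau> assume s: "section_near x \<sigma>" "section_near x \<tau>"
    have e: "\<forall>\<^sub>F y in nhds x. h y (\<sigma> y + \<tau> y) = h y (\<sigma> y) + h y (\<tau> y)"
      using hev eventually_section_near[OF s(1)] eventually_section_near[OF s(2)]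
      by eventually_elim (simp add: antihermitian_add section_near_fibre)
    show "D (\<lambda>y. h y (\<sigma> y + \<tau> y)) x u - h x (D (\<lambda>y. \<sigma> y + \<tau> y) x u) =
      D (\<lambda>y. h y (\<sigma> y)) x u - h x (D \<sigma> x u) + (D (\<lambda>y. h y (\<tau> y)) x u - h x (D \<tau> x u))"
      unfolding D_cong[OF hs[OF section_near_add[OF s]] e u]
      by (simp add: D_add s hs u antihermitian_add[OF ah] D_fibre)
  next
    fix \<sigma> \<tau> assume s: "section_near x \<sigma>" and e: "\<forall>\<^sub>F y in nhds x. \<sigma> y = \<tau> y"
    have e': "\<forall>\<^sub>F y in nhds x. h y (\<sigma> y) = h y (\<tau> y)" using e by eventually_elim simp
    show "D (\<lambda>y. h y (\<sigma> y)) x u - h x (D \<sigma> x u) = D (\<lambda>y. h y (\<tau> y)) x u - h x (D \<tau> x u)"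
      unfolding D_cong[OF hs[OF s] e' u] D_cong[OF s e u] ..
  next
    fix f :: "'m \<Rightarrow> complex" and \<sigma> assume f: "smooth_near M x f" and s: "section_near x \<sigma>"
    have e: "\<forall>\<^sub>F y in nhds x. h y (fscale F (f y) (\<sigma> y)) = fscale F (f y) (h y (\<sigma> y))"
      using hev eventually_section_near[OF s]
      by eventually_elim (simp add: antihermitian_scale section_near_fibre)
    show "D (\<lambda>y. h y (fscale F (f y) (\<sigma> y))) x u - h x (D (\<lambda>y. fscale F (f y) (\<sigma> y)) x u) =
      fscale F (f x) (D (\<lambda>y. h y (\<sigma> y)) x u - h x (D \<sigma> x u))"
      unfolding D_cong[OF hs[OF section_near_scale[OF f s]] e u]
      by (simp add: D_scale[OF f hs[OF s] u] D_scale[OF f s u] antihermitian_add[OF ah]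
          antihermitian_scale[OF ah] section_near_fibre[OF s] D_fibre[OF s u] fibre_scale
          fs.scale_right_diff_distrib)
  qed
qed

lemma cdiff_minus: "v \<in> tangent_space M x \<Longrightarrow> cdiff (\<lambda>y. - f y) v = - cdiff f v"
  using tangent_minus[of v x] by (simp add: cdiff_def complex_eq_iff)

lemma cdiff_cong:
  assumes "v \<in> tangent_space M x" "\<forall>\<^sub>F y in nhds x. f y = g y"
  shows "cdiff f v = cdiff g v"
proof -
  obtain W where W: "open W" "x \<in> W" "\<forall>y\<in>W. f y = g y" using assms(2) unfolding eventually_nhds by blast
  then show ?thesis
    using tangent_cong[OF assms(1) W(1,2), of "\<lambda>y. Re (f y)" "\<lambda>y. Re (g y)"]
      tangent_cong[OF assms(1) W(1,2), of "\<lambda>y. Im (f y)" "\<lambda>y. Im (g y)"]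
    by (simp add: cdiff_def)
qed

lemma D_hmetric:
  assumes "section_near x \<sigma>" "section_near x \<tau>" "v \<in> tangent_space M x"
  shows "hmetric F x (D \<sigma> x v) (\<tau> x) + hmetric F x (\<sigma> x) (D \<tau> x v) =
    cdiff (\<lambda>y. hmetric F y (\<sigma> y) (\<tau> y)) v"
proof -
  obtain W T where W: "open W" "x \<in> W" "smooth_section M F W \<sigma>" "open T" "x \<in> T" "smooth_section M F T \<tau>"
    using assms unfolding section_near_def by blast
  have s: "open (W \<inter> T)" "smooth_section M F (W \<inter> T) \<sigma>" "smooth_section M F (W \<inter> T) \<tau>" "x \<in> W \<inter> T"
    using W by (auto intro: smooth_section_subset)
  show ?thesis
    by (rule hermitian_D[unfolded hermitian_connection_def, THEN conjunct2, THEN spec[of _ "W \<inter>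
        T"], THEN spec[of _ \<sigma>],
          THEN spec[of _ \<tau>], THEN mp, rule_format]) (use s assms(3) in auto)
qed

text \<open>Differentiate <h \<sigma>, \<tau>> = - <\<sigma>, h \<tau>> with the metric rule for
  \<open>D\<close>. Moving \<open>h\<close> across the product in the terms where it is not
  differentiated leaves the identity for the commutator.\<close>

lemma nabla_end_antihermitian:
  assumes h: "endo_near x h" and u: "u \<in> tangent_space M x"
  shows "antihermitian F x (nabla_end M F D h x u)"
proof -
  note ah = endo_near_antihermitian[OF h] and hs = endo_near_section_near[OF h]
    and hev = endo_near_eventually[OF h]
  let ?T = "\<lambda>\<sigma>. D (\<lambda>y. h y (\<sigma> y)) x u - h x (D \<sigma> x u)"
  have mem: "nabla_end M F D h x u (\<sigma> x) \<in> fibre F x" if "section_near x \<sigma>" for \<sigma>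
    using that by (simp add: nabla_end_eq[OF h that u] fibre_diff D_fibre hs u
        antihermitian_fibre[OF ah])
  show ?thesis
    unfolding antihermitian_def
  proof (intro ballI conjI allI)
    fix z a assume z: "z \<in> fibre F x"
    define \<sigma> where "\<sigma> = section_through M F x z"
    have s: "section_near x \<sigma>" "\<sigma> x = z" using section_through[OF z] by (simp_all add: \<sigma>_def)
    show "nabla_end M F D h x u z \<in> fibre F x" using mem[OF s(1)] s(2) by simp
    have e: "\<forall>\<^sub>F y in nhds x. h y (fscale F a (\<sigma> y)) = fscale F a (h y (\<sigma> y))"
      using hev eventually_section_near[OF s(1)]
      by eventually_elim (simp add: antihermitian_scale section_near_fibre)
    have "nabla_end M F D h x u (fscale F a (\<sigma> x)) = fscale F a (nabla_end M F D h x u (\<sigma> x))"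
      unfolding nabla_end_eq[OF h s(1) u] nabla_end_eq[OF h section_near_scale_const[OF s(1)] u]
        D_cong[OF hs[OF section_near_scale_const[OF s(1)]] e u]
      by (simp add: D_scale_const s hs u antihermitian_scale[OF ah] D_fibre fs.scale_right_diff_distrib)
    then show "nabla_end M F D h x u (fscale F a z) = fscale F a (nabla_end M F D h x u z)" by
        (simp add: s)
  next
    fix z w assume z: "z \<in> fibre F x" and w: "w \<in> fibre F x"
    obtain \<sigma> \<tau> where s: "section_near x \<sigma>" "\<sigma> x = z" and t: "section_near x \<tau>" "\<tau> x = w"
      using ex_section_near z w by metis
    have e: "\<forall>\<^sub>F y in nhds x. h y (\<sigma> y + \<tau> y) = h y (\<sigma> y) + h y (\<tau> y)"
      using hev eventually_section_near[OF s(1)] eventually_section_near[OF t(1)]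
      by eventually_elim (simp add: antihermitian_add section_near_fibre)
    have "nabla_end M F D h x u (\<sigma> x + \<tau> x) = nabla_end M F D h x u (\<sigma> x) + nabla_end M F D h x u (\<tau> x)"
      unfolding nabla_end_eq[OF h s(1) u] nabla_end_eq[OF h t(1) u] nabla_end_eq[OF h
          section_near_add[OF s(1) t(1)] u]
        D_cong[OF hs[OF section_near_add[OF s(1) t(1)]] e u]
      by (simp add: D_add s t hs u antihermitian_add[OF ah] D_fibre)
    then show "nabla_end M F D h x u (z + w) = nabla_end M F D h x u z + nabla_end M F D h x u w"
      by (simp add: s t)
    have e: "\<forall>\<^sub>F y in nhds x. hmetric F y (h y (\<sigma> y)) (\<tau> y) = - hmetric F y (\<sigma> y) (h y (\<tau> y))"
      using hev eventually_section_near[OF s(1)] eventually_section_near[OF t(1)]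
      by eventually_elim (simp add: antihermitian_hmetric section_near_fibre)
    have "hmetric F x (D (\<lambda>y. h y (\<sigma> y)) x u) (\<tau> x) + hmetric F x (h x (\<sigma> x)) (D \<tau> x u) =
      - (hmetric F x (D \<sigma> x u) (h x (\<tau> x)) + hmetric F x (\<sigma> x) (D (\<lambda>y. h y (\<tau> y)) x u))"
      unfolding D_hmetric[OF hs[OF s(1)] t(1) u] D_hmetric[OF s(1) hs[OF t(1)] u]
      using cdiff_cong[OF u e] cdiff_minus[OF u] by simp
    then have "hmetric F x (nabla_end M F D h x u (\<sigma> x)) (\<tau> x) + hmetric F x (\<sigma> x) (nabla_end M F
        D h x u (\<tau> x)) = 0"
      unfolding nabla_end_eq[OF h s(1) u] nabla_end_eq[OF h t(1) u]
      by (simp add: hmetric_diff_left hmetric_diff_right D_fibre s t z w u hs antihermitian_fibre[OF ah]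
          antihermitian_hmetric[OF ah] algebra_simps)
    then show "hmetric F x (nabla_end M F D h x u z) w + hmetric F x z (nabla_end M F D h x u w) = 0"
      by (simp add: s t)
  qed
qed

section \<open>Covariant derivative of 1-forms and 2-forms\<close>

lemma nabla_form_1:
  "nabla_form M F D E x [u, v] z =
    nabla_end M F D (\<lambda>y. E y [field_through M x v y]) x u z -
    nabla_end M F D (\<lambda>y. E y [field_through M x u y]) x v z"
  by (simp add: nabla_form_def numeral_2_eq_2)

lemma nabla_form_2:
  "nabla_form M F D E x [u, v, w] z =
    nabla_end M F D (\<lambda>y. E y [field_through M x v y, field_through M x w y]) x u z -
    nabla_end M F D (\<lambda>y. E y [field_through M x u y, field_through M x w y]) x v z +
    nabla_end M F D (\<lambda>y. E y [field_through M x u y, field_through M x v y]) x w z"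
  by (simp add: nabla_form_def numeral_3_eq_3)

text \<open>The derivative terms are collected into \<open>nabla1\<close> of a 1-form with values in
  the bundle, for which changes of chart have been dealt with. The formula therefore holds in every
  chart around \<open>x\<close>.\<close>

lemma nabla_form_1_eq:
  assumes E: "uform M F 1 E" and c: "c \<in> atlas M" "x \<in> fst c" and \<sigma>: "section_near x \<sigma>"
  shows "nabla_form M F D E x [coord_vec M c x w, coord_vec M c x w'] (\<sigma> x) =
    nabla1_chart c (\<lambda>y v. E y [v] (\<sigma> y)) x w w' -
    E x [coord_vec M c x w'] (D \<sigma> x (coord_vec M c x w)) +
    E x [coord_vec M c x w] (D \<sigma> x (coord_vec M c x w'))"
proof -
  have *: "nabla_form M F D E x [u, v] (\<sigma> x) = nabla1 M D (\<lambda>y v. E y [v] (\<sigma> y)) x u v -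
      E x [v] (D \<sigma> x u) + E x [u] (D \<sigma> x v)"
    if T: "u \<in> tangent_space M x" "v \<in> tangent_space M x" for u v
  proof -
    obtain a b where "u = coord_vec M (chart_at M x) x a" "v = coord_vec M (chart_at M x) x b"
      using T tangent_space_chart[OF chart_at] by blast
    then show ?thesis
      using T by (simp add: nabla_form_1 field_through_coord_vec nabla1_def nabla_end_eq[OF
          endo_near_uform_1[OF E chart_at] \<sigma>])
  qed
  show ?thesis
    using *[OF coord_vec_tangent[OF c] coord_vec_tangent[OF c]] nabla1_eq[OF form_near_uform_1[OF
        E \<sigma>] c] by simp
qed

text \<open>Here the chart remains the one chosen at \<open>x\<close>. This is enough because
  3-forms occur only in equations at a single point, so their dependence on the point is never
  differentiated.\<close>

lemma nabla_form_2_eq: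
  assumes C: "uform M F 2 C" and \<sigma>: "section_near x \<sigma>"
  defines "X \<equiv> \<lambda>w y. coord_vec M (chart_at M x) y w"
  shows "nabla_form M F D C x [X u x, X v x, X w x] (\<sigma> x) =
    (D (\<lambda>y. C y [X v y, X w y] (\<sigma> y)) x (X u x) - C x [X v x, X w x] (D \<sigma> x (X u x))) -
    (D (\<lambda>y. C y [X u y, X w y] (\<sigma> y)) x (X v x) - C x [X u x, X w x] (D \<sigma> x (X v x))) +
    (D (\<lambda>y. C y [X u y, X v y] (\<sigma> y)) x (X w x) - C x [X u x, X v x] (D \<sigma> x (X w x)))"
  unfolding X_def nabla_form_2 field_through_coord_vec
  by (simp add: nabla_end_eq[OF endo_near_uform_2[OF C chart_at] \<sigma> coord_vec_tangent[OF chart_at]])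

lemma uform_nabla_form:
  assumes E: "uform M F 1 E"
  shows "uform M F 2 (nabla_form M F D E)"
proof (rule uform_2I)
  fix x u v assume T: "u \<in> tangent_space M x" "v \<in> tangent_space M x"
  obtain a b where ab: "u = coord_vec M (chart_at M x) x a" "v = coord_vec M (chart_at M x) x b"
    using T tangent_space_chart[OF chart_at] by blast
  have eq: "nabla_form M F D E x [u, v] = (\<lambda>z. nabla_end M F D (\<lambda>y. E y [field_through M x v y]) x u z -
    nabla_end M F D (\<lambda>y. E y [field_through M x u y]) x v z)"
    by (simp add: nabla_form_1 fun_eq_iff)
  show "antihermitian F x (nabla_form M F D E x [u, v])"
    unfolding eq using T
    by (intro antihermitian_minus) (auto simp: ab field_through_coord_vec intro!:
        nabla_end_antihermitian endo_near_uform_1[OF E chart_at])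
next
  fix x u v z show "nabla_form M F D E x [u, v] z = - nabla_form M F D E x [v, u] z"
    by (simp add: nabla_form_1)
next
  fix x u z show "nabla_form M F D E x [u, u] z = 0"
    by (simp add: nabla_form_1)
next
  fix c w w' x \<sigma> assume c: "c \<in> atlas M" "x \<in> fst c" and \<sigma>: "section_near x \<sigma>"
  \<comment> \<open>\<open>nabla_form\<close> picks a new chart at every \<open>y\<close>.
    Smoothness in \<open>y\<close> becomes visible only after rewriting it near \<open>x\<close> by
    the formula in the fixed chart \<open>c\<close>.\<close>
  have e: "\<forall>\<^sub>F y in nhds x. nabla1_chart c (\<lambda>y v. E y [v] (\<sigma> y)) y w w' -
    E y [coord_vec M c y w'] (D \<sigma> y (coord_vec M c y w)) +
    E y [coord_vec M c y w] (D \<sigma> y (coord_vec M c y w')) =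
    nabla_form M F D E y [coord_vec M c y w, coord_vec M c y w'] (\<sigma> y)"
    using eventually_chart[OF c] eventually_section_near[OF \<sigma>]
    by eventually_elim (simp add: nabla_form_1_eq[OF E c(1)])
  show "section_near x (\<lambda>y. nabla_form M F D E y [coord_vec M c y w, coord_vec M c y w'] (\<sigma> y))"
    by (rule section_near_cong[OF _ e])
       (simp add: nabla1_chart_def section_near_add section_near_diff section_near_D
         uform_1_section_near[OF E c] c \<sigma>)
next
  fix x u v u' a b z assume T: "u \<in> tangent_space M x" "u' \<in> tangent_space M x" "v \<in> tangent_space M x"
    and z: "z \<in> fibre F x"
  note c = chart_at[of x]
  obtain w w' w'' where w: "u = coord_vec M (chart_at M x) x w" "u' = coord_vec M (chart_at M x) x w'"
    "v = coord_vec M (chart_at M x) x w''"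
    using T tangent_space_chart[OF c] by blast
  obtain \<sigma> where \<sigma>: "section_near x \<sigma>" "\<sigma> x = z" using ex_section_near[OF z] by blast
  have t: "tcomb a u b u' = coord_vec M (chart_at M x) x (a *\<^sub>R w + b *\<^sub>R w')"
    by (simp add: w coord_vec_tcomb[OF c])
  have e: "\<forall>\<^sub>F y in nhds x. E y [coord_vec M (chart_at M x) y (a *\<^sub>R w + b *\<^sub>R w')] (\<sigma> y) =
     fscale F (of_real a) (E y [coord_vec M (chart_at M x) y w] (\<sigma> y)) +
     fscale F (of_real b) (E y [coord_vec M (chart_at M x) y w'] (\<sigma> y))"
    using eventually_chart[OF c] eventually_section_near[OF \<sigma>(1)]
    by eventually_elim (simp add: coord_vec_tcomb c uform_1_tcomb[OF E] section_near_fibre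
        coord_vec_tangent)
  have D1: "D (\<lambda>y. E y [coord_vec M (chart_at M x) y (a *\<^sub>R w + b *\<^sub>R w')] (\<sigma> y)) x v =
     fscale F (of_real a) (D (\<lambda>y. E y [coord_vec M (chart_at M x) y w] (\<sigma> y)) x v) +
     fscale F (of_real b) (D (\<lambda>y. E y [coord_vec M (chart_at M x) y w'] (\<sigma> y)) x v)"
    unfolding D_cong[OF uform_1_section_near[OF E c \<sigma>(1)] e T(3)]
    by (simp add: D_add D_scale_const section_near_scale_const uform_1_section_near[OF E c \<sigma>(1)] T)
  have D2: "D \<sigma> x (coord_vec M (chart_at M x) x (a *\<^sub>R w + b *\<^sub>R w')) =
     fscale F (of_real a) (D \<sigma> x u) + fscale F (of_real b) (D \<sigma> x u')"
    "D (\<lambda>y. E y [coord_vec M (chart_at M x) y w''] (\<sigma> y)) x (coord_vec M (chart_at M x) x (a *\<^sub>R w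
        + b *\<^sub>R w')) =
     fscale F (of_real a) (D (\<lambda>y. E y [coord_vec M (chart_at M x) y w''] (\<sigma> y)) x u) +
     fscale F (of_real b) (D (\<lambda>y. E y [coord_vec M (chart_at M x) y w''] (\<sigma> y)) x u')"
    unfolding t[symmetric]
    by (intro D_tcomb uform_1_section_near[OF E c] \<sigma>(1) T)+
  have E1: "E x [coord_vec M (chart_at M x) x (a *\<^sub>R w + b *\<^sub>R w')] y =
     fscale F (of_real a) (E x [u] y) + fscale F (of_real b) (E x [u'] y)" if "y \<in> fibre F x" for y
    unfolding t[symmetric] by (rule uform_1_tcomb[OF E that T(1,2)])
  note ah = uform_1_antihermitian[OF E T(3)]
  show "nabla_form M F D E x [tcomb a u b u', v] z =
    fscale F (of_real a) (nabla_form M F D E x [u, v] z) + fscale F (of_real b) (nabla_form M F D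
        E x [u', v] z)"
    using E1[OF D_fibre[OF \<sigma>(1) T(3)]] D1 antihermitian_add[OF ah] antihermitian_scale[OF ah] D2
      D_fibre[OF \<sigma>(1) T(1)] D_fibre[OF \<sigma>(1) T(2)]
    unfolding t unfolding \<sigma>(2)[symmetric] w nabla_form_1_eq[OF E c \<sigma>(1)] nabla1_chart_def
    by (simp add: fibre_scale fs.scale_right_distrib fs.scale_right_diff_distrib)
qed

text \<open>When \<open>D\<close> + \<open>E\<close> is applied twice, the pure terms give the
  curvature of \<open>D\<close> and the wedge square, and the mixed ones form
  \<open>nabla_form\<close> by \<open>nabla_form_1_eq\<close>. Both curvatures use the same chosen
  section and chart, so they can be compared directly.\<close>

lemma curvature_conn_add:
  assumes E: "uform M F 1 E" and T: "u \<in> tangent_space M x" "v \<in> tangent_space M x" and z: "z \<in>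
      fibre F x"
  shows "curvature M F (conn_add D E) x [u, v] z =
    curvature M F D x [u, v] z + nabla_form M F D E x [u, v] z + wedge_square E x [u, v] z"
proof -
  note c = chart_at[of x]
  obtain a b where ab: "u = coord_vec M (chart_at M x) x a" "v = coord_vec M (chart_at M x) x b"
    using T tangent_space_chart[OF c] by blast
  define \<sigma> where "\<sigma> = section_through M F x z"
  have \<sigma>: "section_near x \<sigma>" "\<sigma> x = z" using section_through[OF z] by (auto simp: \<sigma>_def)
  let ?X = "\<lambda>w y. coord_vec M (chart_at M x) y w"
  have DD: "D (\<lambda>y. D \<sigma> y (?X w y) + E y [?X w y] (\<sigma> y)) x t =
     D (\<lambda>y. D \<sigma> y (?X w y)) x t + D (\<lambda>y. E y [?X w y] (\<sigma> y)) x t" if "t \<in> tangent_space M x" for w t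
    by (rule D_add[OF section_near_D[OF \<sigma>(1) c] uform_1_section_near[OF E c \<sigma>(1)] that])
  have EE: "E x [t] (D \<sigma> x s + E x [s] z) = E x [t] (D \<sigma> x s) + E x [t] (E x [s] z)"
    if "t \<in> tangent_space M x" "s \<in> tangent_space M x" for s t
    using that by (intro antihermitian_add[OF uform_1_antihermitian[OF E]] D_fibre \<sigma>
        antihermitian_fibre[OF uform_1_antihermitian[OF E]] z)
  have "nabla_form M F D E x [u, v] (\<sigma> x) = nabla1_chart (chart_at M x) (\<lambda>y v. E y [v] (\<sigma> y)) x a b -
    E x [v] (D \<sigma> x u) + E x [u] (D \<sigma> x v)"
    unfolding ab by (rule nabla_form_1_eq[OF E c \<sigma>(1)])
  then show ?thesis
    unfolding \<sigma>(2)
    using DD EE T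
    by (simp add: curvature_def nabla1_def conn_add_def \<sigma>_def[symmetric] \<sigma>(2) ab
        field_through_coord_vec nabla1_chart_def
        wedge_square_def algebra_simps)
qed

lemma nabla_form_1_scale:
  assumes E: "uform M F 1 E" and T: "u \<in> tangent_space M x" "v \<in> tangent_space M x" and z: "z \<in>
      fibre F x"
  shows "nabla_form M F D (form_scale F s E) x [u, v] z = fscale F (of_real s) (nabla_form M F D E
      x [u, v] z)"
proof -
  note c = chart_at[of x]
  obtain a b where ab: "u = coord_vec M (chart_at M x) x a" "v = coord_vec M (chart_at M x) x b"
    using T tangent_space_chart[OF c] by blast
  obtain \<sigma> where \<sigma>: "section_near x \<sigma>" "\<sigma> x = z" using ex_section_near[OF z] by blast
  show ?thesis
    unfolding \<sigma>(2)[symmetric] ab nabla_form_1_eq[OF E c \<sigma>(1)] nabla_form_1_eq[OF uform_scale[OF E]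
        c \<sigma>(1)]
    by (simp add: form_scale_def nabla1_chart_def D_scale_const[OF uform_1_section_near[OF E c
        \<sigma>(1)] coord_vec_tangent[OF c]]
        fs.scale_right_distrib fs.scale_right_diff_distrib)
qed

lemma nabla_form_2_add:
  assumes C: "uform M F 2 C" "uform M F 2 C'"
    and T: "u \<in> tangent_space M x" "v \<in> tangent_space M x" "w \<in> tangent_space M x" and z: "z \<in> fibre F x"
  shows "nabla_form M F D (form_add C C') x [u, v, w] z =
    nabla_form M F D C x [u, v, w] z + nabla_form M F D C' x [u, v, w] z"
proof -
  note c = chart_at[of x]
  obtain a b d where ab: "u = coord_vec M (chart_at M x) x a" "v = coord_vec M (chart_at M x) x b"
      "w = coord_vec M (chart_at M x) x d"
    using T tangent_space_chart[OF c] by blast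
  obtain \<sigma> where \<sigma>: "section_near x \<sigma>" "\<sigma> x = z" using ex_section_near[OF z] by blast
  show ?thesis
    unfolding \<sigma>(2)[symmetric] ab nabla_form_2_eq[OF C(1) \<sigma>(1)] nabla_form_2_eq[OF C(2) \<sigma>(1)]
      nabla_form_2_eq[OF uform_2_form_add[OF C] \<sigma>(1)]
    by (simp add: form_add_def D_add uform_2_section_near[OF C(1) c \<sigma>(1)] uform_2_section_near[OF
        C(2) c \<sigma>(1)] coord_vec_tangent[OF c])
qed

section \<open>Identities for closedness\<close>

lemma flat_commute:
  assumes flat: "flat M F D" and c: "c \<in> atlas M" "x \<in> fst c" and \<sigma>: "section_near x \<sigma>"
  shows "D (\<lambda>y. D \<sigma> y (coord_vec M c y w)) x (coord_vec M c x w') =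
    D (\<lambda>y. D \<sigma> y (coord_vec M c y w')) x (coord_vec M c x w)"
proof -
  have "curvature M F D x [coord_vec M c x w, coord_vec M c x w'] (\<sigma> x) = 0"
    using flat coord_vec_tangent[OF c] section_near_fibre[OF \<sigma>]
    by (simp add: flat_def form_eq_def form_zero_def)
  then show ?thesis unfolding curvature_eq[OF c \<sigma>] nabla1_chart_def by simp
qed

text \<open>With operators \<open>P u = \<nabla>\<^sub>u\<close> and \<open>Q v = E(v)\<close> on germs of sections, the value of the exterior
  covariant derivative is a signed sum of commutators and the claim is the Jacobi identity.\<close>

lemma nabla_nabla:
  assumes flat: "flat M F D" and E: "uform M F 1 E"
  shows "form_eq M F 3 (nabla_form M F D (nabla_form M F D E)) form_zero"
  unfolding form_eq_def form_zero_def
proof (intro allI ballI impI, elim conjE)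
  fix x z and vs :: "'m tangent list" assume z: "z \<in> fibre F x" and l: "length vs = 3" and T: "set
      vs \<subseteq> tangent_space M x"
  note c = chart_at[of x]
  obtain t u v where vs: "vs = [t, u, v]"
    using l by (auto simp: numeral_3_eq_3 length_Suc_conv)
  obtain i j k where ijk: "t = coord_vec M (chart_at M x) x i" "u = coord_vec M (chart_at M x) x j"
      "v = coord_vec M (chart_at M x) x k"
    using T tangent_space_chart[OF c] vs by auto
  obtain \<sigma> where \<sigma>: "section_near x \<sigma>" "\<sigma> x = z" using ex_section_near[OF z] by blast
  define P where "P = (\<lambda>w \<sigma> y. D \<sigma> y (coord_vec M (chart_at M x) y w))"
  define Q where "Q = (\<lambda>w \<sigma> y. E y [coord_vec M (chart_at M x) y w] (\<sigma> y))"
  define C where "C = (\<lambda>w w' \<sigma> y. nabla_form M F D E y [coord_vec M (chart_at M x) y w, coord_vec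
      M (chart_at M x) y w'] (\<sigma> y))"
  have Tc: "coord_vec M (chart_at M x) x w \<in> tangent_space M x" for w using coord_vec_tangent[OF c] .
  have nP: "section_near x (P w \<tau>)" if "section_near x \<tau>" for w \<tau>
    unfolding P_def by (rule section_near_D[OF that c])
  have nQ: "section_near x (Q w \<tau>)" if "section_near x \<tau>" for w \<tau>
    unfolding Q_def by (rule uform_1_section_near[OF E c that])
  have addP: "P w (\<lambda>y. \<alpha> y + \<beta> y) x = P w \<alpha> x + P w \<beta> x" if "section_near x \<alpha>" "section_near x \<beta>"
      for w \<alpha> \<beta>
    unfolding P_def using that by (intro D_add Tc)
  have diffP: "P w (\<lambda>y. \<alpha> y - \<beta> y) x = P w \<alpha> x - P w \<beta> x" if "section_near x \<alpha>" "section_near x \<beta>"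
      for w \<alpha> \<beta>
    unfolding P_def using that by (intro D_diff Tc)
  have C: "C w w' \<tau> y = P w (Q w' \<tau>) y - P w' (Q w \<tau>) y - Q w' (P w \<tau>) y + Q w (P w' \<tau>) y"
    if "section_near y \<tau>" "y \<in> fst (chart_at M x)" for w w' \<tau> y
    unfolding C_def nabla_form_1_eq[OF E c(1) that(2,1)]
    by (simp add: P_def Q_def nabla1_chart_def)
  have CP: "P d (C w w' \<tau>) x = P d (P w (Q w' \<tau>)) x - P d (P w' (Q w \<tau>)) x - P d (Q w' (P w \<tau>)) x
      + P d (Q w (P w' \<tau>)) x"
    if \<tau>: "section_near x \<tau>" for d w w' \<tau>
  proof -
    have e: "\<forall>\<^sub>F y in nhds x. C w w' \<tau> y = P w (Q w' \<tau>) y - P w' (Q w \<tau>) y - Q w' (P w \<tau>) y + Q w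
        (P w' \<tau>) y"
      using eventually_chart[OF c] eventually_section_near[OF \<tau>] by eventually_elim (rule C)
    have "section_near x (C w w' \<tau>)"
      unfolding C_def by (rule uform_2_section_near[OF uform_nabla_form[OF E] c \<tau>])
    then have "P d (C w w' \<tau>) x = P d (\<lambda>y. P w (Q w' \<tau>) y - P w' (Q w \<tau>) y - Q w' (P w \<tau>) y + Q w
        (P w' \<tau>) y) x"
      unfolding P_def by (intro D_cong[OF _ e[unfolded P_def] Tc])
    also have "\<dots> = P d (P w (Q w' \<tau>)) x - P d (P w' (Q w \<tau>)) x - P d (Q w' (P w \<tau>)) x + P d (Q w
        (P w' \<tau>)) x"
      by (simp add: addP diffP nP nQ \<tau> section_near_diff)
    finally show ?thesis .
  qed
  have comm: "P w (P w' \<tau>) x = P w' (P w \<tau>) x" if "section_near x \<tau>" for w w' \<tau>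
    unfolding P_def by (rule flat_commute[OF flat c that])
  have commQ: "Q d (P w (P w' \<tau>)) x = Q d (P w' (P w \<tau>)) x" if "section_near x \<tau>" for d w w' \<tau>
    unfolding Q_def using comm[OF that] by simp
  have "nabla_form M F D (nabla_form M F D E) x vs z =
     (P i (C j k \<sigma>) x - C j k (P i \<sigma>) x) - (P j (C i k \<sigma>) x - C i k (P j \<sigma>) x) + (P k (C i j \<sigma>) x
         - C i j (P k \<sigma>) x)"
    unfolding vs ijk \<sigma>(2)[symmetric] nabla_form_2_eq[OF uform_nabla_form[OF E] \<sigma>(1)]
    by (simp add: P_def C_def)
  also have "\<dots> = 0"
    \<comment> \<open>The terms with both derivatives outside \<open>E\<close> cancel by flatness on
      the sections \<open>Q w \<sigma>\<close>, those with both inside \<open>E\<close> by flatness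
      on \<sigma>. The terms with \<open>E\<close> between the two derivatives cancel
      identically.\<close>
    unfolding CP[OF \<sigma>(1)] C[OF nP[OF \<sigma>(1)] c(2)]
    using comm[OF nQ[OF \<sigma>(1)], of i j k] comm[OF nQ[OF \<sigma>(1)], of i k j] comm[OF nQ[OF \<sigma>(1)], of j k i]
      commQ[OF \<sigma>(1), of k i j] commQ[OF \<sigma>(1), of j i k] commQ[OF \<sigma>(1), of i j k]
    by (simp add: algebra_simps)
  finally show "nabla_form M F D (nabla_form M F D E) x vs z = 0" .
qed

text \<open>By the Leibniz rule the derivative of the wedge square is made of the derivative of
  \<open>E\<close> composed with \<open>E\<close> on either side, and the derivative of
  \<open>E\<close> vanishes. \<open>C0\<close> is this vanishing on a section, \<open>QQ\<close> its
  image under \<open>E\<close>.\<close>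

lemma nabla_wedge_square:
  assumes E: "uform M F 1 E" and closed: "form_eq M F 2 (nabla_form M F D E) form_zero"
  shows "form_eq M F 3 (nabla_form M F D (wedge_square E)) form_zero"
  unfolding form_eq_def form_zero_def
proof (intro allI ballI impI, elim conjE)
  fix x z and vs :: "'m tangent list" assume z: "z \<in> fibre F x" and l: "length vs = 3" and T: "set
      vs \<subseteq> tangent_space M x"
  note c = chart_at[of x]
  obtain t u v where vs: "vs = [t, u, v]"
    using l by (auto simp: numeral_3_eq_3 length_Suc_conv)
  obtain i j k where ijk: "t = coord_vec M (chart_at M x) x i" "u = coord_vec M (chart_at M x) x j"
      "v = coord_vec M (chart_at M x) x k"
    using T tangent_space_chart[OF c] vs by auto
  obtain \<sigma> where \<sigma>: "section_near x \<sigma>" "\<sigma> x = z" using ex_section_near[OF z] by blast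
  define P where "P = (\<lambda>w \<sigma> y. D \<sigma> y (coord_vec M (chart_at M x) y w))"
  define Q where "Q = (\<lambda>w \<sigma> y. E y [coord_vec M (chart_at M x) y w] (\<sigma> y))"
  have Tc: "coord_vec M (chart_at M x) x w \<in> tangent_space M x" for w using coord_vec_tangent[OF c] .
  have nP: "section_near x (P w \<tau>)" if "section_near x \<tau>" for w \<tau>
    unfolding P_def by (rule section_near_D[OF that c])
  have nQ: "section_near x (Q w \<tau>)" if "section_near x \<tau>" for w \<tau>
    unfolding Q_def by (rule uform_1_section_near[OF E c that])
  have diffP: "P w (\<lambda>y. \<alpha> y - \<beta> y) x = P w \<alpha> x - P w \<beta> x" if "section_near x \<alpha>" "section_near x \<beta>"
      for w \<alpha> \<beta>
    unfolding P_def using that by (intro D_diff Tc)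
  have C0: "P w (Q w' \<tau>) x - P w' (Q w \<tau>) x - Q w' (P w \<tau>) x + Q w (P w' \<tau>) x = 0"
    if "section_near x \<tau>" for w w' \<tau>
  proof -
    have "nabla_form M F D E x [coord_vec M (chart_at M x) x w, coord_vec M (chart_at M x) x w']
        (\<tau> x) = 0"
      using closed Tc section_near_fibre[OF that] by (simp add: form_eq_def form_zero_def)
    then show ?thesis
      unfolding nabla_form_1_eq[OF E c that] by (simp add: P_def Q_def nabla1_chart_def)
  qed
  have QQ: "Q d (P w (Q w' \<tau>)) x - Q d (P w' (Q w \<tau>)) x - Q d (Q w' (P w \<tau>)) x + Q d (Q w (P w'
      \<tau>)) x = 0"
    if \<tau>: "section_near x \<tau>" for d w w' \<tau>
  proof -
    have QE: "Q d \<alpha> x = E x [coord_vec M (chart_at M x) x d] (\<alpha> x)" for d \<alpha> by (simp add: Q_def)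
    note ah = uform_1_antihermitian[OF E Tc[of d]]
    note m = section_near_fibre[OF nP[OF nQ[OF \<tau>]]] section_near_fibre[OF nQ[OF nP[OF \<tau>]]]
    have "E x [coord_vec M (chart_at M x) x d] (P w (Q w' \<tau>) x - P w' (Q w \<tau>) x - Q w' (P w \<tau>) x +
        Q w (P w' \<tau>) x) = 0"
      unfolding C0[OF \<tau>] by (rule antihermitian_zero[OF ah])
    then show ?thesis
      by (simp add: QE[of d] antihermitian_add[OF ah] antihermitian_diff[OF ah] fibre_add fibre_diff m)
  qed
  have "nabla_form M F D (wedge_square E) x vs z =
     (P i (\<lambda>y. Q j (Q k \<sigma>) y - Q k (Q j \<sigma>) y) x - (Q j (Q k (P i \<sigma>)) x - Q k (Q j (P i \<sigma>)) x)) -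
     (P j (\<lambda>y. Q i (Q k \<sigma>) y - Q k (Q i \<sigma>) y) x - (Q i (Q k (P j \<sigma>)) x - Q k (Q i (P j \<sigma>)) x)) +
     (P k (\<lambda>y. Q i (Q j \<sigma>) y - Q j (Q i \<sigma>) y) x - (Q i (Q j (P k \<sigma>)) x - Q j (Q i (P k \<sigma>)) x))"
    unfolding vs ijk \<sigma>(2)[symmetric] nabla_form_2_eq[OF uform_wedge_square[OF E] \<sigma>(1)]
    by (simp add: P_def Q_def wedge_square_def)
  \<comment> \<open>The first three brackets are instances of \<open>C0\<close> at some
    \<open>Q w \<sigma>\<close>, the last three of \<open>QQ\<close>. The terms added to complete
    the first three are subtracted in the last three.\<close>
  also have "\<dots> =
     (P i (Q j (Q k \<sigma>)) x - P j (Q i (Q k \<sigma>)) x - Q j (P i (Q k \<sigma>)) x + Q i (P j (Q k \<sigma>)) x) +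
     (P j (Q k (Q i \<sigma>)) x - P k (Q j (Q i \<sigma>)) x - Q k (P j (Q i \<sigma>)) x + Q j (P k (Q i \<sigma>)) x) -
     (P i (Q k (Q j \<sigma>)) x - P k (Q i (Q j \<sigma>)) x - Q k (P i (Q j \<sigma>)) x + Q i (P k (Q j \<sigma>)) x) +
     (Q j (P i (Q k \<sigma>)) x - Q j (P k (Q i \<sigma>)) x - Q j (Q k (P i \<sigma>)) x + Q j (Q i (P k \<sigma>)) x) -
     (Q i (P j (Q k \<sigma>)) x - Q i (P k (Q j \<sigma>)) x - Q i (Q k (P j \<sigma>)) x + Q i (Q j (P k \<sigma>)) x) -
     (Q k (P i (Q j \<sigma>)) x - Q k (P j (Q i \<sigma>)) x - Q k (Q j (P i \<sigma>)) x + Q k (Q i (P j \<sigma>)) x)"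
    unfolding diffP[OF nQ[OF nQ[OF \<sigma>(1)]] nQ[OF nQ[OF \<sigma>(1)]]]
    by (simp add: algebra_simps)
  also have "\<dots> = 0"
    unfolding C0[OF nQ[OF \<sigma>(1)]] QQ[OF \<sigma>(1)] by simp
  finally show "nabla_form M F D (wedge_square E) x vs z = 0" .
qed

end

section \<open>Inverse Gram matrices\<close>

text \<open>Covers \<open>x \<mapsto> x\<close> on the reals and complex conjugation, so that tangent spaces and fibres are
  treated alike.\<close>

locale conjugation =
  fixes cj :: "'k::real_normed_field \<Rightarrow> 'k"
  assumes cj_add: "cj (x + y) = cj x + cj y"
    and cj_mult: "cj (x * y) = cj x * cj y"
    and cj_cj: "cj (cj x) = x"
    and mult_cj: "x * cj x = of_real ((norm x)\<^sup>2)"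
    and continuous_cj: "continuous_on UNIV cj"
begin

lemma cj_0: "cj 0 = 0"
  using cj_add[of 0 0] by simp

lemma cj_of_real: "cj (of_real t) = of_real t"
proof (cases "t = 0")
  case False
  then have "of_real t * cj (of_real t) = of_real t * of_real t"
    using mult_cj[of "of_real t"] by (simp add: power2_eq_square)
  then show ?thesis using False by simp
qed (simp add: cj_0)

lemma cj_1: "cj 1 = 1"
  using cj_of_real[of 1] by simp

lemma cj_minus: "cj (- x) = - cj x"
  using cj_add[of x "- x"] by (simp add: cj_0 eq_neg_iff_add_eq_0 add.commute)

lemma cj_diff: "cj (x - y) = cj x - cj y"
  using cj_add[of x "- y"] by (simp add: cj_minus)

lemma cj_sum: "cj (\<Sum>i\<in>I. f i) = (\<Sum>i\<in>I. cj (f i))"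
  by (induction I rule: infinite_finite_induct) (auto simp: cj_0 cj_add)

lemma continuous_on_cj: "continuous_on S f \<Longrightarrow> continuous_on S (\<lambda>x. cj (f x))"
  using continuous_on_compose2[OF continuous_cj] by auto

text \<open>If the rows of \<open>C\<close> are orthonormal, the squared distance of \<open>C\<^sup>*C\<close> from the identity is
  \<open>r - 2r + r = 0\<close>.\<close>

lemma orthonormal_columns:
  fixes r :: nat
  assumes rows: "\<And>k l. k < r \<Longrightarrow> l < r \<Longrightarrow> (\<Sum>i<r. c k i * cj (c l i)) = (if k = l then 1 else 0)"
    and ij: "i < r" "j < r"
  shows "(\<Sum>k<r. c k i * cj (c k j)) = (if i = j then 1 else 0)"
proof -
  define X where "X = (\<lambda>i j. \<Sum>k<r. c k i * cj (c k j))"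
  define \<delta> :: "nat \<Rightarrow> nat \<Rightarrow> 'k" where "\<delta> = (\<lambda>i j. if i = j then 1 else 0)"
  have trace: "(\<Sum>i<r. X i i) = of_nat r"
  proof -
    have "(\<Sum>i<r. X i i) = (\<Sum>k<r. \<Sum>i<r. c k i * cj (c k i))" unfolding X_def by (rule sum.swap)
    also have "\<dots> = (\<Sum>k<r. 1)" by (rule sum.cong) (simp_all add: rows)
    finally show ?thesis by simp
  qed
  have square: "(\<Sum>i<r. \<Sum>j<r. X i j * cj (X i j)) = of_nat r"
  proof -
    have "(\<Sum>i<r. \<Sum>j<r. X i j * cj (X i j)) =
      (\<Sum>i<r. \<Sum>j<r. \<Sum>k<r. \<Sum>l<r. (c k i * cj (c l i)) * (cj (c k j) * c l j))"
      by (simp add: X_def cj_sum cj_mult cj_cj sum_product algebra_simps)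
    \<comment> \<open>The sums are reordered until, for fixed \<open>k\<close> and \<open>l\<close>,
      those over \<open>i\<close> and \<open>j\<close> factor into two row products.\<close>
    also have "\<dots> = (\<Sum>i<r. \<Sum>k<r. \<Sum>j<r. \<Sum>l<r. (c k i * cj (c l i)) * (cj (c k j) * c l j))"
      by (intro sum.cong refl sum.swap)
    also have "\<dots> = (\<Sum>k<r. \<Sum>i<r. \<Sum>l<r. \<Sum>j<r. (c k i * cj (c l i)) * (cj (c k j) * c l j))"
      by (subst sum.swap, intro sum.cong refl sum.swap)
    also have "\<dots> = (\<Sum>k<r. \<Sum>l<r. \<Sum>i<r. \<Sum>j<r. (c k i * cj (c l i)) * (cj (c k j) * c l j))"
      by (intro sum.cong refl sum.swap)
    also have "\<dots> = (\<Sum>k<r. \<Sum>l<r. (\<Sum>i<r. c k i * cj (c l i)) * (\<Sum>j<r. c l j * cj (c k j)))"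
      by (simp add: sum_product mult.commute)
    also have "\<dots> = (\<Sum>k<r. \<Sum>l<r. if k = l then 1 else 0)"
      by (intro sum.cong refl) (simp add: rows)
    also have "\<dots> = of_nat r" by simp
    finally show ?thesis .
  qed
  have "(\<Sum>i<r. \<Sum>j<r. (\<delta> i j - X i j) * cj (\<delta> i j - X i j)) = 0"
  proof -
    have "(\<delta> i j - X i j) * cj (\<delta> i j - X i j) =
        X i j * cj (X i j) + (if i = j then 1 - X i i - cj (X i i) else 0)" for i j
      by (simp add: \<delta>_def cj_diff cj_0 cj_1 cj_minus algebra_simps)
    then have "(\<Sum>i<r. \<Sum>j<r. (\<delta> i j - X i j) * cj (\<delta> i j - X i j)) =
       (\<Sum>i<r. \<Sum>j<r. X i j * cj (X i j)) + (\<Sum>i<r. 1 - X i i - cj (X i i))"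
      by (simp add: sum.distrib)
    also have "(\<Sum>i<r. 1 - X i i - cj (X i i)) = of_nat r - of_nat r - cj (of_nat r)"
      by (simp add: sum_subtractf trace cj_sum[symmetric])
    also have "cj (of_nat r) = of_nat r" using cj_of_real[of "real r"] by simp
    finally show ?thesis by (simp add: square)
  qed
  then have "of_real (\<Sum>i<r. \<Sum>j<r. (norm (\<delta> i j - X i j))\<^sup>2) = (0 :: 'k)"
    by (simp only: mult_cj of_real_sum)
  then have "(\<Sum>i<r. \<Sum>j<r. (norm (\<delta> i j - X i j))\<^sup>2) = 0"
    by (simp only: of_real_eq_0_iff)
  then have "norm (\<delta> i j - X i j) = 0"
    using ij by (simp add: sum_nonneg_eq_0_iff sum_nonneg)
  then show ?thesis by (simp add: X_def \<delta>_def)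
qed

end

text \<open>\<open>H i j y\<close> plays the Gram matrix, at the parameter \<open>y\<close>, of a
  basis of the tangent space or of the fibre. Positivity is phrased by a positive real number
  because the values may be complex.\<close>

locale gram_family = conjugation cj
  for cj :: "'k::real_normed_field \<Rightarrow> 'k" +
  fixes W :: "'y::topological_space set" and r :: nat and H :: "nat \<Rightarrow> nat \<Rightarrow> 'y \<Rightarrow> 'k"
  assumes cont_H: "i < r \<Longrightarrow> j < r \<Longrightarrow> continuous_on W (H i j)"
    and herm_H: "y \<in> W \<Longrightarrow> i < r \<Longrightarrow> j < r \<Longrightarrow> H i j y = cj (H j i y)"
    and pos_H: "y \<in> W \<Longrightarrow> i < r \<Longrightarrow> c i \<noteq> 0 \<Longrightarrow> \<exists>t>0. (\<Sum>i<r. \<Sum>j<r. c i * cj (c j) * H i j y) = of_real t"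
begin

section \<open>Gram-Schmidt with continuous dependence on a parameter\<close>

definition B :: "'y \<Rightarrow> (nat \<Rightarrow> 'k) \<Rightarrow> (nat \<Rightarrow> 'k) \<Rightarrow> 'k" where
  "B y c d = (\<Sum>i<r. \<Sum>j<r. c i * cj (d j) * H i j y)"

definition orthonormal :: "'y \<Rightarrow> nat \<Rightarrow> (nat \<Rightarrow> nat \<Rightarrow> 'k) \<Rightarrow> bool" where
  "orthonormal y k a \<longleftrightarrow> (\<forall>l<k. \<forall>m<k. B y (a l) (a m) = (if l = m then 1 else 0))"

lemma B_diff_left: "B y (\<lambda>i. c i - c' i) d = B y c d - B y c' d"
  by (simp add: B_def sum_subtractf algebra_simps)

lemma B_scale_left: "B y (\<lambda>i. s * c i) d = s * B y c d"
  by (simp add: B_def sum_distrib_left mult.assoc)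

lemma B_sum_left: "B y (\<lambda>i. \<Sum>l\<in>L. s l * c l i) d = (\<Sum>l\<in>L. s l * B y (c l) d)"
proof (induction L rule: infinite_finite_induct)
  case (insert l L)
  have "B y (\<lambda>i. s l * c l i - (- (\<Sum>l\<in>L. s l * c l i))) d =
     s l * B y (c l) d - B y (\<lambda>i. - (\<Sum>l\<in>L. s l * c l i)) d"
    by (subst B_diff_left) (simp add: B_scale_left)
  also have "B y (\<lambda>i. - (\<Sum>l\<in>L. s l * c l i)) d = - B y (\<lambda>i. \<Sum>l\<in>L. s l * c l i) d"
    by (simp add: B_def sum_negf)
  finally show ?case using insert by simp
qed (simp_all add: B_def)

lemma B_commute: "y \<in> W \<Longrightarrow> B y c d = cj (B y d c)"
  unfolding B_def cj_sum
  by (subst sum.swap) (auto intro!: sum.cong simp: cj_mult cj_cj herm_H[symmetric])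

lemma continuous_on_B:
  assumes "\<And>i. i < r \<Longrightarrow> continuous_on W (c i)" "\<And>i. i < r \<Longrightarrow> continuous_on W (d i)"
  shows "continuous_on W (\<lambda>y. B y (\<lambda>i. c i y) (\<lambda>i. d i y))"
  unfolding B_def
  by (intro continuous_on_sum continuous_on_mult continuous_on_cj assms cont_H) auto

text \<open>Triangularity keeps the residual of the next unit vector nonzero, since the earlier
  vectors have no component there. Spanning records that the coefficient matrix is
  invertible.\<close>

definition orthonormal_family :: "nat \<Rightarrow> ('y \<Rightarrow> nat \<Rightarrow> nat \<Rightarrow> 'k) \<Rightarrow> bool" where
  "orthonormal_family k a \<longleftrightarrow> (\<forall>l<k. \<forall>i. continuous_on W (\<lambda>y. a y l i)) \<and>
     (\<forall>y\<in>W. orthonormal y k (a y) \<and> (\<forall>l<k. \<forall>i>l. a y l i = 0) \<and>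
       (\<forall>m<k. \<exists>b. \<forall>i. (if i = m then 1 else 0) = (\<Sum>l<k. b l * a y l i)))"

text \<open>The unit vectors are orthonormalised for all parameters at once. Only sums, products,
  conjugates and division by a positive norm occur, so the coefficients depend continuously on
  \<open>y\<close>.\<close>

lemma gram_schmidt: "k \<le> r \<Longrightarrow> \<exists>a. orthonormal_family k a"
proof (induction k)
  case 0
  then show ?case by (auto simp: orthonormal_def orthonormal_family_def)
next
  case (Suc k)
  then obtain a where "orthonormal_family k a" by auto
  then have cont: "\<And>l i. l < k \<Longrightarrow> continuous_on W (\<lambda>y. a y l i)"
    and on: "\<And>y. y \<in> W \<Longrightarrow> orthonormal y k (a y)"
    and tri: "\<And>y l i. y \<in> W \<Longrightarrow> l < k \<Longrightarrow> i > l \<Longrightarrow> a y l i = 0"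
    and span: "\<And>y m. y \<in> W \<Longrightarrow> m < k \<Longrightarrow> \<exists>b. \<forall>i. (if i = m then 1 else 0) = (\<Sum>l<k. b l * a y l i)"
    unfolding orthonormal_family_def by blast+
  define e :: "nat \<Rightarrow> 'k" where "e = (\<lambda>i. if i = k then 1 else 0)"
  define b where "b = (\<lambda>y i. e i - (\<Sum>l<k. B y e (a y l) * a y l i))"
  define N where "N = (\<lambda>y. sqrt (norm (B y (b y) (b y))))"
  define a' where "a' = (\<lambda>y l i. if l = k then of_real (1 / N y) * b y i else a y l i)"
  have cont_b: "continuous_on W (\<lambda>y. b y i)" for i
    unfolding b_def by (intro continuous_intros continuous_on_B cont) auto
  have N: "N y > 0" "B y (b y) (b y) = of_real ((N y)\<^sup>2)" if y: "y \<in> W" for y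
  proof -
    have "b y k = 1" using tri[OF y] by (simp add: b_def e_def)
    then obtain t where t: "t > 0" "B y (b y) (b y) = of_real t"
      using pos_H[OF y, of k "b y"] Suc.prems unfolding B_def by auto
    then show "N y > 0" "B y (b y) (b y) = of_real ((N y)\<^sup>2)" by (simp_all add: N_def)
  qed
  have cont_N: "continuous_on W (\<lambda>y. of_real (1 / N y) :: 'k)"
    using N(1) unfolding N_def by (intro continuous_intros continuous_on_B cont_b) force
  have cont': "continuous_on W (\<lambda>y. a' y l i)" if "l < Suc k" for l i
    using that cont continuous_on_mult[OF cont_N cont_b[of i]] by (cases "l = k") (simp_all add: a'_def)
  have orth: "B y (b y) (a y m) = 0" if y: "y \<in> W" and m: "m < k" for y m
  proof -
    have "B y (b y) (a y m) = B y e (a y m) - (\<Sum>l<k. B y e (a y l) * B y (a y l) (a y m))"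
      unfolding b_def B_diff_left B_sum_left ..
    also have "(\<Sum>l<k. B y e (a y l) * B y (a y l) (a y m)) = (\<Sum>l<k. if l = m then B y e (a y m) else 0)"
      using on[OF y] m by (intro sum.cong) (auto simp: orthonormal_def)
    finally show ?thesis using m by simp
  qed
  have B': "B y (a' y k) d = of_real (1 / N y) * B y (b y) d" for y d
    unfolding a'_def using B_scale_left[of y "of_real (1 / N y)" "b y" d] by simp
  have B'k: "B y (b y) (a' y k) = of_real (N y)" if y: "y \<in> W" for y
  proof -
    have "B y (a' y k) (b y) = of_real (1 / N y * (N y)\<^sup>2)"
      unfolding B' N(2)[OF y] by simp
    also have "1 / N y * (N y)\<^sup>2 = N y" using N(1)[OF y] by (simp add: power2_eq_square)
    finally show ?thesis using B_commute[OF y, of "b y" "a' y k"] by (simp add: cj_of_real)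
  qed
  have a'a: "a' y l = a y l" if "l \<noteq> k" for y l using that by (simp add: a'_def)
  have on': "orthonormal y (Suc k) (a' y)" if y: "y \<in> W" for y
    unfolding orthonormal_def
  proof (intro allI impI)
    fix l m assume lm: "l < Suc k" "m < Suc k"
    consider "l = k" "m = k" | "l = k" "m < k" | "l < k" "m = k" | "l < k" "m < k"
      using lm by linarith
    then show "B y (a' y l) (a' y m) = (if l = m then 1 else 0)"
    proof cases
      case 1
      then show ?thesis using N(1)[OF y] B'[of y "a' y k"] B'k[OF y] by simp
    next
      case 2
      then show ?thesis using B'[of y "a' y m"] orth[OF y] by (simp add: a'a)
    next
      case 3
      then have "B y (a' y m) (a' y l) = 0" using B'[of y "a' y l"] orth[OF y] by (simp add: a'a)
      then show ?thesis using 3 B_commute[OF y, of "a' y l" "a' y m"] by (simp add: cj_0)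
    next
      case 4
      then show ?thesis using on[OF y] by (simp add: a'a orthonormal_def)
    qed
  qed
  have tri': "a' y l i = 0" if "y \<in> W" "l < Suc k" "i > l" for y l i
    using that tri[OF that(1)] by (cases "l = k") (auto simp: a'_def b_def e_def)
  have span': "\<exists>b. \<forall>i. (if i = m then 1 else 0) = (\<Sum>l<Suc k. b l * a' y l i)" if y: "y \<in> W" and m:
      "m < Suc k" for y m
  proof (cases "m = k")
    case True
    have eq: "e i = (\<Sum>l<k. B y e (a y l) * a' y l i) + of_real (N y) * a' y k i" for i
    proof -
      have "(\<Sum>l<k. B y e (a y l) * a' y l i) = (\<Sum>l<k. B y e (a y l) * a y l i)"
        by (intro sum.cong) (simp_all add: a'_def)
      moreover have "of_real (N y) * a' y k i = b y i" using N(1)[OF y] by (simp add: a'_def)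
      ultimately show ?thesis by (simp add: b_def)
    qed
    define b' where "b' = (\<lambda>l. if l = k then of_real (N y) else B y e (a y l))"
    have "(if i = m then 1 else 0) = (\<Sum>l<Suc k. b' l * a' y l i)" for i
    proof -
      have "(if i = m then 1 else 0) = e i" by (simp add: e_def True)
      also have "\<dots> = (\<Sum>l<k. B y e (a y l) * a' y l i) + of_real (N y) * a' y k i" by (rule eq)
      also have "(\<Sum>l<k. B y e (a y l) * a' y l i) = (\<Sum>l<k. b' l * a' y l i)"
        by (intro sum.cong) (simp_all add: b'_def)
      also have "of_real (N y) * a' y k i = b' k * a' y k i" by (simp add: b'_def)
      finally show ?thesis by simp
    qed
    then show ?thesis by blast
  next
    case False
    then obtain b where "\<forall>i. (if i = m then 1 else 0) = (\<Sum>l<k. b l * a y l i)" using span[OF y, of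
        m] m by auto
    then show ?thesis by (intro exI[of _ "b(k := 0)"]) (auto simp: a'a intro!: sum.cong)
  qed
  show ?case unfolding orthonormal_family_def
    using cont' on' tri' span' by (intro exI[of _ a']) blast
qed

text \<open>Up to transposition both sums are the inverse Gram matrix, computed from two orthonormal
  bases. The change of basis \<open>u\<close> has orthonormal rows, hence orthonormal columns, and
  the sum over \<open>k\<close> contracts its columns.\<close>

lemma orthonormal_coefficients:
  assumes y: "y \<in> W" and a: "orthonormal y r a" and c: "orthonormal y r c"
    and span: "\<And>m. m < r \<Longrightarrow> \<exists>b. \<forall>i. (if i = m then 1 else 0) = (\<Sum>l<r. b l * a l i)"
    and i: "i < r" and j: "j < r"
  shows "(\<Sum>k<r. c k i * cj (c k j)) = (\<Sum>k<r. a k i * cj (a k j))"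
proof -
  obtain b where b: "\<And>m i. m < r \<Longrightarrow> (if i = m then 1 else 0) = (\<Sum>l<r. b m l * a l i)"
    using span by metis
  define u where "u = (\<lambda>k l. \<Sum>m<r. c k m * b m l)"
  have cu: "c k i = (\<Sum>l<r. u k l * a l i)" if "i < r" for k i
  proof -
    have "c k i = (\<Sum>m<r. c k m * (if i = m then 1 else 0))"
      using that by (simp add: if_distrib cong: if_cong)
    also have "\<dots> = (\<Sum>m<r. c k m * (\<Sum>l<r. b m l * a l i))" by (intro sum.cong) (simp_all add: b)
    also have "\<dots> = (\<Sum>m<r. \<Sum>l<r. c k m * b m l * a l i)" by (simp add: sum_distrib_left mult.assoc)
    also have "\<dots> = (\<Sum>l<r. u k l * a l i)" by (subst sum.swap) (simp add: u_def sum_distrib_right)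
    finally show ?thesis .
  qed
  have Bc: "B y (c k) d = (\<Sum>l<r. u k l * B y (a l) d)" for k d
  proof -
    have "B y (c k) d = B y (\<lambda>i. \<Sum>l<r. u k l * a l i) d"
      unfolding B_def by (intro sum.cong) (simp_all add: cu)
    then show ?thesis by (simp add: B_sum_left)
  qed
  have Ba: "B y (a l) (c k) = cj (u k l)" if "l < r" for k l
  proof -
    have "B y (c k) (a l) = (\<Sum>m<r. if m = l then u k m else 0)"
      unfolding Bc using a that by (intro sum.cong) (simp_all add: orthonormal_def)
    also have "\<dots> = u k l" using that by simp
    finally show ?thesis using B_commute[OF y, of "a l" "c k"] by simp
  qed
  have rows: "(\<Sum>l<r. u k l * cj (u m l)) = (if k = m then 1 else 0)" if "k < r" "m < r" for k m
    using c that Bc[of k "c m"] by (simp add: Ba orthonormal_def)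
  have "(\<Sum>k<r. c k i * cj (c k j)) = (\<Sum>k<r. \<Sum>l<r. \<Sum>m<r. (a l i * cj (a m j)) * (u k l * cj (u k m)))"
    using i j by (simp add: cu cj_sum cj_mult sum_product algebra_simps)
  also have "\<dots> = (\<Sum>l<r. \<Sum>k<r. \<Sum>m<r. (a l i * cj (a m j)) * (u k l * cj (u k m)))"
    by (rule sum.swap)
  also have "\<dots> = (\<Sum>l<r. \<Sum>m<r. \<Sum>k<r. (a l i * cj (a m j)) * (u k l * cj (u k m)))"
    by (intro sum.cong refl sum.swap)
  also have "\<dots> = (\<Sum>l<r. \<Sum>m<r. (a l i * cj (a m j)) * (\<Sum>k<r. u k l * cj (u k m)))"
    by (simp add: sum_distrib_left)
  also have "\<dots> = (\<Sum>l<r. \<Sum>m<r. if l = m then a l i * cj (a m j) else 0)"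
    by (intro sum.cong refl) (simp add: orthonormal_columns[OF rows])
  also have "\<dots> = (\<Sum>l<r. a l i * cj (a l j))" by simp
  finally show ?thesis .
qed

text \<open>\<open>G\<close> is continuous although the orthonormal basis \<open>c\<close> entering
  it may be picked at each point without any continuity. The last fact provides an orthonormal basis
  that spans.\<close>

lemma inverse_gram:
  obtains G where "\<And>i j. continuous_on W (G i j)"
    and "\<And>y c i j. y \<in> W \<Longrightarrow> orthonormal y r c \<Longrightarrow> i < r \<Longrightarrow> j < r \<Longrightarrow> (\<Sum>k<r. c k i * cj (c k j)) = G i j y"
    and "\<And>y. y \<in> W \<Longrightarrow> \<exists>a. orthonormal y r a \<and>
      (\<forall>m<r. \<exists>b. \<forall>i. (if i = m then 1 else 0) = (\<Sum>l<r. b l * a l i))"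
proof -
  obtain a where "orthonormal_family r a" using gram_schmidt[OF order_refl] by blast
  then have cont: "\<And>l i. l < r \<Longrightarrow> continuous_on W (\<lambda>y. a y l i)"
    and on: "\<And>y. y \<in> W \<Longrightarrow> orthonormal y r (a y)"
    and span: "\<And>y m. y \<in> W \<Longrightarrow> m < r \<Longrightarrow> \<exists>b. \<forall>i. (if i = m then 1 else 0) = (\<Sum>l<r. b l * a y l i)"
    unfolding orthonormal_family_def by blast+
  show thesis
  proof (rule that[of "\<lambda>i j y. \<Sum>k<r. a y k i * cj (a y k j)"])
    show "continuous_on W (\<lambda>y. \<Sum>k<r. a y k i * cj (a y k j))" for i j
      by (intro continuous_intros continuous_on_cj cont) auto
    show "(\<Sum>k<r. c k i * cj (c k j)) = (\<Sum>k<r. a y k i * cj (a y k j))"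
      if "y \<in> W" "orthonormal y r c" "i < r" "j < r" for y c i j
      by (rule orthonormal_coefficients[OF that(1) on[OF that(1)] that(2) span[OF that(1)] that(3,4)])
    show "\<exists>a. orthonormal y r a \<and> (\<forall>m<r. \<exists>b. \<forall>i. (if i = m then 1 else 0) = (\<Sum>l<r. b l * a l i))"
      if "y \<in> W" for y
      using on[OF that] span[OF that] by blast
  qed
qed

end

lemma conjugation_real: "conjugation (\<lambda>x::real. x)"
  by unfold_locales (auto simp: power2_eq_square abs_mult_self_eq)

lemma conjugation_complex: "conjugation cnj"
  by unfold_locales (auto simp: complex_norm_square[symmetric] intro: continuous_on_cnj)

section \<open>Orthonormal bases\<close>

context manifold
begin

lemma smooth_fun_continuous:
  assumes W: "open W" and f: "smooth_fun M W f"
  shows "continuous_on W f"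
  unfolding continuous_on_eq_continuous_at[OF W]
proof
  fix x assume x: "x \<in> W"
  obtain c where c: "c \<in> atlas M" "x \<in> fst c" using ex_chart by blast
  have o: "open (W \<inter> fst c)" using W open_chart[OF c(1)] by auto
  have "smooth_on (snd c ` (W \<inter> fst c)) (f \<circ> chart_inv c)"
    using f c by (simp add: smooth_fun_def)
  then have "continuous_on (W \<inter> fst c) ((f \<circ> chart_inv c) \<circ> snd c)"
    by (intro continuous_on_compose smooth_on_continuous continuous_on_subset[OF
        continuous_on_chart[OF c(1)]]) auto
  then have "continuous_on (W \<inter> fst c) f"
    by (rule continuous_on_cong[THEN iffD1, rotated 2]) (use c in auto)
  then show "continuous (at x) f"
    using continuous_on_eq_continuous_at[OF o] x c by auto
qed

section \<open>The Riemannian metric and its inverse\<close>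

lemma riemannian: "riemannian_metric M"
  using oriented_riemannian_M by (simp add: oriented_riemannian_manifold_def)

lemma rmetric_sym: "u \<in> tangent_space M x \<Longrightarrow> v \<in> tangent_space M x \<Longrightarrow> rmetric M x u v = rmetric M x v u"
  using riemannian unfolding riemannian_metric_def by blast

lemma rmetric_tcomb:
  "u \<in> tangent_space M x \<Longrightarrow> v \<in> tangent_space M x \<Longrightarrow> w \<in> tangent_space M x \<Longrightarrow>
   rmetric M x (tcomb a u b v) w = a * rmetric M x u w + b * rmetric M x v w"
  using riemannian unfolding riemannian_metric_def by blast

lemma rmetric_pos: "u \<in> tangent_space M x \<Longrightarrow> u \<noteq> (\<lambda>f. 0) \<Longrightarrow> rmetric M x u u > 0"
  using riemannian unfolding riemannian_metric_def by blast

lemma coord_vec_eq_0: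
  assumes c: "c \<in> atlas M" "x \<in> fst c"
  shows "coord_vec M c x w = (\<lambda>f. 0) \<longleftrightarrow> w = 0"
proof -
  have "coord_vec M c x 0 = (\<lambda>f. 0)"
    using coord_vec_tcomb[OF c, of 0 0 0 0] by (simp add: tcomb_def)
  then show ?thesis using coord_vec_inject[OF c] by metis
qed

definition tangent_bilinear :: "'m \<Rightarrow> ('m tangent \<Rightarrow> 'm tangent \<Rightarrow> real) \<Rightarrow> bool" where
  "tangent_bilinear x T \<longleftrightarrow>
     (\<forall>u\<in>tangent_space M x. \<forall>v\<in>tangent_space M x. \<forall>w\<in>tangent_space M x. \<forall>a b.
        T (tcomb a u b v) w = a * T u w + b * T v w \<and> T w (tcomb a u b v) = a * T w u + b * T w v)"

lemma tangent_bilinear_expansion: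
  assumes T: "tangent_bilinear x T" and c: "c \<in> atlas M" "x \<in> fst c"
  shows "T (coord_vec M c x w) (coord_vec M c x w') =
    (\<Sum>i\<in>UNIV. \<Sum>j\<in>UNIV. w $ i * w' $ j * T (coord_vec M c x (axis i 1)) (coord_vec M c x (axis j 1)))"
proof -
  have expand: "f (w :: real ^ 'n) = (\<Sum>i\<in>UNIV. w $ i * f (axis i 1))"
    if lin: "\<And>a b w w'. f (a *\<^sub>R w + b *\<^sub>R w') = a * f w + b * f w'" for f :: "real ^ 'n \<Rightarrow> real" and w
  proof -
    have "linear f"
      using lin[of 1 _ 1] lin[of _ _ 0] by (intro linearI) auto
    then have "f (\<Sum>i\<in>UNIV. w $ i *\<^sub>R axis i 1) = (\<Sum>i\<in>UNIV. w $ i * f (axis i 1))"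
      by (simp add: linear_sum linear_scale)
    then show ?thesis using basis_expansion[of w] by (simp add: scalar_mult_eq_scaleR)
  qed
  have "T (coord_vec M c x w) (coord_vec M c x w') =
      (\<Sum>i\<in>UNIV. w $ i * T (coord_vec M c x (axis i 1)) (coord_vec M c x w'))"
    by (rule expand) (use T in \<open>simp add: tangent_bilinear_def coord_vec_tcomb[OF c]
        coord_vec_tangent[OF c]\<close>)
  also have "\<dots> = (\<Sum>i\<in>UNIV. w $ i * (\<Sum>j\<in>UNIV. w' $ j * T (coord_vec M c x (axis i 1)) (coord_vec M
      c x (axis j 1))))"
    by (subst expand[where f = "\<lambda>w'. T (coord_vec M c x (axis _ 1)) (coord_vec M c x w')"])
       (use T in \<open>simp_all add: tangent_bilinear_def coord_vec_tcomb[OF c] coord_vec_tangent[OF c]\<close>)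
  finally show ?thesis by (simp add: sum_distrib_left mult.assoc)
qed

lemma tangent_bilinear_rmetric: "tangent_bilinear x (rmetric M x)"
  unfolding tangent_bilinear_def
proof (intro ballI allI conjI)
  fix u v w a b assume T: "u \<in> tangent_space M x" "v \<in> tangent_space M x" "w \<in> tangent_space M x"
  show "rmetric M x (tcomb a u b v) w = a * rmetric M x u w + b * rmetric M x v w"
    by (rule rmetric_tcomb[OF T])
  then show "rmetric M x w (tcomb a u b v) = a * rmetric M x w u + b * rmetric M x w v"
    by (simp only: rmetric_sym[OF T(3) tcomb_tangent[OF T(1,2)]] rmetric_sym[OF T(3,1)]
        rmetric_sym[OF T(3,2)])
qed

text \<open>A trace over an orthonormal basis is a contraction with the inverse metric, whose
  coefficients are continuous on the chart domain. The last fact serves the proof of definiteness,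
  which needs a basis that spans.\<close>

lemma tangent_inverse_gram:
  assumes c: "c \<in> atlas M"
  obtains g where "\<And>i j. continuous_on (fst c) (g i j)"
    and "\<And>x \<epsilon> T. x \<in> fst c \<Longrightarrow> tangent_onb M x \<epsilon> \<Longrightarrow> tangent_bilinear x T \<Longrightarrow>
       (\<Sum>i\<in>UNIV. T (\<epsilon> i) (\<epsilon> i)) =
       (\<Sum>i\<in>UNIV. \<Sum>j\<in>UNIV. g i j x * T (coord_vec M c x (axis i 1)) (coord_vec M c x (axis j 1)))"
    and "\<And>x. x \<in> fst c \<Longrightarrow> \<exists>w. tangent_onb M x (\<lambda>i. coord_vec M c x (w i)) \<and>
       (\<forall>m. \<exists>b. axis m 1 = (\<Sum>k\<in>UNIV. b k *\<^sub>R w k))"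
proof -
  define n where "n = CARD('n)"
  \<comment> \<open>Coordinates are indexed by the type \<open>'n\<close>, vectors in
    \<open>gram_family\<close> by the numbers below \<open>n\<close>; \<open>\<phi>\<close> and
    \<open>\<psi>\<close> translate.\<close>
  obtain \<phi> :: "nat \<Rightarrow> 'n" where "bij_betw \<phi> {0..<n} UNIV"
    using ex_bij_betw_nat_finite[of "UNIV :: 'n set"] unfolding n_def by auto
  then have \<phi>: "bij_betw \<phi> {..<n} UNIV" by (simp add: atLeast0LessThan)
  define \<psi> where "\<psi> = inv_into {..<n} \<phi>"
  have \<psi>: "\<phi> (\<psi> i) = i" "\<psi> i < n" for i
    using bij_betw_inv_into_right[OF \<phi>, of i] bij_betw_apply[OF bij_betw_inv_into[OF \<phi>], of i]
    by (auto simp: \<psi>_def)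
  have \<psi>\<phi>: "\<psi> (\<phi> i) = i" if "i < n" for i
    using bij_betw_inv_into_left[OF \<phi>, of i] that by (simp add: \<psi>_def)
  have re: "(\<Sum>i\<in>UNIV. f i) = (\<Sum>i<n. f (\<phi> i))" for f :: "'n \<Rightarrow> 'z::comm_monoid_add"
    using sum.reindex_bij_betw[OF \<phi>, of f] by simp
  define H where "H = (\<lambda>i j x. rmetric M x (coord_vec M c x (axis (\<phi> i) 1)) (coord_vec M c x (axis
      (\<phi> j) 1)))"
  define V where "V = (\<lambda>a :: nat \<Rightarrow> real. \<chi> i. a (\<psi> i))"
  have rm: "rmetric M x (coord_vec M c x (V a)) (coord_vec M c x (V b)) = (\<Sum>i<n. \<Sum>j<n. a i * b j *
      H i j x)"
    if "x \<in> fst c" for x a b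
    unfolding tangent_bilinear_expansion[OF tangent_bilinear_rmetric c that, of "V a" "V b"] re
    by (intro sum.cong) (auto simp: V_def \<psi>\<phi> H_def)
  interpret conjugation "\<lambda>x::real. x" by (rule conjugation_real)
  interpret gf: gram_family "\<lambda>x::real. x" "fst c" n H
  proof unfold_locales
    show "continuous_on (fst c) (H i j)" for i j
      using riemannian c unfolding H_def riemannian_metric_def
      by (intro smooth_fun_continuous open_chart) auto
    show "H i j x = H j i x" if "x \<in> fst c" for i j x
      unfolding H_def by (intro rmetric_sym coord_vec_tangent c that)
    show "\<exists>t>0. (\<Sum>i<n. \<Sum>j<n. a i * a j * H i j x) = of_real t" if x: "x \<in> fst c" and a: "i < n" "a
        i \<noteq> 0" for x i a
    proof -
      have "V a \<noteq> 0" using a \<psi>\<phi>[of i] unfolding V_def vec_eq_iff by (auto intro!: exI[of _ "\<phi> i"])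
      then have "rmetric M x (coord_vec M c x (V a)) (coord_vec M c x (V a)) > 0"
        using coord_vec_eq_0[OF c x] coord_vec_tangent[OF c x] by (intro rmetric_pos) auto
      then show ?thesis unfolding rm[OF x] by auto
    qed
  qed
  obtain G where G: "\<And>i j. continuous_on (fst c) (G i j)"
    "\<And>y a i j. y \<in> fst c \<Longrightarrow> gf.orthonormal y n a \<Longrightarrow> i < n \<Longrightarrow> j < n \<Longrightarrow> (\<Sum>k<n. a k i * a k j) = G i j y"
    "\<And>y. y \<in> fst c \<Longrightarrow> \<exists>a. gf.orthonormal y n a \<and>
      (\<forall>m<n. \<exists>b. \<forall>i. (if i = m then 1 else 0) = (\<Sum>l<n. b l * a l i))"
    using gf.inverse_gram by blast
  show thesis
  proof (rule that[of "\<lambda>i j. G (\<psi> i) (\<psi> j)"])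
    show "continuous_on (fst c) (G (\<psi> i) (\<psi> j))" for i j by (rule G(1))
    show "(\<Sum>i\<in>UNIV. T (\<epsilon> i) (\<epsilon> i)) = (\<Sum>i\<in>UNIV. \<Sum>j\<in>UNIV. G (\<psi> i) (\<psi> j) x *
        T (coord_vec M c x (axis i 1)) (coord_vec M c x (axis j 1)))"
      if x: "x \<in> fst c" and \<epsilon>: "tangent_onb M x \<epsilon>" and T: "tangent_bilinear x T" for x \<epsilon> T
    proof -
      have "\<forall>i. \<exists>w. \<epsilon> i = coord_vec M c x w"
        using \<epsilon> tangent_space_chart[OF c x] unfolding tangent_onb_def by blast
      then obtain w where w: "\<And>i. \<epsilon> i = coord_vec M c x (w i)" by metis
      define a where "a = (\<lambda>k i. w (\<phi> k) $ \<phi> i)"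
      have Va: "V (a k) = w (\<phi> k)" for k by (simp add: V_def a_def \<psi> vec_eq_iff)
      have "gf.orthonormal x n a"
        unfolding gf.orthonormal_def gf.B_def
      proof (intro allI impI)
        fix l m assume "l < n" "m < n"
        then have "\<phi> l = \<phi> m \<longleftrightarrow> l = m" using \<psi>\<phi> by metis
        then show "(\<Sum>i<n. \<Sum>j<n. a l i * a m j * H i j x) = (if l = m then 1 else 0)"
          using \<epsilon> unfolding rm[OF x, symmetric] Va w[symmetric] tangent_onb_def by simp
      qed
      note ga = G(2)[OF x this]
      define t where "t = (\<lambda>i j. T (coord_vec M c x (axis (\<phi> i) 1)) (coord_vec M c x (axis (\<phi> j) 1)))"
      have "(\<Sum>i\<in>UNIV. T (\<epsilon> i) (\<epsilon> i)) = (\<Sum>k<n. \<Sum>i<n. \<Sum>j<n. a k i * a k j * t i j)"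
      proof -
        have "T (\<epsilon> (\<phi> k)) (\<epsilon> (\<phi> k)) = (\<Sum>i<n. \<Sum>j<n. a k i * a k j * t i j)" for k
          unfolding w tangent_bilinear_expansion[OF T c x, of "w (\<phi> k)" "w (\<phi> k)"] re by (simp
              add: a_def t_def)
        then show ?thesis unfolding re by simp
      qed
      also have "\<dots> = (\<Sum>i<n. \<Sum>k<n. \<Sum>j<n. a k i * a k j * t i j)" by (rule sum.swap)
      also have "\<dots> = (\<Sum>i<n. \<Sum>j<n. \<Sum>k<n. a k i * a k j * t i j)" by (intro sum.cong refl sum.swap)
      also have "\<dots> = (\<Sum>i<n. \<Sum>j<n. (\<Sum>k<n. a k i * a k j) * t i j)" by (simp add: sum_distrib_right)
      also have "\<dots> = (\<Sum>i<n. \<Sum>j<n. G i j x * t i j)" by (intro sum.cong refl) (simp add: ga)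
      also have "\<dots> = (\<Sum>i\<in>UNIV. \<Sum>j\<in>UNIV. G (\<psi> i) (\<psi> j) x *
          T (coord_vec M c x (axis i 1)) (coord_vec M c x (axis j 1)))"
        unfolding re by (intro sum.cong refl) (simp add: \<psi>\<phi> t_def)
      finally show ?thesis .
    qed
    show "\<exists>w. tangent_onb M x (\<lambda>i. coord_vec M c x (w i)) \<and> (\<forall>m. \<exists>b. axis m 1 = (\<Sum>k\<in>UNIV. b k *\<^sub>R w k))"
      if x: "x \<in> fst c" for x
    proof -
      obtain a where a: "gf.orthonormal x n a"
        and span: "\<And>m. m < n \<Longrightarrow> \<exists>b. \<forall>i. (if i = m then 1 else 0) = (\<Sum>l<n. b l * a l i)"
        using G(3)[OF x] by blast
      define w where "w = (\<lambda>i. V (a (\<psi> i)))"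
      have "tangent_onb M x (\<lambda>i. coord_vec M c x (w i))"
        unfolding tangent_onb_def
      proof (intro conjI allI)
        fix i j
        have "\<psi> i = \<psi> j \<longleftrightarrow> i = j" using \<psi>(1) by metis
        then show "rmetric M x (coord_vec M c x (w i)) (coord_vec M c x (w j)) = (if i = j then 1
            else 0)"
          using a \<psi>(2) unfolding w_def rm[OF x] gf.orthonormal_def gf.B_def by simp
      qed (rule coord_vec_tangent[OF c x])
      moreover have "\<exists>b. axis m 1 = (\<Sum>k\<in>UNIV. b k *\<^sub>R w k)" for m
      proof -
        obtain b where b: "\<And>i. (if i = \<psi> m then 1 else 0) = (\<Sum>l<n. b l * a l i)"
          using span[OF \<psi>(2)] by blast
        have "axis m 1 = (\<Sum>k\<in>UNIV. b (\<psi> k) *\<^sub>R w k)"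
        proof (unfold vec_eq_iff, intro allI)
          fix i
          have "\<psi> i = \<psi> m \<longleftrightarrow> i = m" using \<psi>(1) by metis
          then have "axis m 1 $ i = (if \<psi> i = \<psi> m then 1 else (0::real))" by (auto simp: axis_def)
          also have "\<dots> = (\<Sum>l<n. b l * a l (\<psi> i))" by (rule b)
          also have "\<dots> = (\<Sum>k\<in>UNIV. b (\<psi> k) *\<^sub>R w k) $ i"
            unfolding re by (auto simp: w_def V_def \<psi>\<phi> intro!: sum.cong)
          finally show "axis m 1 $ i = (\<Sum>k\<in>UNIV. b (\<psi> k) *\<^sub>R w k) $ i" .
        qed
        then show ?thesis by (intro exI[of _ "\<lambda>k. b (\<psi> k)"])
      qed
      ultimately show ?thesis by blast
    qed
  qed
qed

lemma ex_tangent_onb: "\<exists>\<epsilon>. tangent_onb M x \<epsilon>"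
  using tangent_inverse_gram[OF chart_at(1)] chart_at(2) by metis

end

context hermitian_bundle
begin

section \<open>The fibre metric and its inverse\<close>

lemma hmetric_frame_expansion:
  assumes e: "e \<in> frames F" "x \<in> fst e"
  shows "hmetric F x (\<Sum>i<frank F. fscale F (a i) (snd e i x)) (\<Sum>j<frank F. fscale F (b j) (snd e j x)) =
    (\<Sum>i<frank F. \<Sum>j<frank F. a i * cnj (b j) * hmetric F x (snd e i x) (snd e j x))"
proof -
  note m = frame_fibre[OF e]
  have "hmetric F x (\<Sum>i<frank F. fscale F (a i) (snd e i x)) (\<Sum>j<frank F. fscale F (b j) (snd e j x)) =
    (\<Sum>i<frank F. hmetric F x (fscale F (a i) (snd e i x)) (\<Sum>j<frank F. fscale F (b j) (snd e j x)))"
    by (rule hmetric_sum_left) (auto intro!: fibre_sum fibre_scale m)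
  also have "\<dots> = (\<Sum>i<frank F. \<Sum>j<frank F. hmetric F x (fscale F (a i) (snd e i x)) (fscale F (b j)
      (snd e j x)))"
    by (intro sum.cong refl hmetric_sum_right) (auto intro!: fibre_scale m)
  also have "\<dots> = (\<Sum>i<frank F. \<Sum>j<frank F. a i * cnj (b j) * hmetric F x (snd e i x) (snd e j x))"
    by (intro sum.cong refl) (simp add: hmetric_scale_left hmetric_scale_right fibre_scale m)
  finally show ?thesis .
qed

lemma hmetric_coord:
  assumes e: "e \<in> frames F" "x \<in> fst e" and z: "z \<in> fibre F x" "w \<in> fibre F x"
  shows "hmetric F x z w = (\<Sum>k<frank F. \<Sum>l<frank F.
    frame_coord F e x z k * cnj (frame_coord F e x w l) * hmetric F x (snd e k x) (snd e l x))"
  using hmetric_frame_expansion[OF e, of "frame_coord F e x z" "frame_coord F e x w"]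
  by (simp add: frame_expansion[OF e] z)

lemma continuous_on_hmetric_frame:
  "e \<in> frames F \<Longrightarrow> i < frank F \<Longrightarrow> j < frank F \<Longrightarrow>
   continuous_on (fst e) (\<lambda>x. hmetric F x (snd e i x) (snd e j x))"
  using hermitian_F unfolding hermitian_vector_bundle_def
  by (intro smooth_fun_continuous open_frame) auto

text \<open>Fibre version of \<open>tangent_inverse_gram\<close>. For antihermitian \<open>A\<close>
  and \<open>B\<close> the sum over \<open>k\<close> is minus the trace of their product, so it
  cannot depend on the orthonormal basis.\<close>

lemma fibre_inverse_gram:
  assumes e: "e \<in> frames F"
  obtains G where "\<And>i j. continuous_on (fst e) (G i j)"
    and "\<And>x f A B. x \<in> fst e \<Longrightarrow> fibre_onb F x f \<Longrightarrow> antihermitian F x A \<Longrightarrow> antihermitian F x B \<Longrightarrow>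
       (\<Sum>k<frank F. hmetric F x (A (f k)) (B (f k))) =
       (\<Sum>i<frank F. \<Sum>j<frank F. G i j x * hmetric F x (A (snd e i x)) (B (snd e j x)))"
    and "\<And>x. x \<in> fst e \<Longrightarrow> \<exists>f. fibre_onb F x f \<and>
       (\<forall>z\<in>fibre F x. \<exists>b. z = (\<Sum>k<frank F. fscale F (b k) (f k)))"
proof -
  let ?r = "frank F"
  define H where "H = (\<lambda>i j x. hmetric F x (snd e i x) (snd e j x))"
  define V where "V = (\<lambda>x a. \<Sum>i<?r. fscale F (a i) (snd e i x))"
  have V: "V x a \<in> fibre F x" if "x \<in> fst e" for x a
    unfolding V_def by (intro fibre_sum fibre_scale frame_fibre[OF e that]) auto
  have hm: "hmetric F x (V x a) (V x b) = (\<Sum>i<?r. \<Sum>j<?r. a i * cnj (b j) * H i j x)" if "x \<in> fst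
      e" for x a b
    unfolding V_def H_def by (rule hmetric_frame_expansion[OF e that])
  interpret conjugation cnj by (rule conjugation_complex)
  interpret gf: gram_family cnj "fst e" ?r H
  proof unfold_locales
    show "continuous_on (fst e) (H i j)" if "i < ?r" "j < ?r" for i j
      unfolding H_def by (rule continuous_on_hmetric_frame[OF e that])
    show "H i j x = cnj (H j i x)" if "x \<in> fst e" "i < ?r" "j < ?r" for i j x
      unfolding H_def by (intro hmetric_sym frame_fibre[OF e] that)
    show "\<exists>t>0. (\<Sum>i<?r. \<Sum>j<?r. a i * cnj (a j) * H i j x) = of_real t" if x: "x \<in> fst e" and a: "i
        < ?r" "a i \<noteq> 0" for x i a
    proof -
      have "frame_coord F e x (V x a) i = a i" unfolding V_def by (rule frame_coord_unique[OF e x a(1)])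
      then have "V x a \<noteq> 0" using a frame_coord_0[OF e x a(1)] by auto
      then have "Re (hmetric F x (V x a) (V x a)) > 0" by (rule hmetric_pos[OF V[OF x]])
      moreover have "hmetric F x (V x a) (V x a) = of_real (Re (hmetric F x (V x a) (V x a)))"
        using hmetric_sym[OF V[OF x, of a] V[OF x, of a]] by (simp add: complex_eq_iff)
      ultimately show ?thesis unfolding hm[OF x, symmetric] by metis
    qed
  qed
  obtain G where G: "\<And>i j. continuous_on (fst e) (G i j)"
    "\<And>y a i j. y \<in> fst e \<Longrightarrow> gf.orthonormal y ?r a \<Longrightarrow> i < ?r \<Longrightarrow> j < ?r \<Longrightarrow> (\<Sum>k<?r. a k i * cnj (a k j))
        = G i j y"
    "\<And>y. y \<in> fst e \<Longrightarrow> \<exists>a. gf.orthonormal y ?r a \<and>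
      (\<forall>m<?r. \<exists>b. \<forall>i. (if i = m then 1 else 0) = (\<Sum>l<?r. b l * a l i))"
    using gf.inverse_gram by blast
  show thesis
  proof (rule that[of G])
    show "continuous_on (fst e) (G i j)" for i j by (rule G(1))
    show "(\<Sum>k<?r. hmetric F x (A (f k)) (B (f k))) =
       (\<Sum>i<?r. \<Sum>j<?r. G i j x * hmetric F x (A (snd e i x)) (B (snd e j x)))"
      if x: "x \<in> fst e" and f: "fibre_onb F x f" and A: "antihermitian F x A" and B:
          "antihermitian F x B" for x f A B
    proof -
      define a where "a = (\<lambda>k. frame_coord F e x (f k))"
      have Va: "V x (a k) = f k" if "k < ?r" for k
        using f that frame_expansion[OF e x] by (simp add: V_def a_def fibre_onb_def)
      have "gf.orthonormal x ?r a"
        using f unfolding gf.orthonormal_def gf.B_def hm[OF x, symmetric]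
        by (simp add: Va fibre_onb_def)
      note ga = G(2)[OF x this]
      define t where "t = (\<lambda>i j. hmetric F x (A (snd e i x)) (B (snd e j x)))"
      note m = frame_fibre[OF e x] antihermitian_fibre[OF A frame_fibre[OF e x]]
          antihermitian_fibre[OF B frame_fibre[OF e x]]
      have ex: "C (f k) = (\<Sum>i<?r. fscale F (a k i) (C (snd e i x)))" if "k < ?r" "antihermitian F
          x C" for C k
        unfolding Va[OF that(1), symmetric] V_def
        by (subst antihermitian_sum[OF that(2)]) (auto intro!: fibre_scale m sum.cong
            antihermitian_scale[OF that(2)])
      have "hmetric F x (A (f k)) (B (f k)) = (\<Sum>i<?r. \<Sum>j<?r. a k i * cnj (a k j) * t i j)" if k:
          "k < ?r" for k
      proof -
        have "hmetric F x (A (f k)) (B (f k)) = (\<Sum>i<?r. hmetric F x (fscale F (a k i) (A (snd e i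
            x))) (B (f k)))"
          unfolding ex[OF k A]
          by (rule hmetric_sum_left) (use f k in \<open>auto intro!: fibre_scale m
              antihermitian_fibre[OF B] simp: fibre_onb_def\<close>)
        also have "\<dots> = (\<Sum>i<?r. \<Sum>j<?r. hmetric F x (fscale F (a k i) (A (snd e i x))) (fscale F (a
            k j) (B (snd e j x))))"
          unfolding ex[OF k B]
          by (intro sum.cong refl hmetric_sum_right) (auto intro!: fibre_scale m)
        also have "\<dots> = (\<Sum>i<?r. \<Sum>j<?r. a k i * cnj (a k j) * t i j)"
          by (intro sum.cong refl) (simp add: hmetric_scale_left hmetric_scale_right fibre_scale m t_def)
        finally show ?thesis .
      qed
      then have "(\<Sum>k<?r. hmetric F x (A (f k)) (B (f k))) = (\<Sum>k<?r. \<Sum>i<?r. \<Sum>j<?r. a k i * cnj (a k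
          j) * t i j)"
        by simp
      also have "\<dots> = (\<Sum>i<?r. \<Sum>k<?r. \<Sum>j<?r. a k i * cnj (a k j) * t i j)" by (rule sum.swap)
      also have "\<dots> = (\<Sum>i<?r. \<Sum>j<?r. \<Sum>k<?r. a k i * cnj (a k j) * t i j)" by (intro sum.cong refl
          sum.swap)
      also have "\<dots> = (\<Sum>i<?r. \<Sum>j<?r. (\<Sum>k<?r. a k i * cnj (a k j)) * t i j)" by (simp add:
          sum_distrib_right)
      also have "\<dots> = (\<Sum>i<?r. \<Sum>j<?r. G i j x * t i j)" by (intro sum.cong refl) (simp add: ga)
      finally show ?thesis by (simp add: t_def)
    qed
    show "\<exists>f. fibre_onb F x f \<and> (\<forall>z\<in>fibre F x. \<exists>b. z = (\<Sum>k<?r. fscale F (b k) (f k)))"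
      if x: "x \<in> fst e" for x
    proof -
      obtain a where a: "gf.orthonormal x ?r a"
        and "\<forall>m<?r. \<exists>b. \<forall>i. (if i = m then 1 else 0) = (\<Sum>l<?r. b l * a l i)"
        using G(3)[OF x] by blast
      then obtain b where b: "\<And>m i. m < ?r \<Longrightarrow> (if i = m then 1 else 0) = (\<Sum>l<?r. b m l * a l i)" by metis
      have "fibre_onb F x (\<lambda>k. V x (a k))"
        using a unfolding fibre_onb_def gf.orthonormal_def gf.B_def hm[OF x] by (simp add: V[OF x])
      moreover have "\<exists>b. z = (\<Sum>k<?r. fscale F (b k) (V x (a k)))" if z: "z \<in> fibre F x" for z
      proof -
        \<comment> \<open>\<open>b\<close> writes the frame vectors in the orthonormal basis;
          combining it with the frame coordinates of \<open>z\<close> gives the coefficients of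
          \<open>z\<close>.\<close>
        define p where "p = frame_coord F e x z"
        have "(\<Sum>k<?r. fscale F (\<Sum>m<?r. p m * b m k) (V x (a k))) =
          (\<Sum>k<?r. \<Sum>i<?r. fscale F ((\<Sum>m<?r. p m * b m k) * a k i) (snd e i x))"
          by (simp add: V_def fs.scale_sum_right)
        also have "\<dots> = (\<Sum>k<?r. \<Sum>i<?r. \<Sum>m<?r. fscale F (p m * b m k * a k i) (snd e i x))"
          by (simp add: fs.scale_sum_left sum_distrib_right)
        also have "\<dots> = (\<Sum>i<?r. \<Sum>k<?r. \<Sum>m<?r. fscale F (p m * b m k * a k i) (snd e i x))"
          by (rule sum.swap)
        also have "\<dots> = (\<Sum>i<?r. \<Sum>m<?r. \<Sum>k<?r. fscale F (p m * b m k * a k i) (snd e i x))"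
          by (intro sum.cong refl sum.swap)
        also have "\<dots> = (\<Sum>i<?r. \<Sum>m<?r. fscale F (p m * (\<Sum>k<?r. b m k * a k i)) (snd e i x))"
          by (simp add: fs.scale_sum_left sum_distrib_left mult.assoc)
        also have "\<dots> = (\<Sum>i<?r. \<Sum>m<?r. if m = i then fscale F (p m) (snd e i x) else 0)"
          by (intro sum.cong refl) (simp add: b[symmetric])
        also have "\<dots> = (\<Sum>i<?r. fscale F (p i) (snd e i x))" by simp
        also have "\<dots> = z" unfolding p_def by (rule frame_expansion[OF e x z])
        finally show ?thesis by metis
      qed
      ultimately show ?thesis by blast
    qed
  qed
qed

end

section \<open>Inner product of forms\<close>

lemma uniform_limit_sum_family:
  fixes f :: "'i \<Rightarrow> 't \<Rightarrow> 'x \<Rightarrow> 'b::real_normed_vector"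
  shows "(\<And>i. i \<in> I \<Longrightarrow> uniform_limit S (f i) (l i) T) \<Longrightarrow>
   uniform_limit S (\<lambda>t x. \<Sum>i\<in>I. f i t x) (\<lambda>x. \<Sum>i\<in>I. l i x) T"
  by (induction I rule: infinite_finite_induct) (auto intro: uniform_limit_const uniform_limit_add)

context hermitian_bundle
begin

section \<open>Inner product of endomorphisms of a fibre\<close>

lemma ex_spanning_fibre_onb:
  "\<exists>f. fibre_onb F x f \<and> (\<forall>z\<in>fibre F x. \<exists>b. z = (\<Sum>k<frank F. fscale F (b k) (f k)))"
proof -
  obtain e where e: "e \<in> frames F" "x \<in> fst e" using ex_frame by blast
  show ?thesis by (rule fibre_inverse_gram[OF e(1)]) (use e(2) in blast)
qed

lemma fibre_onb_some: "fibre_onb F x (SOME e. fibre_onb F x e)"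
  using ex_spanning_fibre_onb by (metis someI_ex)

lemma fibre_onb_fibre: "fibre_onb F x f \<Longrightarrow> i < frank F \<Longrightarrow> f i \<in> fibre F x"
  by (simp add: fibre_onb_def)

lemma ex_spanning_tangent_onb:
  assumes "c \<in> atlas M" "x \<in> fst c"
  shows "\<exists>w. tangent_onb M x (\<lambda>i. coord_vec M c x (w i)) \<and> (\<forall>m. \<exists>b. axis m 1 = (\<Sum>k\<in>UNIV. b k *\<^sub>R w k))"
  by (rule tangent_inverse_gram[OF assms(1)]) (use assms(2) in blast)

lemma tangent_onb_some: "tangent_onb M x (SOME e. tangent_onb M x e)"
  by (rule someI_ex[OF ex_tangent_onb])

lemma tangent_onb_tangent: "tangent_onb M x \<epsilon> \<Longrightarrow> \<epsilon> i \<in> tangent_space M x"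
  by (simp add: tangent_onb_def)

text \<open>Every orthonormal basis gives the same contraction with the inverse Gram matrix of a
  frame.\<close>

lemma end_inner_onb:
  assumes f: "fibre_onb F x f" and A: "antihermitian F x A" and B: "antihermitian F x B"
  shows "end_inner F x A B = (\<Sum>k<frank F. Re (hmetric F x (A (f k)) (B (f k))))"
proof -
  obtain e where e: "e \<in> frames F" "x \<in> fst e" using ex_frame by blast
  note s = fibre_onb_some[of x]
  obtain G where G: "\<And>x f A B. x \<in> fst e \<Longrightarrow> fibre_onb F x f \<Longrightarrow> antihermitian F x A \<Longrightarrow> antihermitian F x B \<Longrightarrow>
       (\<Sum>k<frank F. hmetric F x (A (f k)) (B (f k))) =
       (\<Sum>i<frank F. \<Sum>j<frank F. G i j x * hmetric F x (A (snd e i x)) (B (snd e j x)))"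
    by (rule fibre_inverse_gram[OF e(1)]) blast
  show ?thesis
    unfolding end_inner_def Let_def Re_sum[symmetric] G[OF e(2) s A B] G[OF e(2) f A B] ..
qed

lemma end_inner_nonneg:
  assumes "antihermitian F x A"
  shows "end_inner F x A A \<ge> 0"
proof -
  have "Re (hmetric F x z z) \<ge> 0" if "z \<in> fibre F x" for z
    using hmetric_pos[OF that] hmetric_zero(1)[OF fibre_0, of x] by (cases "z = 0") auto
  then show ?thesis
    unfolding end_inner_def Let_def
    by (intro sum_nonneg) (simp add: antihermitian_fibre[OF assms] fibre_onb_fibre[OF fibre_onb_some])
qed

text \<open>All summands are nonnegative, so \<open>A\<close> kills an orthonormal basis, and this
  basis spans the fibre.\<close>

lemma end_inner_eq_0:
  assumes A: "antihermitian F x A" and 0: "end_inner F x A A = 0" and z: "z \<in> fibre F x"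
  shows "A z = 0"
proof -
  obtain f where f: "fibre_onb F x f" and span: "\<And>z. z \<in> fibre F x \<Longrightarrow> \<exists>b. z = (\<Sum>k<frank F. fscale F
      (b k) (f k))"
    using ex_spanning_fibre_onb by blast
  have fm: "f k \<in> fibre F x" if "k < frank F" for k using f that by (simp add: fibre_onb_def)
  note m = antihermitian_fibre[OF A fm]
  have nn: "Re (hmetric F x z z) \<ge> 0" if "z \<in> fibre F x" for z
    using hmetric_pos[OF that] hmetric_zero(1)[OF fibre_0, of x] by (cases "z = 0") auto
  have "\<forall>k\<in>{..<frank F}. Re (hmetric F x (A (f k)) (A (f k))) = 0"
    using 0 unfolding end_inner_onb[OF f A A] by (subst (asm) sum_nonneg_eq_0_iff) (auto intro: nn m)
  then have Af: "A (f k) = 0" if "k < frank F" for k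
    using hmetric_pos[OF m[OF that]] that by (metis lessThan_iff less_irrefl)
  obtain b where "z = (\<Sum>k<frank F. fscale F (b k) (f k))" using span[OF z] by blast
  then have "A z = (\<Sum>k<frank F. A (fscale F (b k) (f k)))"
    by (simp only:) (rule antihermitian_sum[OF A], auto intro: fibre_scale fm)
  also have "\<dots> = 0" by (rule sum.neutral) (auto simp: antihermitian_scale[OF A fm] Af)
  finally show ?thesis .
qed

lemma end_inner_cong:
  assumes "\<And>z. z \<in> fibre F x \<Longrightarrow> A z = A' z" "\<And>z. z \<in> fibre F x \<Longrightarrow> B z = B' z"
  shows "end_inner F x A B = end_inner F x A' B'"
  unfolding end_inner_def Let_def
  by (intro sum.cong refl) (simp add: assms fibre_onb_fibre[OF fibre_onb_some])

lemma end_inner_lincomb_left: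
  assumes A: "antihermitian F x A" and A': "antihermitian F x A'" and B: "antihermitian F x B"
  shows "end_inner F x (\<lambda>z. fscale F (of_real a) (A z) + fscale F (of_real b) (A' z)) B =
    a * end_inner F x A B + b * end_inner F x A' B"
  unfolding end_inner_def Let_def sum_distrib_left sum.distrib[symmetric]
  by (intro sum.cong refl)
     (simp add: fibre_onb_fibre[OF fibre_onb_some] hmetric_add_left hmetric_scale_left fibre_scale
         antihermitian_fibre[OF A]
       antihermitian_fibre[OF A'] antihermitian_fibre[OF B])

lemma end_inner_commute:
  assumes A: "antihermitian F x A" and B: "antihermitian F x B"
  shows "end_inner F x A B = end_inner F x B A"
  unfolding end_inner_def Let_def
  by (intro sum.cong refl, subst hmetric_sym)
     (simp_all add: fibre_onb_fibre[OF fibre_onb_some] antihermitian_fibre[OF A]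
         antihermitian_fibre[OF B])

lemma antihermitian_lincomb:
  assumes "antihermitian F x A" "antihermitian F x A'"
  shows "antihermitian F x (\<lambda>z. fscale F (of_real a) (A z) + fscale F (of_real b) (A' z))"
  by (rule antihermitian_plus[OF antihermitian_scale_real[OF assms(1)] antihermitian_scale_real[OF
      assms(2)]])

lemma end_inner_lincomb_right:
  assumes A: "antihermitian F x A" and A': "antihermitian F x A'" and B: "antihermitian F x B"
  shows "end_inner F x B (\<lambda>z. fscale F (of_real a) (A z) + fscale F (of_real b) (A' z)) =
    a * end_inner F x B A + b * end_inner F x B A'"
  unfolding end_inner_commute[OF B antihermitian_lincomb[OF A A']] end_inner_lincomb_left[OF A A' B]
    end_inner_commute[OF B A] end_inner_commute[OF B A'] ..

section \<open>Pointwise inner product of 2-forms\<close>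

lemma uform_2_tcomb:
  assumes "uform M F 2 \<omega>" "u \<in> tangent_space M x" "u' \<in> tangent_space M x" "v \<in> tangent_space M x"
      "z \<in> fibre F x"
  shows "\<omega> x [tcomb a u b u', v] z = fscale F (of_real a) (\<omega> x [u, v] z) + fscale F (of_real b) (\<omega>
      x [u', v] z)"
    and "\<omega> x [v, tcomb a u b u'] z = fscale F (of_real a) (\<omega> x [v, u] z) + fscale F (of_real b) (\<omega>
        x [v, u'] z)"
  using uform_tcomb[OF assms(1), of "[u, v]" x z 0 u u' a b] uform_tcomb[OF assms(1), of "[v, u]"
      x z 1 u u' a b] assms
  by simp_all

lemma tangent_bilinear_end_inner:
  assumes \<omega>: "uform M F 2 \<omega>" and \<eta>: "uform M F 2 \<eta>" and v: "v \<in> tangent_space M x" "v' \<in>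
      tangent_space M x"
  shows "tangent_bilinear x (\<lambda>u u'. end_inner F x (\<omega> x [u, v]) (\<eta> x [u', v']))"
    and "tangent_bilinear x (\<lambda>u u'. end_inner F x (\<omega> x [v, u]) (\<eta> x [v', u']))"
proof -
  note ah = uform_2_antihermitian[OF \<omega>] uform_2_antihermitian[OF \<eta>]
  have 1: "end_inner F x (\<omega> x [tcomb a u b u', v]) B = a * end_inner F x (\<omega> x [u, v]) B + b *
      end_inner F x (\<omega> x [u', v]) B"
    "end_inner F x (\<omega> x [v, tcomb a u b u']) B = a * end_inner F x (\<omega> x [v, u]) B + b * end_inner
        F x (\<omega> x [v, u']) B"
    if \<omega>: "uform M F 2 \<omega>" and "u \<in> tangent_space M x" "u' \<in> tangent_space M x" "v \<in> tangent_space
        M x" "antihermitian F x B"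
    for \<omega> u u' v a b B
    using that
    by (auto simp: end_inner_lincomb_left[symmetric] uform_2_antihermitian intro!: end_inner_cong
        uform_2_tcomb)
  have 2: "end_inner F x B (\<omega> x [tcomb a u b u', v]) = a * end_inner F x B (\<omega> x [u, v]) + b *
      end_inner F x B (\<omega> x [u', v])"
    "end_inner F x B (\<omega> x [v, tcomb a u b u']) = a * end_inner F x B (\<omega> x [v, u]) + b * end_inner
        F x B (\<omega> x [v, u'])"
    if \<omega>: "uform M F 2 \<omega>" and "u \<in> tangent_space M x" "u' \<in> tangent_space M x" "v \<in> tangent_space
        M x" "antihermitian F x B"
    for \<omega> u u' v a b B
    using that
    by (auto simp: end_inner_lincomb_right[symmetric] uform_2_antihermitian intro!: end_inner_cong
        uform_2_tcomb)
  show "tangent_bilinear x (\<lambda>u u'. end_inner F x (\<omega> x [u, v]) (\<eta> x [u', v']))"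
    "tangent_bilinear x (\<lambda>u u'. end_inner F x (\<omega> x [v, u]) (\<eta> x [v', u']))"
    unfolding tangent_bilinear_def using v by (auto simp: 1[OF \<omega>] 2[OF \<eta>] ah)
qed

lemma form_inner_at_some:
  "form_inner_at M F 2 \<omega> \<eta> x = (\<Sum>i\<in>UNIV. \<Sum>j\<in>UNIV.
     end_inner F x (\<omega> x [(SOME e. tangent_onb M x e) i, (SOME e. tangent_onb M x e) j])
       (\<eta> x [(SOME e. tangent_onb M x e) i, (SOME e. tangent_onb M x e) j])) / 2"
proof -
  have "(\<Sum>I | length I = 2. h I) = (\<Sum>(i, j)\<in>UNIV \<times> UNIV. h [i, j])" for h :: "'n list \<Rightarrow> real"
    by (rule sum.reindex_bij_witness[of _ "\<lambda>(i, j). [i, j]" "\<lambda>I. (I ! 0, I ! 1)"])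
       (auto simp: numeral_2_eq_2 length_Suc_conv)
  then show ?thesis by (simp add: form_inner_at_def Let_def sum.cartesian_product fact_numeral)
qed

text \<open>The double trace is contracted one slot at a time: with the vectors in the other slot
  fixed, the inner product is bilinear in the remaining pair. \<open>g\<close> is the inverse
  metric.\<close>

lemma sum_end_inner_onb:
  fixes g :: "'n \<Rightarrow> 'n \<Rightarrow> 'm \<Rightarrow> real"
  assumes \<omega>: "uform M F 2 \<omega>" and \<eta>: "uform M F 2 \<eta>" and \<epsilon>: "tangent_onb M x \<epsilon>" and c: "c \<in> atlas
      M" "x \<in> fst c"
    and g: "\<And>T. tangent_bilinear x T \<Longrightarrow> (\<Sum>i\<in>UNIV. T (\<epsilon> i) (\<epsilon> i)) =
       (\<Sum>i\<in>UNIV. \<Sum>j\<in>UNIV. g i j x * T (coord_vec M c x (axis i 1)) (coord_vec M c x (axis j 1)))"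
  shows "(\<Sum>i\<in>UNIV. \<Sum>j\<in>UNIV. end_inner F x (\<omega> x [\<epsilon> i, \<epsilon> j]) (\<eta> x [\<epsilon> i, \<epsilon> j])) =
    (\<Sum>p\<in>UNIV. \<Sum>q\<in>UNIV. g p q x * (\<Sum>s\<in>UNIV. \<Sum>t\<in>UNIV. g s t x *
       end_inner F x (\<omega> x [coord_vec M c x (axis s 1), coord_vec M c x (axis p 1)])
         (\<eta> x [coord_vec M c x (axis t 1), coord_vec M c x (axis q 1)])))"
proof -
  note Tc = coord_vec_tangent[OF c]
  note T\<epsilon> = tangent_onb_tangent[OF \<epsilon>]
  let ?h = "\<lambda>u v u' v'. end_inner F x (\<omega> x [u, v]) (\<eta> x [u', v'])"
  let ?d = "\<lambda>i. coord_vec M c x (axis i 1)"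
  have "(\<Sum>i\<in>UNIV. \<Sum>j\<in>UNIV. ?h (\<epsilon> i) (\<epsilon> j) (\<epsilon> i) (\<epsilon> j)) =
     (\<Sum>i\<in>UNIV. \<Sum>p\<in>UNIV. \<Sum>q\<in>UNIV. g p q x * ?h (\<epsilon> i) (?d p) (\<epsilon> i) (?d q))"
    by (intro sum.cong refl g tangent_bilinear_end_inner \<omega> \<eta> T\<epsilon>)
  also have "\<dots> = (\<Sum>p\<in>UNIV. \<Sum>i\<in>UNIV. \<Sum>q\<in>UNIV. g p q x * ?h (\<epsilon> i) (?d p) (\<epsilon> i) (?d q))"
    by (rule sum.swap)
  also have "\<dots> = (\<Sum>p\<in>UNIV. \<Sum>q\<in>UNIV. \<Sum>i\<in>UNIV. g p q x * ?h (\<epsilon> i) (?d p) (\<epsilon> i) (?d q))"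
    by (intro sum.cong refl sum.swap)
  also have "\<dots> = (\<Sum>p\<in>UNIV. \<Sum>q\<in>UNIV. g p q x * (\<Sum>i\<in>UNIV. ?h (\<epsilon> i) (?d p) (\<epsilon> i) (?d q)))"
    by (simp add: sum_distrib_left)
  also have "\<dots> = (\<Sum>p\<in>UNIV. \<Sum>q\<in>UNIV. g p q x * (\<Sum>s\<in>UNIV. \<Sum>t\<in>UNIV. g s t x * ?h (?d s) (?d p) (?d t)
      (?d q)))"
    by (intro sum.cong refl arg_cong2[of _ _ _ _ "(*)"] g tangent_bilinear_end_inner \<omega> \<eta> Tc)
  finally show ?thesis .
qed

lemma form_inner_at_onb:
  assumes \<epsilon>: "tangent_onb M x \<epsilon>" and \<omega>: "uform M F 2 \<omega>" and \<eta>: "uform M F 2 \<eta>"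
  shows "form_inner_at M F 2 \<omega> \<eta> x = (\<Sum>i\<in>UNIV. \<Sum>j\<in>UNIV. end_inner F x (\<omega> x [\<epsilon> i, \<epsilon> j]) (\<eta> x [\<epsilon> i,
      \<epsilon> j])) / 2"
proof -
  note c = chart_at[of x]
  obtain g where g: "\<And>y \<epsilon> T. y \<in> fst (chart_at M x) \<Longrightarrow> tangent_onb M y \<epsilon> \<Longrightarrow> tangent_bilinear y T \<Longrightarrow>
       (\<Sum>i\<in>UNIV. T (\<epsilon> i) (\<epsilon> i)) =
       (\<Sum>i\<in>UNIV. \<Sum>j\<in>UNIV. g i j y * T (coord_vec M (chart_at M x) y (axis i 1)) (coord_vec M
           (chart_at M x) y (axis j 1)))"
    by (rule tangent_inverse_gram[OF c(1)]) blast
  show ?thesis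
    unfolding form_inner_at_some
    by (rule arg_cong[where f = "\<lambda>t. t / 2", OF trans[OF
          sum_end_inner_onb[where g = g, OF \<omega> \<eta> tangent_onb_some c g[OF c(2) tangent_onb_some]]
          sum_end_inner_onb[where g = g, OF \<omega> \<eta> \<epsilon> c g[OF c(2) \<epsilon>], symmetric]]])
qed

lemma form_inner_at_nonneg:
  assumes "uform M F 2 \<omega>"
  shows "form_inner_at M F 2 \<omega> \<omega> x \<ge> 0"
  using tangent_onb_tangent[OF tangent_onb_some] unfolding form_inner_at_some
  by (intro divide_nonneg_nonneg sum_nonneg end_inner_nonneg uform_2_antihermitian[OF assms]) auto

text \<open>Positivity forces the value on each pair of orthonormal basis vectors to vanish. Since
  these span, bilinearity spreads this to all pairs, one argument after the other.\<close>

lemma form_inner_at_eq_0: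
  assumes \<omega>: "uform M F 2 \<omega>" and 0: "form_inner_at M F 2 \<omega> \<omega> x = 0"
    and T: "u \<in> tangent_space M x" "v \<in> tangent_space M x" and z: "z \<in> fibre F x"
  shows "\<omega> x [u, v] z = 0"
proof -
  note c = chart_at[of x]
  let ?X = "coord_vec M (chart_at M x) x"
  obtain w where w: "tangent_onb M x (\<lambda>i. ?X (w i))"
    and span: "\<And>m. \<exists>b. axis m 1 = (\<Sum>k\<in>UNIV. b k *\<^sub>R w k)"
    using ex_spanning_tangent_onb[OF c] by blast
  note ah = uform_2_antihermitian[OF \<omega> coord_vec_tangent[OF c] coord_vec_tangent[OF c]]
  have "(\<Sum>i\<in>UNIV. \<Sum>j\<in>UNIV. end_inner F x (\<omega> x [?X (w i), ?X (w j)]) (\<omega> x [?X (w i), ?X (w j)])) = 0"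
    using 0 unfolding form_inner_at_onb[OF w \<omega> \<omega>] by simp
  then have "end_inner F x (\<omega> x [?X (w i), ?X (w j)]) (\<omega> x [?X (w i), ?X (w j)]) = 0" for i j
    by (simp add: sum_nonneg_eq_0_iff sum_nonneg end_inner_nonneg[OF ah])
  then have ww: "\<omega> x [?X (w i), ?X (w j)] z = 0" for i j
    by (rule end_inner_eq_0[OF ah _ z])
  have comb: "f (\<Sum>k\<in>K. b k *\<^sub>R w k) = 0"
    if lin: "\<And>a b w w'. f (a *\<^sub>R w + b *\<^sub>R w') = fscale F (of_real a) (f w) + fscale F (of_real b)
        (f w')"
      and "\<And>k. f (w k) = 0" for f :: "real ^ 'n \<Rightarrow> 'v" and b and K :: "'n set"
  proof (induction K rule: infinite_finite_induct)
    case (insert k K)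
    then show ?case using lin[of "b k" "w k" 1 "\<Sum>k\<in>K. b k *\<^sub>R w k"] that(2) by simp
  qed (use lin[of 0 0 0 0] in auto)
  have all: "f w' = 0"
    if lin: "\<And>a b w w'. f (a *\<^sub>R w + b *\<^sub>R w') = fscale F (of_real a) (f w) + fscale F (of_real b)
        (f w')"
      and 0: "\<And>k. f (w k) = 0" for f :: "real ^ 'n \<Rightarrow> 'v" and w'
  proof -
    have "f (axis m 1) = 0" for m
    proof -
      obtain b where b: "axis m 1 = (\<Sum>k\<in>UNIV. b k *\<^sub>R w k)" using span by blast
      show ?thesis unfolding b by (rule comb[OF lin 0])
    qed
    then show ?thesis by (subst linear_map_expansion[of f, OF lin]) simp
  qed
  obtain a b where ab: "u = ?X a" "v = ?X b" using T tangent_space_chart[OF c] by blast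
  note tc = coord_vec_tcomb[OF c] uform_2_tcomb[OF \<omega> coord_vec_tangent[OF c] coord_vec_tangent[OF
      c] coord_vec_tangent[OF c] z]
  have wb: "\<omega> x [?X (w i), ?X b] z = 0" for i
    by (rule all[of "\<lambda>b. \<omega> x [?X (w i), ?X b] z"]) (simp_all add: tc ww)
  have "\<omega> x [?X a, ?X b] z = 0"
    by (rule all[of "\<lambda>a. \<omega> x [?X a, ?X b] z"]) (simp_all add: tc wb)
  then show ?thesis by (simp add: ab)
qed

text \<open>\<open>K\<close> is compared with the two forms only through its values at
  \<open>x\<close>, so that the curvature of a perturbed connection can be inserted as it
  stands.\<close>

lemma form_inner_at_lincomb:
  assumes \<omega>: "uform M F 2 \<omega>" and \<eta>: "uform M F 2 \<eta>"
    and K: "\<And>u v z. u \<in> tangent_space M x \<Longrightarrow> v \<in> tangent_space M x \<Longrightarrow> z \<in> fibre F x \<Longrightarrow>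
      K x [u, v] z = fscale F (of_real a) (\<omega> x [u, v] z) + fscale F (of_real b) (\<eta> x [u, v] z)"
  shows "form_inner_at M F 2 K K x = a\<^sup>2 * form_inner_at M F 2 \<omega> \<omega> x +
    2 * a * b * form_inner_at M F 2 \<omega> \<eta> x + b\<^sup>2 * form_inner_at M F 2 \<eta> \<eta> x"
proof -
  have "end_inner F x (K x [u, v]) (K x [u, v]) = a\<^sup>2 * end_inner F x (\<omega> x [u, v]) (\<omega> x [u, v]) +
     2 * a * b * end_inner F x (\<omega> x [u, v]) (\<eta> x [u, v]) + b\<^sup>2 * end_inner F x (\<eta> x [u, v]) (\<eta> x [u, v])"
    if T: "u \<in> tangent_space M x" "v \<in> tangent_space M x" for u v
  proof -
    note ah = uform_2_antihermitian[OF \<omega> T] uform_2_antihermitian[OF \<eta> T]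
    let ?K = "\<lambda>z. fscale F (of_real a) (\<omega> x [u, v] z) + fscale F (of_real b) (\<eta> x [u, v] z)"
    have "end_inner F x (K x [u, v]) (K x [u, v]) = end_inner F x ?K ?K"
      by (rule end_inner_cong) (use K T in auto)
    also have "\<dots> = a * end_inner F x (\<omega> x [u, v]) ?K + b * end_inner F x (\<eta> x [u, v]) ?K"
      by (rule end_inner_lincomb_left[OF ah antihermitian_lincomb[OF ah]])
    also have "end_inner F x (\<omega> x [u, v]) ?K = a * end_inner F x (\<omega> x [u, v]) (\<omega> x [u, v]) + b *
        end_inner F x (\<omega> x [u, v]) (\<eta> x [u, v])"
      by (rule end_inner_lincomb_right[OF ah ah(1)])
    also have "end_inner F x (\<eta> x [u, v]) ?K = a * end_inner F x (\<omega> x [u, v]) (\<eta> x [u, v]) + b *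
        end_inner F x (\<eta> x [u, v]) (\<eta> x [u, v])"
      by (subst end_inner_commute[OF ah]) (rule end_inner_lincomb_right[OF ah ah(2)])
    finally show ?thesis by (simp add: algebra_simps power2_eq_square)
  qed
  note K2 = this
  show ?thesis
    unfolding form_inner_at_some
    by (simp add: K2[OF tangent_onb_tangent[OF tangent_onb_some] tangent_onb_tangent[OF
        tangent_onb_some]] sum.distrib sum_distrib_left add_divide_distrib)
qed

section \<open>Local formula, continuity and limits of the pointwise inner product\<close>

definition form_entry ::
  "('m, 'n) chart \<Rightarrow> ('m, 'v) frame \<Rightarrow> ('m, 'v) eform \<Rightarrow> 'n \<times> 'n \<times> nat \<times> nat \<Rightarrow> 'm \<Rightarrow> complex" where
  "form_entry c e \<omega> = (\<lambda>(s, p, i, k) x. frame_coord F e x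
     (\<omega> x [coord_vec M c x (axis s 1), coord_vec M c x (axis p 1)] (snd e i x)) k)"

text \<open>In a chart and a frame the inner product is the real part of a sesquilinear form in the
  entries. The kernel \<open>K\<close> consists of two inverse metrics (one per slot), the inverse
  Gram matrix and the Gram matrix of the frame, and the factor 1/2 of \<open>form_inner_at\<close>.
  All are continuous, so continuity and limits reduce to those of the entries.\<close>

lemma form_inner_at_local:
  assumes c: "c \<in> atlas M" and e: "e \<in> frames F"
  defines "S \<equiv> UNIV \<times> UNIV \<times> {..<frank F} \<times> {..<frank F}"
  obtains K where
    "\<And>\<alpha> \<beta>. \<alpha> \<in> S \<Longrightarrow> \<beta> \<in> S \<Longrightarrow> continuous_on (fst c \<inter> fst e) (K \<alpha> \<beta>)"
    "\<And>x \<omega> \<eta>. x \<in> fst c \<inter> fst e \<Longrightarrow> uform M F 2 \<omega> \<Longrightarrow> uform M F 2 \<eta> \<Longrightarrow>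
      form_inner_at M F 2 \<omega> \<eta> x = (\<Sum>\<alpha>\<in>S. \<Sum>\<beta>\<in>S. Re (K \<alpha> \<beta> x * form_entry c e \<omega> \<alpha> x * cnj
          (form_entry c e \<eta> \<beta> x)))"
proof -
  obtain g where g: "\<And>i j. continuous_on (fst c) (g i j)"
    "\<And>x \<epsilon> T. x \<in> fst c \<Longrightarrow> tangent_onb M x \<epsilon> \<Longrightarrow> tangent_bilinear x T \<Longrightarrow>
       (\<Sum>i\<in>UNIV. T (\<epsilon> i) (\<epsilon> i)) =
       (\<Sum>i\<in>UNIV. \<Sum>j\<in>UNIV. g i j x * T (coord_vec M c x (axis i 1)) (coord_vec M c x (axis j 1)))"
    by (rule tangent_inverse_gram[OF c]) blast
  obtain G where G: "\<And>i j. continuous_on (fst e) (G i j)"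
    "\<And>x f A B. x \<in> fst e \<Longrightarrow> fibre_onb F x f \<Longrightarrow> antihermitian F x A \<Longrightarrow> antihermitian F x B \<Longrightarrow>
       (\<Sum>k<frank F. hmetric F x (A (f k)) (B (f k))) =
       (\<Sum>i<frank F. \<Sum>j<frank F. G i j x * hmetric F x (A (snd e i x)) (B (snd e j x)))"
    by (rule fibre_inverse_gram[OF e]) blast
  define K where "K = (\<lambda>(s, p, i, k) (t, q, j, l) x.
     of_real (g p q x * g s t x / 2) * G i j x * hmetric F x (snd e k x) (snd e l x))"
  show thesis
  proof (rule that[of K])
    fix \<alpha> \<beta> assume "\<alpha> \<in> S" "\<beta> \<in> S"
    then obtain s p i k t q j l where ab: "\<alpha> = (s, p, i, k)" "\<beta> = (t, q, j, l)" and kl: "k < frank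
        F" "l < frank F"
      unfolding S_def by auto
    show "continuous_on (fst c \<inter> fst e) (K \<alpha> \<beta>)"
      unfolding ab K_def prod.case
      by (intro continuous_intros continuous_on_subset[OF g(1)] continuous_on_subset[OF G(1)]
          continuous_on_subset[OF continuous_on_hmetric_frame[OF e kl]]) auto
  next
    fix x \<omega> \<eta> assume x: "x \<in> fst c \<inter> fst e" and \<omega>: "uform M F 2 \<omega>" and \<eta>: "uform M F 2 \<eta>"
    let ?r = "frank F"
    let ?d = "\<lambda>i. coord_vec M c x (axis i 1)"
    let ?H = "\<lambda>k l. hmetric F x (snd e k x) (snd e l x)"
    have xc: "x \<in> fst c" and xe: "x \<in> fst e" using x by auto
    have ah: "antihermitian F x (\<theta> x [?d s, ?d p])" if "uform M F 2 \<theta>" for \<theta> s p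
      by (rule uform_2_antihermitian[OF that coord_vec_tangent[OF c xc] coord_vec_tangent[OF c xc]])
    obtain \<epsilon> where \<epsilon>: "tangent_onb M x \<epsilon>" using ex_tangent_onb by blast
    obtain f where f: "fibre_onb F x f" using fibre_onb_some by blast
    have ei: "end_inner F x (\<omega> x [?d s, ?d p]) (\<eta> x [?d t, ?d q]) =
      (\<Sum>i<?r. \<Sum>j<?r. \<Sum>k<?r. \<Sum>l<?r.
         Re (G i j x * (form_entry c e \<omega> (s, p, i, k) x * cnj (form_entry c e \<eta> (t, q, j, l) x) *
             ?H k l)))"
      for s p t q
    proof -
      have "end_inner F x (\<omega> x [?d s, ?d p]) (\<eta> x [?d t, ?d q]) =
        (\<Sum>i<?r. \<Sum>j<?r. Re (G i j x * hmetric F x (\<omega> x [?d s, ?d p] (snd e i x)) (\<eta> x [?d t, ?d q]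
            (snd e j x))))"
        unfolding end_inner_onb[OF f ah[OF \<omega>] ah[OF \<eta>]] Re_sum[symmetric] G(2)[OF xe f ah[OF \<omega>]
            ah[OF \<eta>]] ..
      also have "\<dots> = (\<Sum>i<?r. \<Sum>j<?r. Re (G i j x * (\<Sum>k<?r. \<Sum>l<?r.
          form_entry c e \<omega> (s, p, i, k) x * cnj (form_entry c e \<eta> (t, q, j, l) x) * ?H k l)))"
      proof (intro sum.cong refl arg_cong[of _ _ Re] arg_cong2[of _ _ _ _ "(*)"])
        fix i j assume ij: "i \<in> {..<?r}" "j \<in> {..<?r}"
        then have fr: "snd e i x \<in> fibre F x" "snd e j x \<in> fibre F x"
          using frame_fibre[OF e xe] by auto
        note m = antihermitian_fibre[OF ah[OF \<omega>, of s p] fr(1)] antihermitian_fibre[OF ah[OF \<eta>, of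
            t q] fr(2)]
        show "hmetric F x (\<omega> x [?d s, ?d p] (snd e i x)) (\<eta> x [?d t, ?d q] (snd e j x)) =
          (\<Sum>k<?r. \<Sum>l<?r. form_entry c e \<omega> (s, p, i, k) x * cnj (form_entry c e \<eta> (t, q, j, l) x) *
              ?H k l)"
          unfolding hmetric_coord[OF e xe m] form_entry_def by simp
      qed
      finally show ?thesis by (simp only: sum_distrib_left Re_sum)
    qed
    define Z where "Z = (\<lambda>p q s t i j k l. Re (K (s, p, i, k) (t, q, j, l) x *
       form_entry c e \<omega> (s, p, i, k) x * cnj (form_entry c e \<eta> (t, q, j, l) x)))"
    have "form_inner_at M F 2 \<omega> \<eta> x =
      (\<Sum>p\<in>UNIV. \<Sum>q\<in>UNIV. g p q x * (\<Sum>s\<in>UNIV. \<Sum>t\<in>UNIV. g s t x *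
         end_inner F x (\<omega> x [?d s, ?d p]) (\<eta> x [?d t, ?d q]))) / 2"
      unfolding form_inner_at_onb[OF \<epsilon> \<omega> \<eta>]
      using sum_end_inner_onb[where g = g, OF \<omega> \<eta> \<epsilon> c xc g(2)[OF xc \<epsilon>]] by simp
    also have "\<dots> = (\<Sum>p\<in>UNIV. \<Sum>q\<in>UNIV. \<Sum>s\<in>UNIV. \<Sum>t\<in>UNIV. \<Sum>i<?r. \<Sum>j<?r. \<Sum>k<?r. \<Sum>l<?r. Z p q s t i j k l)"
    proof -
      have "g p q x * (g s t x * Re (G i j x * (form_entry c e \<omega> (s, p, i, k) x * cnj (form_entry
          c e \<eta> (t, q, j, l) x) * ?H k l))) / 2
        = Z p q s t i j k l" for p q s t i j k l
      proof -
        have "Z p q s t i j k l = Re (of_real (g p q x * g s t x / 2) *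
          (G i j x * (form_entry c e \<omega> (s, p, i, k) x * cnj (form_entry c e \<eta> (t, q, j, l) x) * ?H
              k l)))"
          unfolding Z_def K_def prod.case by (simp only: mult.assoc mult.commute mult.left_commute)
        also have "\<dots> = (g p q x * g s t x / 2) *
          Re (G i j x * (form_entry c e \<omega> (s, p, i, k) x * cnj (form_entry c e \<eta> (t, q, j, l) x) *
              ?H k l))"
          by simp
        finally show ?thesis by simp
      qed
      then show ?thesis unfolding ei sum_distrib_left sum_divide_distrib by simp
    qed
    also have "\<dots> = (\<Sum>\<alpha>\<in>S. \<Sum>\<beta>\<in>S. Re (K \<alpha> \<beta> x * form_entry c e \<omega> \<alpha> x * cnj (form_entry c e \<eta> \<beta> x)))"
      unfolding sum.cartesian_product S_def
      by (rule sum.reindex_bij_witness[of _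
            "\<lambda>((s, p, i, k), (t, q, j, l)). (p, q, s, t, i, j, k, l)"
            "\<lambda>(p, q, s, t, i, j, k, l). ((s, p, i, k), (t, q, j, l))"])
         (auto simp: Z_def)
    finally show "form_inner_at M F 2 \<omega> \<eta> x =
      (\<Sum>\<alpha>\<in>S. \<Sum>\<beta>\<in>S. Re (K \<alpha> \<beta> x * form_entry c e \<omega> \<alpha> x * cnj (form_entry c e \<eta> \<beta> x)))" .
  qed
qed

lemma smooth_near_form_entry:
  assumes \<omega>: "uform M F 2 \<omega>" and c: "c \<in> atlas M" "x \<in> fst c" and e: "e \<in> frames F" "x \<in> fst e"
    and ik: "i < frank F" "k < frank F"
  shows "smooth_near M x (form_entry c e \<omega> (s, p, i, k))"
  unfolding form_entry_def prod.case
  by (rule section_near_coord[OF uform_2_section_near[OF \<omega> c section_near_frame[OF e ik(1)]] e ik(2)])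

lemma continuous_on_form_entry:
  assumes \<omega>: "uform M F 2 \<omega>" and c: "c \<in> atlas M" and e: "e \<in> frames F"
    and \<alpha>: "\<alpha> \<in> UNIV \<times> UNIV \<times> {..<frank F} \<times> {..<frank F}"
  shows "continuous_on (fst c \<inter> fst e) (form_entry c e \<omega> \<alpha>)"
proof (rule smooth_fun_continuous)
  show o: "open (fst c \<inter> fst e)" using open_chart[OF c] open_frame[OF e] by auto
  show "smooth_fun M (fst c \<inter> fst e) (form_entry c e \<omega> \<alpha>)"
  proof (rule smooth_fun_local[OF o])
    fix x assume "x \<in> fst c \<inter> fst e"
    then have "smooth_near M x (form_entry c e \<omega> \<alpha>)"
      using \<alpha> smooth_near_form_entry[OF \<omega> c _ e] by auto
    then show "\<exists>T. open T \<and> x \<in> T \<and> smooth_fun M (fst c \<inter> fst e \<inter> T) (form_entry c e \<omega> \<alpha>)"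
      unfolding smooth_near_def by (blast intro: smooth_fun_subset)
  qed
qed

lemma continuous_on_form_inner_at:
  assumes \<omega>: "uform M F 2 \<omega>" and \<eta>: "uform M F 2 \<eta>"
  shows "continuous_on UNIV (form_inner_at M F 2 \<omega> \<eta>)"
  unfolding continuous_on_eq_continuous_at[OF open_UNIV]
proof
  fix x
  obtain c where c: "c \<in> atlas M" "x \<in> fst c" using ex_chart by blast
  obtain e where e: "e \<in> frames F" "x \<in> fst e" using ex_frame by blast
  have o: "open (fst c \<inter> fst e)" using open_chart[OF c(1)] open_frame[OF e(1)] by auto
  obtain K where K: "\<And>\<alpha> \<beta>. \<alpha> \<in> UNIV \<times> UNIV \<times> {..<frank F} \<times> {..<frank F} \<Longrightarrow>
      \<beta> \<in> UNIV \<times> UNIV \<times> {..<frank F} \<times> {..<frank F} \<Longrightarrow> continuous_on (fst c \<inter> fst e) (K \<alpha> \<beta>)"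
    "\<And>x \<omega> \<eta>. x \<in> fst c \<inter> fst e \<Longrightarrow> uform M F 2 \<omega> \<Longrightarrow> uform M F 2 \<eta> \<Longrightarrow>
      form_inner_at M F 2 \<omega> \<eta> x = (\<Sum>\<alpha>\<in>UNIV \<times> UNIV \<times> {..<frank F} \<times> {..<frank F}.
        \<Sum>\<beta>\<in>UNIV \<times> UNIV \<times> {..<frank F} \<times> {..<frank F}.
        Re (K \<alpha> \<beta> x * form_entry c e \<omega> \<alpha> x * cnj (form_entry c e \<eta> \<beta> x)))"
    using form_inner_at_local[OF c(1) e(1)] by blast
  have "continuous_on (fst c \<inter> fst e) (\<lambda>x. \<Sum>\<alpha>\<in>UNIV \<times> UNIV \<times> {..<frank F} \<times> {..<frank F}.
        \<Sum>\<beta>\<in>UNIV \<times> UNIV \<times> {..<frank F} \<times> {..<frank F}.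
        Re (K \<alpha> \<beta> x * form_entry c e \<omega> \<alpha> x * cnj (form_entry c e \<eta> \<beta> x)))"
    by (intro continuous_on_sum continuous_on_Re continuous_on_mult continuous_on_cnj K(1)
        continuous_on_form_entry \<omega> \<eta> c(1) e(1))
  then have "continuous_on (fst c \<inter> fst e) (form_inner_at M F 2 \<omega> \<eta>)"
    by (rule continuous_on_cong[THEN iffD1, rotated 2]) (simp_all add: K(2) \<omega> \<eta>)
  then show "isCont (form_inner_at M F 2 \<omega> \<eta>) x"
    using continuous_on_eq_continuous_at[OF o] c e by auto
qed

text \<open>Compactness of \<open>C\<close> bounds the kernel and the limit entries, as products of
  uniform limits require.\<close>

lemma uniform_limit_form_inner_at:
  assumes c: "c \<in> atlas M" and e: "e \<in> frames F" and C: "compact C" "C \<subseteq> fst c \<inter> fst e"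
    and u\<omega>: "\<forall>\<^sub>F t in T. uform M F 2 (\<omega> t)" and u\<eta>: "\<forall>\<^sub>F t in T. uform M F 2 (\<eta> t)"
    and \<omega>0: "uform M F 2 \<omega>0" and \<eta>0: "uform M F 2 \<eta>0"
    and \<omega>: "\<And>\<alpha>. \<alpha> \<in> UNIV \<times> UNIV \<times> {..<frank F} \<times> {..<frank F} \<Longrightarrow>
      uniform_limit C (\<lambda>t. form_entry c e (\<omega> t) \<alpha>) (form_entry c e \<omega>0 \<alpha>) T"
    and \<eta>: "\<And>\<alpha>. \<alpha> \<in> UNIV \<times> UNIV \<times> {..<frank F} \<times> {..<frank F} \<Longrightarrow>
      uniform_limit C (\<lambda>t. form_entry c e (\<eta> t) \<alpha>) (form_entry c e \<eta>0 \<alpha>) T"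
  shows "uniform_limit C (\<lambda>t. form_inner_at M F 2 (\<omega> t) (\<eta> t)) (form_inner_at M F 2 \<omega>0 \<eta>0) T"
proof -
  define S :: "('n \<times> 'n \<times> nat \<times> nat) set" where "S = UNIV \<times> UNIV \<times> {..<frank F} \<times> {..<frank F}"
  obtain K where K: "\<And>\<alpha> \<beta>. \<alpha> \<in> S \<Longrightarrow> \<beta> \<in> S \<Longrightarrow> continuous_on (fst c \<inter> fst e) (K \<alpha> \<beta>)"
    "\<And>x \<omega> \<eta>. x \<in> fst c \<inter> fst e \<Longrightarrow> uform M F 2 \<omega> \<Longrightarrow> uform M F 2 \<eta> \<Longrightarrow>
      form_inner_at M F 2 \<omega> \<eta> x = (\<Sum>\<alpha>\<in>S. \<Sum>\<beta>\<in>S. Re (K \<alpha> \<beta> x * form_entry c e \<omega> \<alpha> x * cnj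
          (form_entry c e \<eta> \<beta> x)))"
    using form_inner_at_local[OF c e] unfolding S_def by blast
  have bdd: "bounded (f ` C)" if "continuous_on (fst c \<inter> fst e) f" for f :: "'m \<Rightarrow> complex"
    using compact_continuous_image[OF continuous_on_subset[OF that C(2)] C(1)] compact_imp_bounded
        by blast
  have ent: "continuous_on (fst c \<inter> fst e) (form_entry c e \<theta> \<alpha>)" if "uform M F 2 \<theta>" "\<alpha> \<in> S" for \<theta> \<alpha>
    using continuous_on_form_entry[OF that(1) c e] that(2) by (simp add: S_def)
  have lim: "uniform_limit C (\<lambda>t x. \<Sum>\<alpha>\<in>S. \<Sum>\<beta>\<in>S. Re (K \<alpha> \<beta> x * form_entry c e (\<omega> t) \<alpha> x * cnj
      (form_entry c e (\<eta> t) \<beta> x)))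
      (\<lambda>x. \<Sum>\<alpha>\<in>S. \<Sum>\<beta>\<in>S. Re (K \<alpha> \<beta> x * form_entry c e \<omega>0 \<alpha> x * cnj (form_entry c e \<eta>0 \<beta> x))) T"
    by (intro uniform_limit_sum_family bounded_linear.uniform_limit[OF bounded_linear_Re]
        uniform_lim_mult
        bounded_linear.uniform_limit[OF bounded_linear_cnj] uniform_limit_const \<omega>[folded S_def]
            \<eta>[folded S_def]
        bdd continuous_on_mult continuous_on_cnj K(1) ent \<omega>0 \<eta>0)
  have ev: "\<forall>\<^sub>F t in T. \<forall>x\<in>C. form_inner_at M F 2 (\<omega> t) (\<eta> t) x =
      (\<Sum>\<alpha>\<in>S. \<Sum>\<beta>\<in>S. Re (K \<alpha> \<beta> x * form_entry c e (\<omega> t) \<alpha> x * cnj (form_entry c e (\<eta> t) \<beta> x)))"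
    using u\<omega> u\<eta>
  proof eventually_elim
    case (elim t)
    then show ?case using K(2) C(2) by blast
  qed
  have eq: "form_inner_at M F 2 \<omega>0 \<eta>0 x =
      (\<Sum>\<alpha>\<in>S. \<Sum>\<beta>\<in>S. Re (K \<alpha> \<beta> x * form_entry c e \<omega>0 \<alpha> x * cnj (form_entry c e \<eta>0 \<beta> x)))" if "x \<in> C" for x
    using K(2)[OF _ \<omega>0 \<eta>0] C(2) that by auto
  show ?thesis
    by (rule uniform_limit_cong[OF ev eq, THEN iffD2, OF _ lim])
qed

end

section \<open>Convergence of forms\<close>

context manifold
begin

lemma smooth_fun_of_near:
  assumes W: "open W" and f: "\<And>x. x \<in> W \<Longrightarrow> smooth_near M x f"
  shows "smooth_fun M W f"
proof (rule smooth_fun_local[OF W])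
  fix x assume "x \<in> W"
  then show "\<exists>T. open T \<and> x \<in> T \<and> smooth_fun M (W \<inter> T) f"
    using f[of x] unfolding smooth_near_def by (blast intro: smooth_fun_subset)
qed

lemma chart_deriv_diff:
  assumes c: "c \<in> atlas M" "x \<in> fst c" and f: "smooth_near M x f" "smooth_near M x g"
  shows "chart_deriv c w (\<lambda>y. f y - g y) x = chart_deriv c w f x - chart_deriv c w g x"
  unfolding chart_deriv_def[of _ _ f] chart_deriv_def[of _ _ g]
  by (rule chart_derivI) (use has_derivative_diff[OF smooth_near_differentiable[OF c f(1)]
      smooth_near_differentiable[OF c f(2)]] in \<open>simp add: o_def\<close>)

end

context hermitian_bundle
begin

section \<open>Matrix entries of 1-forms and their convergence\<close>

definition matrix_entry ::
  "('m, 'n) chart \<Rightarrow> ('m, 'v) frame \<Rightarrow> ('m, 'v) eform \<Rightarrow> real ^ 'n \<Rightarrow> nat \<Rightarrow> nat \<Rightarrow> 'm \<Rightarrow> complex" where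
  "matrix_entry c e \<omega> w i j = (\<lambda>x. frame_coord F e x (\<omega> x [coord_vec M c x w] (snd e j x)) i)"

lemma smooth_near_matrix_entry:
  assumes "uform M F 1 \<omega>" "c \<in> atlas M" "e \<in> frames F" "x \<in> fst c \<inter> fst e" "i < frank F" "j < frank F"
  shows "smooth_near M x (matrix_entry c e \<omega> w i j)"
  unfolding matrix_entry_def
  by (rule section_near_coord[OF uform_1_section_near[OF assms(1,2) _ section_near_frame[OF
      assms(3)]] assms(3)])
     (use assms in auto)

lemma continuous_on_matrix_entry:
  assumes "uform M F 1 \<omega>" and c: "c \<in> atlas M" and e: "e \<in> frames F" and "i < frank F" "j < frank F"
  shows "continuous_on (fst c \<inter> fst e) (matrix_entry c e \<omega> w i j)"
    and "continuous_on (fst c \<inter> fst e) (chart_deriv c v (matrix_entry c e \<omega> w i j))"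
proof -
  have o: "open (fst c \<inter> fst e)" using open_chart[OF c] open_frame[OF e] by auto
  have s: "smooth_fun M (fst c \<inter> fst e) (matrix_entry c e \<omega> w i j)"
    by (rule smooth_fun_of_near[OF o smooth_near_matrix_entry]) (use assms in auto)
  show "continuous_on (fst c \<inter> fst e) (matrix_entry c e \<omega> w i j)"
    by (rule smooth_fun_continuous[OF o s])
  show "continuous_on (fst c \<inter> fst e) (chart_deriv c v (matrix_entry c e \<omega> w i j))"
    by (rule smooth_fun_continuous[OF o smooth_fun_chart_deriv[OF c o _ s]]) auto
qed

lemma frame_coord_diff:
  assumes e: "e \<in> frames F" "x \<in> fst e" and i: "i < frank F"
    and z: "z \<in> fibre F x" "w \<in> fibre F x"
  shows "frame_coord F e x (z - w) i = frame_coord F e x z i - frame_coord F e x w i"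
  using frame_coord_add[OF e i fibre_diff[OF z] z(2)] by simp

lemma matrix_entry_diff:
  assumes \<omega>: "uform M F 1 \<omega>" and \<eta>: "uform M F 1 \<eta>" and c: "c \<in> atlas M" "x \<in> fst c"
    and e: "e \<in> frames F" "x \<in> fst e" and ij: "i < frank F" "j < frank F"
  shows "matrix_entry c e (form_diff \<omega> \<eta>) w i j x = matrix_entry c e \<omega> w i j x - matrix_entry c e
      \<eta> w i j x"
  unfolding matrix_entry_def form_diff_def
  by (rule frame_coord_diff[OF e ij(1)])
     (rule antihermitian_fibre[OF uform_1_antihermitian[OF _ coord_vec_tangent[OF c]]
         frame_fibre[OF e ij(2)]], fact)+

text \<open>A real \<open>SUP\<close> dominates the values only if they are bounded above; this is
  where compactness and continuity enter.\<close>

lemma uniform_limit_of_SUP: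
  fixes f :: "'t \<Rightarrow> 'm \<Rightarrow> complex"
  assumes K: "compact K" and lim: "((\<lambda>t. SUP x\<in>K. norm (h t x)) \<longlongrightarrow> 0) T"
    and h: "\<forall>\<^sub>F t in T. \<forall>x\<in>K. h t x = f t x - g x"
    and cont: "\<forall>\<^sub>F t in T. continuous_on K (f t)" and g: "continuous_on K g"
  shows "uniform_limit K f g T"
  unfolding uniform_limit_iff
proof (intro allI impI)
  fix d :: real assume "d > 0"
  then have "\<forall>\<^sub>F t in T. dist (SUP x\<in>K. norm (h t x)) 0 < d" by (rule tendstoD[OF lim])
  then show "\<forall>\<^sub>F t in T. \<forall>x\<in>K. dist (f t x) (g x) < d"
    using h cont
  proof eventually_elim
    case (elim t)
    show ?case
    proof
      fix x assume x: "x \<in> K"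
      have "continuous_on K (\<lambda>x. norm (f t x - g x))" using elim(3) g by (intro continuous_intros)
      then have "continuous_on K (\<lambda>x. norm (h t x))"
        by (rule continuous_on_cong[THEN iffD1, rotated 2]) (use elim(2) in auto)
      then have "bdd_above ((\<lambda>x. norm (h t x)) ` K)"
        by (intro bounded_imp_bdd_above compact_imp_bounded compact_continuous_image K)
      then have "norm (h t x) \<le> (SUP x\<in>K. norm (h t x))" by (rule cSUP_upper2[OF _ x]) simp
      also have "\<dots> < d" using elim(1) by simp
      finally show "dist (f t x) (g x) < d" using elim(2) x by (simp add: dist_norm)
    qed
  qed
qed

text \<open>The two claims use the seminorms with no derivative and with one derivative. These are
  formed over nonempty sets, and the empty set is treated apart.\<close>

lemma uniform_limit_matrix_entry:
  assumes lim: "form_tendsto M F 1 \<omega> \<eta> T" and \<omega>: "\<forall>\<^sub>F t in T. uform M F 1 (\<omega> t)" and \<eta>: "uform M F 1 \<eta>"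
    and c: "c \<in> atlas M" and e: "e \<in> frames F" and K: "compact K" "K \<subseteq> fst c \<inter> fst e"
    and ij: "i < frank F" "j < frank F"
  shows "uniform_limit K (\<lambda>t. matrix_entry c e (\<omega> t) w i j) (matrix_entry c e \<eta> w i j) T"
    and "uniform_limit K (\<lambda>t. chart_deriv c v (matrix_entry c e (\<omega> t) w i j)) (chart_deriv c v
        (matrix_entry c e \<eta> w i j)) T"
proof -
  have o: "open (fst c \<inter> fst e)" using open_chart[OF c] open_frame[OF e] by auto
  have comp: "form_component M F c e [w] i j \<theta> = matrix_entry c e \<theta> w i j \<circ> chart_inv c" for \<theta>
    by (simp add: form_component_def matrix_entry_def Let_def fun_eq_iff)
  have p: "((\<lambda>t. SUP x\<in>K. norm (iter_deriv ws (form_component M F c e [w] i j (form_diff (\<omega> t) \<eta>))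
      (snd c x))) \<longlongrightarrow> 0) T"
    if "K \<noteq> {}" for ws
  proof -
    have mem: "(\<lambda>\<omega>. SUP x\<in>K. norm (iter_deriv ws (form_component M F c e [w] i j \<omega>) (snd c x))) \<in>
        smooth_seminorms M F 1"
      unfolding smooth_seminorms_def using c e K ij that
      by (intro CollectI exI[of _ c] exI[of _ e] exI[of _ "[w]"] exI[of _ i] exI[of _ j] exI[of _
          ws] exI[of _ K]) auto
    show ?thesis by (rule bspec[OF lim[unfolded form_tendsto_def] mem])
  qed
  show "uniform_limit K (\<lambda>t. matrix_entry c e (\<omega> t) w i j) (matrix_entry c e \<eta> w i j) T"
  proof (cases "K = {}")
    case False
    show ?thesis
    proof (rule uniform_limit_of_SUP[OF K(1) p[OF False, of "[]"]])
      show "\<forall>\<^sub>F t in T. \<forall>x\<in>K. iter_deriv [] (form_component M F c e [w] i j (form_diff (\<omega> t) \<eta>))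
          (snd c x) =
          matrix_entry c e (\<omega> t) w i j x - matrix_entry c e \<eta> w i j x"
        using \<omega>
      proof eventually_elim
        case (elim t)
        show ?case
        proof
          fix x assume "x \<in> K"
          then have x: "x \<in> fst c" "x \<in> fst e" using K by auto
          show "iter_deriv [] (form_component M F c e [w] i j (form_diff (\<omega> t) \<eta>)) (snd c x) =
            matrix_entry c e (\<omega> t) w i j x - matrix_entry c e \<eta> w i j x"
            by (simp add: comp c x(1) matrix_entry_diff[OF elim \<eta> c x(1) e x(2) ij])
        qed
      qed
      show "\<forall>\<^sub>F t in T. continuous_on K (matrix_entry c e (\<omega> t) w i j)"
        using \<omega> by eventually_elim (rule continuous_on_subset[OF continuous_on_matrix_entry(1)[OF
            _ c e ij] K(2)])
    qed (rule continuous_on_subset[OF continuous_on_matrix_entry(1)[OF \<eta> c e ij] K(2)])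
  qed simp
  show "uniform_limit K (\<lambda>t. chart_deriv c v (matrix_entry c e (\<omega> t) w i j)) (chart_deriv c v
      (matrix_entry c e \<eta> w i j)) T"
  proof (cases "K = {}")
    case False
    show ?thesis
    proof (rule uniform_limit_of_SUP[OF K(1) p[OF False, of "[v]"]])
      show "\<forall>\<^sub>F t in T. \<forall>x\<in>K. iter_deriv [v] (form_component M F c e [w] i j (form_diff (\<omega> t) \<eta>))
          (snd c x) =
          chart_deriv c v (matrix_entry c e (\<omega> t) w i j) x - chart_deriv c v (matrix_entry c e \<eta> w
              i j) x"
        using \<omega>
      proof eventually_elim
        case (elim t)
        show ?case
        proof
          fix x assume "x \<in> K"
          then have x: "x \<in> fst c" "x \<in> fst e" "x \<in> fst c \<inter> fst e" using K by auto
          note s = smooth_near_matrix_entry[OF elim c e x(3) ij] smooth_near_matrix_entry[OF \<eta> c e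
              x(3) ij]
          have d: "smooth_near M x (\<lambda>y. matrix_entry c e (\<omega> t) w i j y - matrix_entry c e \<eta> w i j y)"
          proof (rule smooth_near_open[OF o x(3)])
            have "smooth_fun M (fst c \<inter> fst e) (\<lambda>y. matrix_entry c e (\<omega> t) w i j y + (- 1) *
                matrix_entry c e \<eta> w i j y)"
              by (intro smooth_fun_add smooth_fun_mult smooth_fun_const o
                  smooth_fun_of_near[OF o smooth_near_matrix_entry[OF elim c e _ ij]]
                  smooth_fun_of_near[OF o smooth_near_matrix_entry[OF \<eta> c e _ ij]])
            then show "smooth_fun M (fst c \<inter> fst e) (\<lambda>y. matrix_entry c e (\<omega> t) w i j y -
                matrix_entry c e \<eta> w i j y)"
              by simp
          qed
          have "iter_deriv [v] (form_component M F c e [w] i j (form_diff (\<omega> t) \<eta>)) (snd c x) =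
            chart_deriv c v (matrix_entry c e (form_diff (\<omega> t) \<eta>) w i j) x"
            by (simp add: comp chart_deriv_def)
          also have "\<dots> = chart_deriv c v (\<lambda>y. matrix_entry c e (\<omega> t) w i j y - matrix_entry c e \<eta>
              w i j y) x"
            by (rule chart_deriv_cong[OF c x(1) o x(3) _ d]) (use matrix_entry_diff[OF elim \<eta> c _
                e _ ij] in auto)
          also have "\<dots> = chart_deriv c v (matrix_entry c e (\<omega> t) w i j) x - chart_deriv c v
              (matrix_entry c e \<eta> w i j) x"
            by (rule chart_deriv_diff[OF c x(1) s])
          finally show "iter_deriv [v] (form_component M F c e [w] i j (form_diff (\<omega> t) \<eta>)) (snd c x) =
            chart_deriv c v (matrix_entry c e (\<omega> t) w i j) x - chart_deriv c v (matrix_entry c e \<eta>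
                w i j) x" .
        qed
      qed
      show "\<forall>\<^sub>F t in T. continuous_on K (chart_deriv c v (matrix_entry c e (\<omega> t) w i j))"
        using \<omega> by eventually_elim (rule continuous_on_subset[OF continuous_on_matrix_entry(2)[OF
            _ c e ij] K(2)])
    qed (rule continuous_on_subset[OF continuous_on_matrix_entry(2)[OF \<eta> c e ij] K(2)])
  qed simp
qed

lemma matrix_entry_expansion:
  assumes E: "uform M F 1 E" and c: "c \<in> atlas M" "x \<in> fst c" and e: "e \<in> frames F" "x \<in> fst e"
      and j: "j < frank F"
  shows "E x [coord_vec M c x w] (snd e j x) = (\<Sum>l<frank F. fscale F (matrix_entry c e E w l j x)
      (snd e l x))"
  unfolding matrix_entry_def
  by (rule frame_expansion[OF e antihermitian_fibre[OF uform_1_antihermitian[OF E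
      coord_vec_tangent[OF c]]
        frame_fibre[OF e j]], symmetric])

lemma frame_coord_uform_1:
  assumes E: "uform M F 1 E" and c: "c \<in> atlas M" "x \<in> fst c" and e: "e \<in> frames F" "x \<in> fst e"
    and k: "k < frank F" and z: "z \<in> fibre F x"
  shows "frame_coord F e x (E x [coord_vec M c x w] z) k =
    (\<Sum>l<frank F. frame_coord F e x z l * matrix_entry c e E w k l x)"
proof -
  note ah = uform_1_antihermitian[OF E coord_vec_tangent[OF c, of w]]
  note fr = frame_fibre[OF e]
  have "E x [coord_vec M c x w] z = E x [coord_vec M c x w] (\<Sum>l<frank F. fscale F (frame_coord F e
      x z l) (snd e l x))"
    by (simp add: frame_expansion[OF e z])
  also have "\<dots> = (\<Sum>l<frank F. E x [coord_vec M c x w] (fscale F (frame_coord F e x z l) (snd e l x)))"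
    by (rule antihermitian_sum[OF ah]) (simp add: fibre_scale fr)
  also have "\<dots> = (\<Sum>l<frank F. fscale F (frame_coord F e x z l) (E x [coord_vec M c x w] (snd e l x)))"
    by (rule sum.cong) (simp_all add: antihermitian_scale[OF ah] fr)
  finally have eq: "E x [coord_vec M c x w] z =
    (\<Sum>l<frank F. fscale F (frame_coord F e x z l) (E x [coord_vec M c x w] (snd e l x)))" .
  have m: "E x [coord_vec M c x w] (snd e l x) \<in> fibre F x" if "l \<in> {..<frank F}" for l
    using that by (intro antihermitian_fibre[OF ah] fr) simp
  have "frame_coord F e x (E x [coord_vec M c x w] z) k =
    (\<Sum>l<frank F. frame_coord F e x (fscale F (frame_coord F e x z l) (E x [coord_vec M c x w] (snd
        e l x))) k)"
    unfolding eq by (rule frame_coord_sum[OF e k fibre_scale[OF m]])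
  also have "\<dots> = (\<Sum>l<frank F. frame_coord F e x z l * matrix_entry c e E w k l x)"
    by (rule sum.cong) (simp_all add: frame_coord_scale[OF e k m] matrix_entry_def)
  finally show ?thesis .
qed

lemma form_entry_wedge_square:
  assumes E: "uform M F 1 E" and c: "c \<in> atlas M" "x \<in> fst c" and e: "e \<in> frames F" "x \<in> fst e"
    and ik: "i < frank F" "k < frank F"
  shows "form_entry c e (wedge_square E) (s, p, i, k) x =
    (\<Sum>l<frank F. matrix_entry c e E (axis p 1) l i x * matrix_entry c e E (axis s 1) k l x) -
    (\<Sum>l<frank F. matrix_entry c e E (axis s 1) l i x * matrix_entry c e E (axis p 1) k l x)"
proof -
  note ah = uform_1_antihermitian[OF E coord_vec_tangent[OF c]]
  note m = antihermitian_fibre[OF ah frame_fibre[OF e ik(1)]]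
  show ?thesis
    unfolding form_entry_def prod.case wedge_square_def
    by (simp add: frame_coord_diff[OF e ik(2)] antihermitian_fibre[OF ah] m frame_coord_uform_1[OF
        E c e ik(2) m])
       (simp add: matrix_entry_def)
qed

end

context hermitian_bundle_connection
begin

section \<open>Matrix entries of the covariant derivative\<close>

definition christoffel :: "('m, 'n) chart \<Rightarrow> ('m, 'v) frame \<Rightarrow> 'n \<Rightarrow> nat \<Rightarrow> nat \<Rightarrow> 'm \<Rightarrow> complex" where
  "christoffel c e s j k = (\<lambda>x. frame_coord F e x (D (snd e j) x (coord_vec M c x (axis s 1))) k)"

lemma continuous_on_christoffel:
  assumes c: "c \<in> atlas M" and e: "e \<in> frames F" and jk: "j < frank F" "k < frank F"
  shows "continuous_on (fst c \<inter> fst e) (christoffel c e s j k)"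
proof -
  have o: "open (fst c \<inter> fst e)" using open_chart[OF c] open_frame[OF e] by auto
  show ?thesis
    unfolding christoffel_def
    by (intro smooth_fun_continuous o smooth_fun_of_near section_near_coord[OF section_near_D[OF
        section_near_frame]])
       (use c e jk in auto)
qed

lemma frame_coord_D_uform:
  assumes E: "uform M F 1 E" and c: "c \<in> atlas M" "x \<in> fst c" and e: "e \<in> frames F" "x \<in> fst e"
    and ik: "i < frank F" "k < frank F"
  shows "frame_coord F e x (D (\<lambda>y. E y [coord_vec M c y w] (snd e i y)) x (coord_vec M c x (axis s
      1))) k =
    chart_deriv c (axis s 1) (matrix_entry c e E w k i) x +
    (\<Sum>l<frank F. matrix_entry c e E w l i x * christoffel c e s l k x)"
proof -
  let ?a = "\<lambda>l. matrix_entry c e E w l i" and ?v = "coord_vec M c x (axis s 1)"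
  note T = coord_vec_tangent[OF c, of "axis s 1"]
  have x: "x \<in> fst c \<inter> fst e" using c e by auto
  have ev: "\<forall>\<^sub>F y in nhds x. E y [coord_vec M c y w] (snd e i y) = (\<Sum>l<frank F. fscale F (?a l y)
      (snd e l y))"
    using eventually_chart[OF c] eventually_nhds_in_open[OF open_frame[OF e(1)] e(2)]
    by eventually_elim (rule matrix_entry_expansion[OF E c(1) _ e(1) _ ik(1)])
  note sa = smooth_near_matrix_entry[OF E c(1) e(1) x _ ik(1)]
  note se = section_near_frame[OF e]
  have "D (\<lambda>y. E y [coord_vec M c y w] (snd e i y)) x ?v = D (\<lambda>y. \<Sum>l<frank F. fscale F (?a l y)
      (snd e l y)) x ?v"
    by (rule D_cong[OF uform_1_section_near[OF E c se[OF ik(1)]] ev T])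
  also have "\<dots> = (\<Sum>l<frank F. D (\<lambda>y. fscale F (?a l y) (snd e l y)) x ?v)"
    by (rule D_sum[OF _ T]) (auto intro: section_near_scale[OF sa se])
  also have "\<dots> = (\<Sum>l<frank F. fscale F (chart_deriv c (axis s 1) (?a l) x) (snd e l x) + fscale F
      (?a l x) (D (snd e l) x ?v))"
    by (rule sum.cong) (simp_all add: D_scale[OF sa se T] cdiff_coord_vec[OF c sa])
  finally have eq: "D (\<lambda>y. E y [coord_vec M c y w] (snd e i y)) x ?v =
    (\<Sum>l<frank F. fscale F (chart_deriv c (axis s 1) (?a l) x) (snd e l x)) + (\<Sum>l<frank F. fscale F
        (?a l x) (D (snd e l) x ?v))"
    by (simp add: sum.distrib)
  have m: "snd e l x \<in> fibre F x" "D (snd e l) x ?v \<in> fibre F x" if "l \<in> {..<frank F}" for l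
    using that frame_fibre[OF e] D_fibre[OF se T] by auto
  have "frame_coord F e x (\<Sum>l<frank F. fscale F (?a l x) (D (snd e l) x ?v)) k =
    (\<Sum>l<frank F. frame_coord F e x (fscale F (?a l x) (D (snd e l) x ?v)) k)"
    by (rule frame_coord_sum[OF e ik(2) fibre_scale[OF m(2)]])
  also have "\<dots> = (\<Sum>l<frank F. ?a l x * christoffel c e s l k x)"
    by (rule sum.cong) (simp_all add: frame_coord_scale[OF e ik(2) m(2)] christoffel_def)
  finally have 2: "frame_coord F e x (\<Sum>l<frank F. fscale F (?a l x) (D (snd e l) x ?v)) k =
    (\<Sum>l<frank F. ?a l x * christoffel c e s l k x)" .
  have A: "(\<Sum>l<frank F. fscale F (chart_deriv c (axis s 1) (?a l) x) (snd e l x)) \<in> fibre F x"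
    by (rule fibre_sum[OF fibre_scale[OF m(1)]])
  have B: "(\<Sum>l<frank F. fscale F (?a l x) (D (snd e l) x ?v)) \<in> fibre F x"
    by (rule fibre_sum[OF fibre_scale[OF m(2)]])
  show ?thesis
    unfolding eq frame_coord_add[OF e ik(2) A B] 2 frame_coord_unique[OF e ik(2)] ..
qed

text \<open>In matrices this reads \<partial>_s A_p - \<partial>_p A_s + [\<Gamma>_s, A_p] -
  [\<Gamma>_p, A_s], with A the components of \<open>E\<close> and \<Gamma> those of the connection.
  It is linear in the entries and their first derivatives, with continuous coefficients.\<close>

lemma form_entry_nabla_form:
  assumes E: "uform M F 1 E" and c: "c \<in> atlas M" "x \<in> fst c" and e: "e \<in> frames F" "x \<in> fst e"
    and ik: "i < frank F" "k < frank F"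
  shows "form_entry c e (nabla_form M F D E) (s, p, i, k) x =
    (chart_deriv c (axis s 1) (matrix_entry c e E (axis p 1) k i) x +
      (\<Sum>l<frank F. matrix_entry c e E (axis p 1) l i x * christoffel c e s l k x)) -
    (chart_deriv c (axis p 1) (matrix_entry c e E (axis s 1) k i) x +
      (\<Sum>l<frank F. matrix_entry c e E (axis s 1) l i x * christoffel c e p l k x)) -
    (\<Sum>l<frank F. christoffel c e s i l x * matrix_entry c e E (axis p 1) k l x) +
    (\<Sum>l<frank F. christoffel c e p i l x * matrix_entry c e E (axis s 1) k l x)"
proof -
  note se = section_near_frame[OF e ik(1)]
  note T = coord_vec_tangent[OF c]
  note ah = uform_1_antihermitian[OF E T]
  note mD = D_fibre[OF se T]
  note m = D_fibre[OF uform_1_section_near[OF E c se] T] antihermitian_fibre[OF ah mD]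
  show ?thesis
    unfolding form_entry_def prod.case nabla_form_1_eq[OF E c se] nabla1_chart_def
    by (simp add: frame_coord_add[OF e ik(2)] frame_coord_diff[OF e ik(2)] fibre_diff m
        frame_coord_D_uform[OF E c e ik] frame_coord_uform_1[OF E c e ik(2) mD])
       (simp add: christoffel_def)
qed

text \<open>Both forms are polynomial in the matrix entries and their first derivatives, with
  coefficients independent of \<open>t\<close>, so uniform convergence of these suffices. The bounds
  \<open>B\<close> serve the products.\<close>

lemma uniform_limit_form_entry:
  assumes lim: "form_tendsto M F 1 \<omega> \<eta> T" and \<omega>: "\<forall>\<^sub>F t in T. uform M F 1 (\<omega> t)" and \<eta>: "uform M F 1 \<eta>"
    and c: "c \<in> atlas M" and e: "e \<in> frames F" and K: "compact K" "K \<subseteq> fst c \<inter> fst e"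
    and \<alpha>: "\<alpha> \<in> UNIV \<times> UNIV \<times> {..<frank F} \<times> {..<frank F}"
  shows "uniform_limit K (\<lambda>t. form_entry c e (nabla_form M F D (\<omega> t)) \<alpha>) (form_entry c e
      (nabla_form M F D \<eta>) \<alpha>) T"
    and "uniform_limit K (\<lambda>t. form_entry c e (wedge_square (\<omega> t)) \<alpha>) (form_entry c e (wedge_square
        \<eta>) \<alpha>) T"
proof -
  obtain s p i k where \<alpha>': "\<alpha> = (s, p, i, k)" and ik: "i < frank F" "k < frank F" using \<alpha> by auto
  note L = uniform_limit_matrix_entry[OF lim \<omega> \<eta> c e K]
  have bdd: "bounded (f ` K)" if "continuous_on (fst c \<inter> fst e) f" for f :: "'m \<Rightarrow> complex"
    using compact_continuous_image[OF continuous_on_subset[OF that K(2)] K(1)] compact_imp_bounded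
        by blast
  note B = bdd[OF continuous_on_matrix_entry(1)[OF \<eta> c e]] bdd[OF continuous_on_christoffel[OF c e]]
  note Kx = subsetD[OF K(2)]
  show "uniform_limit K (\<lambda>t. form_entry c e (nabla_form M F D (\<omega> t)) \<alpha>) (form_entry c e
      (nabla_form M F D \<eta>) \<alpha>) T"
  proof (rule uniform_limit_cong[THEN iffD2])
    show "\<forall>\<^sub>F t in T. \<forall>x\<in>K. form_entry c e (nabla_form M F D (\<omega> t)) \<alpha> x =
      (chart_deriv c (axis s 1) (matrix_entry c e (\<omega> t) (axis p 1) k i) x +
        (\<Sum>l<frank F. matrix_entry c e (\<omega> t) (axis p 1) l i x * christoffel c e s l k x)) -
      (chart_deriv c (axis p 1) (matrix_entry c e (\<omega> t) (axis s 1) k i) x +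
        (\<Sum>l<frank F. matrix_entry c e (\<omega> t) (axis s 1) l i x * christoffel c e p l k x)) -
      (\<Sum>l<frank F. christoffel c e s i l x * matrix_entry c e (\<omega> t) (axis p 1) k l x) +
      (\<Sum>l<frank F. christoffel c e p i l x * matrix_entry c e (\<omega> t) (axis s 1) k l x)"
      using \<omega> by eventually_elim (use Kx in \<open>auto simp: \<alpha>' form_entry_nabla_form[OF _ c _ e _ ik]\<close>)
    show "form_entry c e (nabla_form M F D \<eta>) \<alpha> x =
      (chart_deriv c (axis s 1) (matrix_entry c e \<eta> (axis p 1) k i) x +
        (\<Sum>l<frank F. matrix_entry c e \<eta> (axis p 1) l i x * christoffel c e s l k x)) -
      (chart_deriv c (axis p 1) (matrix_entry c e \<eta> (axis s 1) k i) x +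
        (\<Sum>l<frank F. matrix_entry c e \<eta> (axis s 1) l i x * christoffel c e p l k x)) -
      (\<Sum>l<frank F. christoffel c e s i l x * matrix_entry c e \<eta> (axis p 1) k l x) +
      (\<Sum>l<frank F. christoffel c e p i l x * matrix_entry c e \<eta> (axis s 1) k l x)" if "x \<in> K" for x
      using Kx[OF that] by (auto simp: \<alpha>' form_entry_nabla_form[OF \<eta> c _ e _ ik])
  qed (intro uniform_limit_add uniform_limit_minus uniform_limit_sum_family uniform_lim_mult
      uniform_limit_const L B ik; simp)
  show "uniform_limit K (\<lambda>t. form_entry c e (wedge_square (\<omega> t)) \<alpha>) (form_entry c e (wedge_square
      \<eta>) \<alpha>) T"
  proof (rule uniform_limit_cong[THEN iffD2])
    show "\<forall>\<^sub>F t in T. \<forall>x\<in>K. form_entry c e (wedge_square (\<omega> t)) \<alpha> x =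
      (\<Sum>l<frank F. matrix_entry c e (\<omega> t) (axis p 1) l i x * matrix_entry c e (\<omega> t) (axis s 1) k l x) -
      (\<Sum>l<frank F. matrix_entry c e (\<omega> t) (axis s 1) l i x * matrix_entry c e (\<omega> t) (axis p 1) k l x)"
      using \<omega> by eventually_elim (use Kx in \<open>auto simp: \<alpha>' form_entry_wedge_square[OF _ c _ e _ ik]\<close>)
    show "form_entry c e (wedge_square \<eta>) \<alpha> x =
      (\<Sum>l<frank F. matrix_entry c e \<eta> (axis p 1) l i x * matrix_entry c e \<eta> (axis s 1) k l x) -
      (\<Sum>l<frank F. matrix_entry c e \<eta> (axis s 1) l i x * matrix_entry c e \<eta> (axis p 1) k l x)" if
          "x \<in> K" for x
      using Kx[OF that] by (auto simp: \<alpha>' form_entry_wedge_square[OF \<eta> c _ e _ ik])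
  qed (intro uniform_limit_minus uniform_limit_sum_family uniform_lim_mult L B ik; simp)
qed

end

section \<open>Integration\<close>

context manifold
begin

text \<open>The rows of \<open>A\<close> are the coordinates of an orthonormal basis. Hence
  \<open>A ** H ** transpose A\<close> is the identity, and the square of det A times det H is
  1.\<close>

lemma vol_density_pos:
  assumes c: "c \<in> atlas M" "x \<in> fst c"
  shows "vol_density M c x > 0"
proof -
  let ?d = "\<lambda>i. coord_vec M c x (axis i 1)"
  define H :: "real ^ 'n ^ 'n" where "H = (\<chi> i j. rmetric M x (?d i) (?d j))"
  obtain \<epsilon> where \<epsilon>: "tangent_onb M x \<epsilon>" using ex_tangent_onb by blast
  then have "\<forall>i. \<exists>w. \<epsilon> i = coord_vec M c x w"
    using tangent_space_chart[OF c] unfolding tangent_onb_def by blast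
  then obtain w where w: "\<And>i. \<epsilon> i = coord_vec M c x (w i)" by metis
  define A :: "real ^ 'n ^ 'n" where "A = (\<chi> i. w i)"
  have "A ** H ** transpose A = mat 1"
  proof (unfold vec_eq_iff, intro allI)
    fix k l
    have "(A ** H ** transpose A) $ k $ l = (\<Sum>j\<in>UNIV. \<Sum>i\<in>UNIV. w k $ i * w l $ j * rmetric M x (?d
        i) (?d j))"
      by (simp add: matrix_matrix_mult_def transpose_def A_def H_def sum_distrib_right
          sum_distrib_left algebra_simps)
    also have "\<dots> = (\<Sum>i\<in>UNIV. \<Sum>j\<in>UNIV. w k $ i * w l $ j * rmetric M x (?d i) (?d j))"
      by (rule sum.swap)
    also have "\<dots> = rmetric M x (\<epsilon> k) (\<epsilon> l)"
      unfolding w by (rule tangent_bilinear_expansion[OF tangent_bilinear_rmetric c, symmetric])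
    also have "\<dots> = mat 1 $ k $ l" using \<epsilon> by (simp add: tangent_onb_def mat_def)
    finally show "(A ** H ** transpose A) $ k $ l = mat 1 $ k $ l" .
  qed
  then have "det (A ** H ** transpose A) = 1" by simp
  then have "(det A)\<^sup>2 * det H = 1" by (simp add: det_mul det_transpose power2_eq_square mult_ac)
  then have "det H > 0" by (metis zero_le_power2 zero_less_mult_pos zero_less_one mult_eq_0_iff
      order_le_less)
  then show ?thesis by (simp add: vol_density_def H_def)
qed

lemma continuous_on_vol_density:
  assumes c: "c \<in> atlas M"
  shows "continuous_on (fst c) (vol_density M c)"
proof -
  have "continuous_on (fst c) (\<lambda>x. rmetric M x (coord_vec M c x w) (coord_vec M c x w'))" for w w'
    using riemannian c unfolding riemannian_metric_def by (intro smooth_fun_continuous open_chart) auto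
  then show ?thesis
    unfolding vol_density_def det_def by (simp, intro continuous_intros)
qed

end

locale compact_manifold = manifold M
  for M :: "('m::t2_space, 'n::finite) riem" +
  assumes compact_UNIV: "compact (UNIV :: 'm set)"
begin

section \<open>Continuous partitions of unity on a compact manifold\<close>

lemma bump_function:
  assumes U: "open U" "x \<in> U"
  shows "\<exists>f :: 'm \<Rightarrow> real. continuous_on UNIV f \<and> (\<forall>y. f y \<ge> 0) \<and> f x > 0 \<and> closure {y. f y \<noteq> 0} \<subseteq> U"
proof -
  have "Hausdorff_space (euclidean :: 'm topology)"
    unfolding Hausdorff_space_def disjnt_def by simp (metis hausdorff)
  then have normal: "normal_space (euclidean :: 'm topology)"
    using compact_UNIV by (intro compact_Hausdorff_or_regular_imp_normal_space) (auto simp: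
        compact_space_def)
  have sets: "closedin euclidean (- U)" "closedin euclidean {x}" "disjnt (- U) {x}"
    using U by (auto simp: disjnt_def)
  obtain g where g: "continuous_map euclidean euclideanreal g" "g ` (- U) \<subseteq> {0 :: real}" "g ` {x} \<subseteq> {1}"
    by (rule Urysohn_lemma_alt[OF normal sets, where a = 0 and b = 1]) (rule that)
  then have cont: "continuous_on UNIV g" by simp
  \<comment> \<open>Cutting off below 1/2 puts the closure of the support into a closed set on which
    \<open>g\<close> is at least 1/2, hence into \<open>U\<close>. For \<open>g\<close> itself the
    closure could reach the boundary of \<open>U\<close>.\<close>
  define f where "f = (\<lambda>y. max 0 (g y - 1/2))"
  have "closed {y. g y \<ge> 1/2}"
    using continuous_closed_preimage[OF cont closed_UNIV closed_atLeast[of "1/2"]]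
    by (simp add: vimage_def)
  then have "closure {y. f y \<noteq> 0} \<subseteq> {y. g y \<ge> 1/2}"
    by (intro closure_minimal) (auto simp: f_def)
  also have "\<dots> \<subseteq> U" using g(2) by force
  finally show ?thesis
    using g(3) cont by (intro exI[of _ f]) (auto simp: f_def intro!: continuous_intros)
qed

lemma ex_partition_of_unity: "\<exists>C \<rho>. partition_of_unity M C \<rho>"
proof -
  have "\<forall>x. \<exists>c f. c \<in> atlas M \<and> continuous_on UNIV f \<and> (\<forall>y. f y \<ge> 0) \<and> f x > (0::real) \<and>
      closure {y. f y \<noteq> 0} \<subseteq> fst c"
    using ex_chart bump_function[OF open_chart] by metis
  then obtain c f where c: "\<And>x. c x \<in> atlas M" and f: "\<And>x. continuous_on UNIV (f x)" "\<And>x y. f x y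
      \<ge> (0::real)"
      "\<And>x. f x x > 0" "\<And>x. closure {y. f x y \<noteq> 0} \<subseteq> fst (c x)"
    by metis
  have op: "open {y. f x y > 0}" for x
    using open_Collect_less[OF continuous_on_const f(1)] by simp
  obtain X where X: "finite X" "(UNIV :: 'm set) \<subseteq> (\<Union>x\<in>X. {y. f x y > 0})"
    by (rule compactE_image[OF compact_UNIV, of UNIV "\<lambda>x. {y. f x y > 0}"]) (use op f(3) in auto)
  define Z where "Z = (\<lambda>y. \<Sum>x\<in>X. f x y)"
  have Z: "Z y > 0" for y
  proof -
    obtain x where "x \<in> X" "f x y > 0" using X(2) by blast
    then show ?thesis unfolding Z_def using X(1) f(2) by (intro sum_pos2[of X x]) auto
  qed
  \<comment> \<open>Weights are indexed by charts, so the bump functions of all points that were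
    assigned the same chart are added up.\<close>
  define \<rho> where "\<rho> = (\<lambda>d y. (\<Sum>x\<in>{x\<in>X. c x = d}. f x y) / Z y)"
  have "partition_of_unity M (c ` X) \<rho>"
    unfolding partition_of_unity_def
  proof (intro conjI ballI allI)
    show "finite (c ` X)" using X by simp
    show "c ` X \<subseteq> atlas M" using c by auto
    fix d
    have "Z y \<noteq> 0" for y using Z[of y] by simp
    then show "continuous_on UNIV (\<rho> d)" unfolding \<rho>_def
      unfolding Z_def by (intro continuous_intros f(1)) auto
    show "\<rho> d y \<ge> 0" for y unfolding \<rho>_def using Z[of y] f(2) by (intro divide_nonneg_pos
        sum_nonneg) auto
    have "{y. \<rho> d y \<noteq> 0} \<subseteq> (\<Union>x\<in>{x\<in>X. c x = d}. {y. f x y \<noteq> 0})"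
    proof
      fix y assume "y \<in> {y. \<rho> d y \<noteq> 0}"
      then have "(\<Sum>x\<in>{x\<in>X. c x = d}. f x y) \<noteq> 0" unfolding \<rho>_def by force
      then obtain x where "x \<in> {x\<in>X. c x = d}" "f x y \<noteq> 0" by (rule sum.not_neutral_contains_not_neutral)
      then show "y \<in> (\<Union>x\<in>{x\<in>X. c x = d}. {y. f x y \<noteq> 0})" by blast
    qed
    also have "\<dots> \<subseteq> (\<Union>x\<in>{x\<in>X. c x = d}. closure {y. f x y \<noteq> 0})"
      by (intro UN_mono closure_subset) auto
    finally have "closure {y. \<rho> d y \<noteq> 0} \<subseteq> (\<Union>x\<in>{x\<in>X. c x = d}. closure {y. f x y \<noteq> 0})"
      by (rule closure_minimal) (use X in \<open>auto intro!: closed_UN\<close>)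
    also have "\<dots> \<subseteq> fst d" using f(4) by auto
    finally show "closure {y. \<rho> d y \<noteq> 0} \<subseteq> fst d" .
  next
    fix y
    have "(\<Sum>d\<in>c ` X. \<rho> d y) = (\<Sum>d\<in>c ` X. \<Sum>x\<in>{x\<in>X. c x = d}. f x y) / Z y"
      by (simp add: \<rho>_def sum_divide_distrib)
    also have "(\<Sum>d\<in>c ` X. \<Sum>x\<in>{x\<in>X. c x = d}. f x y) = Z y"
      unfolding Z_def using X by (simp add: sum.image_gen[symmetric])
    finally show "(\<Sum>d\<in>c ` X. \<rho> d y) = 1" using Z[of y] by simp
  qed
  then show ?thesis by blast
qed

section \<open>Integration of continuous functions\<close>

definition vol_integrand ::
  "(('m, 'n) chart \<Rightarrow> 'm \<Rightarrow> real) \<Rightarrow> ('m, 'n) chart \<Rightarrow> ('m \<Rightarrow> real) \<Rightarrow> real ^ 'n \<Rightarrow> real" where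
  "vol_integrand \<rho> c f y = indicator (snd c ` fst c) y *\<^sub>R
     (\<rho> c (chart_inv c y) * f (chart_inv c y) * vol_density M c (chart_inv c y))"

text \<open>The partition chosen in \<open>vol_integral\<close> is the same for every integrand, so
  linearity and monotonicity can be read off one fixed partition.\<close>

lemma obtain_vol_integral:
  obtains C \<rho> where "partition_of_unity M C \<rho>"
    and "\<And>f. vol_integral M f = (\<Sum>c\<in>C. integral\<^sup>L lborel (vol_integrand \<rho> c f))"
proof -
  define P where "P = (SOME (C, \<rho>). partition_of_unity M C \<rho>)"
  have "case P of (C, \<rho>) \<Rightarrow> partition_of_unity M C \<rho>"
    unfolding P_def using ex_partition_of_unity by (intro someI_ex[of "\<lambda>(C, \<rho>). partition_of_unity
        M C \<rho>"]) auto
  moreover obtain C \<rho> where "P = (C, \<rho>)" by (cases P)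
  ultimately show thesis
    using that[of C \<rho>]
    by (simp add: vol_integral_def P_def[symmetric] set_lebesgue_integral_def
        vol_integrand_def[abs_def] Let_def)
qed

lemma continuous_on_vol_integrand:
  assumes P: "partition_of_unity M C \<rho>" "c \<in> C" and f: "continuous_on UNIV f"
  shows "continuous_on (snd c ` fst c)
    (\<lambda>y. \<rho> c (chart_inv c y) * f (chart_inv c y) * vol_density M c (chart_inv c y))"
proof -
  have c: "c \<in> atlas M" and \<rho>: "continuous_on UNIV (\<rho> c)"
    using P unfolding partition_of_unity_def by auto
  have inv: "continuous_on (snd c ` fst c) (chart_inv c)" by (rule continuous_on_chart_inv[OF c])
  show ?thesis
    by (intro continuous_on_mult continuous_on_compose2[OF \<rho> inv] continuous_on_compose2[OF f inv]
        continuous_on_compose2[OF continuous_on_vol_density[OF c] inv]) (use c in auto)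
qed

text \<open>The weight confines the integrand to the image of a compact support inside the chart,
  where it is continuous; the chart image itself may be unbounded.\<close>

lemma integrable_vol_integrand:
  assumes P: "partition_of_unity M C \<rho>" "c \<in> C" and f: "continuous_on UNIV f"
  shows "integrable lborel (vol_integrand \<rho> c f)"
proof -
  have c: "c \<in> atlas M" and supp: "closure {x. \<rho> c x \<noteq> 0} \<subseteq> fst c"
    using P unfolding partition_of_unity_def by auto
  define K where "K = snd c ` closure {x. \<rho> c x \<noteq> 0}"
  have "compact (closure {x. \<rho> c x \<noteq> 0})"
    using compact_Int_closed[OF compact_UNIV closed_closure] by simp
  then have K: "compact K" unfolding K_def
    by (intro compact_continuous_image continuous_on_subset[OF continuous_on_chart[OF c] supp])
  have KV: "K \<subseteq> snd c ` fst c" using supp by (auto simp: K_def)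
  have "vol_integrand \<rho> c f = (\<lambda>y. indicator K y *\<^sub>R
      (\<rho> c (chart_inv c y) * f (chart_inv c y) * vol_density M c (chart_inv c y)))"
  proof
    fix y
    show "vol_integrand \<rho> c f y = indicator K y *\<^sub>R
      (\<rho> c (chart_inv c y) * f (chart_inv c y) * vol_density M c (chart_inv c y))"
    proof (cases "y \<in> snd c ` fst c - K")
      case True
      then have "\<rho> c (chart_inv c y) = 0"
        using c closure_subset[of "{x. \<rho> c x \<noteq> 0}"] by (auto simp: K_def)
      then show ?thesis by (simp add: vol_integrand_def)
    next
      case False
      then show ?thesis using KV by (auto simp: vol_integrand_def indicator_def)
    qed
  qed
  then show ?thesis
    using borel_integrable_compact[OF K continuous_on_subset[OF continuous_on_vol_integrand[OF P
        f] KV]] by simp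
qed

lemma vol_integral_add:
  assumes "continuous_on UNIV f" "continuous_on UNIV g"
  shows "vol_integral M (\<lambda>x. f x + g x) = vol_integral M f + vol_integral M g"
proof -
  obtain C \<rho> where P: "partition_of_unity M C \<rho>"
    and vol: "\<And>f. vol_integral M f = (\<Sum>c\<in>C. integral\<^sup>L lborel (vol_integrand \<rho> c f))"
    by (rule obtain_vol_integral) (rule that)
  have "vol_integrand \<rho> c (\<lambda>x. f x + g x) = (\<lambda>y. vol_integrand \<rho> c f y + vol_integrand \<rho> c g y)" for c
    by (simp add: vol_integrand_def fun_eq_iff algebra_simps)
  then show ?thesis
    by (simp add: vol integrable_vol_integrand[OF P] assms sum.distrib)
qed

lemma vol_integral_cmult:
  "vol_integral M (\<lambda>x. a * f x) = a * vol_integral M f"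
proof -
  obtain C \<rho> where P: "partition_of_unity M C \<rho>"
    and vol: "\<And>f. vol_integral M f = (\<Sum>c\<in>C. integral\<^sup>L lborel (vol_integrand \<rho> c f))"
    by (rule obtain_vol_integral) (rule that)
  have "vol_integrand \<rho> c (\<lambda>x. a * f x) = (\<lambda>y. a * vol_integrand \<rho> c f y)" for c
    by (simp add: vol_integrand_def fun_eq_iff algebra_simps)
  then show ?thesis by (simp add: vol sum_distrib_left)
qed

lemma vol_integrand_mono:
  assumes P: "partition_of_unity M C \<rho>" "c \<in> C" and fg: "\<And>x. f x \<le> g x"
  shows "vol_integrand \<rho> c f y \<le> vol_integrand \<rho> c g y"
proof (cases "y \<in> snd c ` fst c")
  case True
  have c: "c \<in> atlas M" and \<rho>: "\<And>x. \<rho> c x \<ge> 0"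
    using P unfolding partition_of_unity_def by auto
  have "vol_density M c (chart_inv c y) \<ge> 0"
    using True c by (intro less_imp_le vol_density_pos) auto
  then show ?thesis using True fg \<rho> by (auto simp: vol_integrand_def intro!: mult_right_mono
      mult_left_mono)
qed (simp add: vol_integrand_def)

lemma vol_integral_mono:
  assumes f: "continuous_on UNIV f" and g: "continuous_on UNIV g" and fg: "\<And>x. f x \<le> g x"
  shows "vol_integral M f \<le> vol_integral M g"
proof -
  obtain C \<rho> where P: "partition_of_unity M C \<rho>"
    and vol: "\<And>f. vol_integral M f = (\<Sum>c\<in>C. integral\<^sup>L lborel (vol_integrand \<rho> c f))"
    by (rule obtain_vol_integral) (rule that)
  show ?thesis
    unfolding vol
    by (intro sum_mono integral_mono integrable_vol_integrand[OF P] vol_integrand_mono[OF P] f g fg)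
qed

text \<open>Some weight is positive at \<open>x\<close>. If \<open>f x\<close> were positive, the
  integrand of that chart would be positive on a nonempty open set, which is not negligible.\<close>

lemma vol_integral_eq_0:
  assumes f: "continuous_on UNIV f" and nonneg: "\<And>x. f x \<ge> 0" and 0: "vol_integral M f = 0"
  shows "f x = 0"
proof (rule ccontr)
  assume "f x \<noteq> 0"
  then have fx: "f x > 0" using nonneg[of x] by simp
  obtain C \<rho> where P: "partition_of_unity M C \<rho>"
    and vol: "\<And>f. vol_integral M f = (\<Sum>c\<in>C. integral\<^sup>L lborel (vol_integrand \<rho> c f))"
    by (rule obtain_vol_integral) (rule that)
  have fin: "finite C" and sum1: "(\<Sum>c\<in>C. \<rho> c x) = 1" using P unfolding partition_of_unity_def by auto
  have nn: "vol_integrand \<rho> c f y \<ge> 0" if "c \<in> C" for c y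
    using vol_integrand_mono[OF P that, of "\<lambda>_. 0" f y] nonneg by (simp add: vol_integrand_def)
  obtain c where cC: "c \<in> C" and \<rho>0: "\<rho> c x \<noteq> 0" using sum1 by (metis sum.neutral zero_neq_one)
  then have c: "c \<in> atlas M" and \<rho>x: "\<rho> c x > 0" and supp: "closure {x. \<rho> c x \<noteq> 0} \<subseteq> fst c"
    using P unfolding partition_of_unity_def by (auto simp: order_less_le)
  have xc: "x \<in> fst c" using supp \<rho>0 closure_subset[of "{x. \<rho> c x \<noteq> 0}"] by blast
  let ?V = "snd c ` fst c"
  let ?g = "\<lambda>y. \<rho> c (chart_inv c y) * f (chart_inv c y) * vol_density M c (chart_inv c y)"
  have "integral\<^sup>L lborel (vol_integrand \<rho> c f) = 0"
    using 0 unfolding vol by (subst (asm) sum_nonneg_eq_0_iff) (use fin cC nn in auto)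
  then have ae: "AE y in lborel. vol_integrand \<rho> c f y = 0"
    using integral_nonneg_eq_0_iff_AE[OF integrable_vol_integrand[OF P cC f]] nn[OF cC] by simp
  define U where "U = ?V \<inter> ?g -` {0<..}"
  have oV: "open ?V" using open_chart_image[OF c open_UNIV] by simp
  have oU: "open U" unfolding U_def
    by (rule continuous_open_preimage[OF continuous_on_vol_integrand[OF P cC f] oV]) simp
  have "AE y in lborel. y \<notin> U"
    using ae by eventually_elim (auto simp: U_def vol_integrand_def)
  then have "U \<in> null_sets lborel" using oU by (subst AE_iff_null_sets) auto
  then have "negligible U" by (simp add: negligible_iff_null_sets null_sets_completionI)
  moreover have "snd c x \<in> U"
    using xc c fx \<rho>x vol_density_pos[OF c xc] by (simp add: U_def)
  ultimately show False using open_not_negligible[OF oU] by blast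
qed

lemma vol_integral_uniform_limit:
  assumes lim: "uniform_limit UNIV f g T" and f: "\<forall>\<^sub>F t in T. continuous_on UNIV (f t)" and g:
      "continuous_on UNIV g"
  shows "((\<lambda>t. vol_integral M (f t)) \<longlongrightarrow> vol_integral M g) T"
proof (rule tendstoI)
  fix \<delta> :: real assume \<delta>: "\<delta> > 0"
  define V where "V = vol_integral M (\<lambda>x. 1)"
  have V: "V \<ge> 0"
    using vol_integral_mono[of "\<lambda>x. 0" "\<lambda>x. 1"] vol_integral_cmult[of 0 "\<lambda>x. 1"] by (simp add: V_def)
  \<comment> \<open>\<open>V\<close> is the total volume. The summand 1 avoids division by zero and
    makes \<open>d * V < \<delta>\<close> strict.\<close>
  define d where "d = \<delta> / (V + 1)"
  have d: "d > 0" "d * V < \<delta>" using \<delta> V by (auto simp: d_def field_simps)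
  have shift: "vol_integral M (\<lambda>x. g x + e * 1) = vol_integral M g + e * V" for e
    unfolding V_def vol_integral_cmult[symmetric] by (rule vol_integral_add[OF g]) (intro
        continuous_intros)
  have "\<forall>\<^sub>F t in T. \<forall>x\<in>UNIV. dist (f t x) (g x) < d" using lim d(1) unfolding uniform_limit_iff by blast
  then show "\<forall>\<^sub>F t in T. dist (vol_integral M (f t)) (vol_integral M g) < \<delta>"
    using f
  proof eventually_elim
    case (elim t)
    have b: "g x + (- d) * 1 \<le> f t x" "f t x \<le> g x + d * 1" for x
      using elim(1)[rule_format, of x] by (auto simp: dist_real_def abs_less_iff)
    have "vol_integral M g + (- d) * V \<le> vol_integral M (f t)"
      unfolding shift[symmetric] by (intro vol_integral_mono elim(2) continuous_intros g b)
    moreover have "vol_integral M (f t) \<le> vol_integral M g + d * V"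
      unfolding shift[symmetric] by (intro vol_integral_mono elim(2) continuous_intros g b)
    ultimately show ?case using d(2) by (simp add: dist_real_def abs_less_iff)
  qed
qed

end

section \<open>Yang-Mills connections\<close>

locale compact_hermitian_bundle_connection =
  hermitian_bundle_connection M F D + compact_manifold M
  for M :: "('m::t2_space, 'n::finite) riem" and F :: "('m, 'v::ab_group_add) hbundle" and D
begin

section \<open>Continuity and definiteness of the integrated inner product\<close>

lemma form_inner_tendsto:
  assumes \<omega>: "\<forall>\<^sub>F t in T. uform M F 2 (\<omega> t)" and \<eta>: "\<forall>\<^sub>F t in T. uform M F 2 (\<eta> t)"
    and \<omega>0: "uform M F 2 \<omega>0" and \<eta>0: "uform M F 2 \<eta>0"
    and lim: "\<And>c e K \<alpha>. c \<in> atlas M \<Longrightarrow> e \<in> frames F \<Longrightarrow> compact K \<Longrightarrow> K \<subseteq> fst c \<inter> fst e \<Longrightarrow>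
      \<alpha> \<in> UNIV \<times> UNIV \<times> {..<frank F} \<times> {..<frank F} \<Longrightarrow>
      uniform_limit K (\<lambda>t. form_entry c e (\<omega> t) \<alpha>) (form_entry c e \<omega>0 \<alpha>) T \<and>
      uniform_limit K (\<lambda>t. form_entry c e (\<eta> t) \<alpha>) (form_entry c e \<eta>0 \<alpha>) T"
  shows "((\<lambda>t. form_inner M F 2 (\<omega> t) (\<eta> t)) \<longlongrightarrow> form_inner M F 2 \<omega>0 \<eta>0) T"
  unfolding form_inner_def
proof (rule vol_integral_uniform_limit)
  \<comment> \<open>The assumed convergence concerns compact sets inside one chart and one frame.
    Bump functions provide compact neighbourhoods of this kind, and finitely many of them cover the
    manifold.\<close>
  have "\<exists>U K c e. open U \<and> x \<in> U \<and> U \<subseteq> K \<and> compact K \<and> c \<in> atlas M \<and> e \<in> frames F \<and> K \<subseteq> fst c \<inter>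
      fst e" for x
  proof -
    obtain c where c: "c \<in> atlas M" "x \<in> fst c" using ex_chart by blast
    obtain e where e: "e \<in> frames F" "x \<in> fst e" using ex_frame by blast
    have o: "open (fst c \<inter> fst e)" using open_chart[OF c(1)] open_frame[OF e(1)] by auto
    obtain f :: "'m \<Rightarrow> real" where f: "continuous_on UNIV f" "f x > 0" "closure {y. f y \<noteq> 0} \<subseteq> fst
        c \<inter> fst e"
      using bump_function[OF o, of x] c e by blast
    have "open {y. f y > 0}" using open_Collect_less[OF continuous_on_const f(1)] by simp
    moreover have "{y. f y > 0} \<subseteq> closure {y. f y \<noteq> 0}" using closure_subset[of "{y. f y \<noteq> 0}"] by auto
    moreover have "compact (closure {y. f y \<noteq> 0})"
      using compact_Int_closed[OF compact_UNIV closed_closure] by simp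
    ultimately show ?thesis using f c e by blast
  qed
  then obtain U K c e where U: "\<And>x. open (U x)" "\<And>x. x \<in> U x" "\<And>x. U x \<subseteq> K x"
    and K: "\<And>x. compact (K x)" "\<And>x. K x \<subseteq> fst (c x) \<inter> fst (e x)"
    and ce: "\<And>x. c x \<in> atlas M" "\<And>x. e x \<in> frames F"
    by metis
  obtain X where X: "finite X" "(UNIV :: 'm set) \<subseteq> (\<Union>x\<in>X. U x)"
    by (rule compactE_image[OF compact_UNIV, of UNIV U]) (use U in auto)
  have "uniform_limit (\<Union>x\<in>X. K x) (\<lambda>t. form_inner_at M F 2 (\<omega> t) (\<eta> t)) (form_inner_at M F 2 \<omega>0 \<eta>0) T"
    by (rule uniform_limit_on_UNION[OF X(1)],
        rule uniform_limit_form_inner_at[OF ce K \<omega> \<eta> \<omega>0 \<eta>0]) (use lim[OF ce K] in blast)+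
  then show "uniform_limit UNIV (\<lambda>t. form_inner_at M F 2 (\<omega> t) (\<eta> t)) (form_inner_at M F 2 \<omega>0 \<eta>0) T"
    by (rule uniform_limit_on_subset) (use X U in blast)
  show "\<forall>\<^sub>F t in T. continuous_on UNIV (form_inner_at M F 2 (\<omega> t) (\<eta> t))"
    using \<omega> \<eta> by eventually_elim (rule continuous_on_form_inner_at)
qed (rule continuous_on_form_inner_at[OF \<omega>0 \<eta>0])

lemma form_inner_lincomb:
  assumes \<omega>: "uform M F 2 \<omega>" and \<eta>: "uform M F 2 \<eta>"
    and K: "\<And>x u v z. u \<in> tangent_space M x \<Longrightarrow> v \<in> tangent_space M x \<Longrightarrow> z \<in> fibre F x \<Longrightarrow>
      K x [u, v] z = fscale F (of_real a) (\<omega> x [u, v] z) + fscale F (of_real b) (\<eta> x [u, v] z)"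
  shows "form_inner M F 2 K K = a\<^sup>2 * form_inner M F 2 \<omega> \<omega> + 2 * a * b * form_inner M F 2 \<omega> \<eta> +
      b\<^sup>2 * form_inner M F 2 \<eta> \<eta>"
proof -
  note c = continuous_on_form_inner_at[OF \<omega> \<omega>] continuous_on_form_inner_at[OF \<omega> \<eta>]
      continuous_on_form_inner_at[OF \<eta> \<eta>]
  have "form_inner_at M F 2 K K = (\<lambda>x. a\<^sup>2 * form_inner_at M F 2 \<omega> \<omega> x +
    2 * a * b * form_inner_at M F 2 \<omega> \<eta> x + b\<^sup>2 * form_inner_at M F 2 \<eta> \<eta> x)"
    by (rule ext, rule form_inner_at_lincomb[OF \<omega> \<eta> K])
  then show ?thesis
    unfolding form_inner_def
    by (simp only:) (subst vol_integral_add, (intro continuous_intros c)+, subst vol_integral_add,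
        (intro continuous_intros c)+, simp only: vol_integral_cmult)
qed

text \<open>Definiteness in two stages: a continuous nonnegative function with integral zero
  vanishes, and then the pointwise inner product is definite.\<close>

lemma form_inner_eq_0:
  assumes \<omega>: "uform M F 2 \<omega>" and 0: "form_inner M F 2 \<omega> \<omega> = 0"
  shows "form_eq M F 2 \<omega> form_zero"
  unfolding form_eq_def form_zero_def
proof (intro allI ballI impI, elim conjE)
  fix x z and vs :: "'m tangent list"
  assume z: "z \<in> fibre F x" and l: "length vs = 2" and T: "set vs \<subseteq> tangent_space M x"
  obtain u v where vs: "vs = [u, v]" using l by (auto simp: numeral_2_eq_2 length_Suc_conv)
  have "form_inner_at M F 2 \<omega> \<omega> x = 0"
    using vol_integral_eq_0[OF continuous_on_form_inner_at[OF \<omega> \<omega>] form_inner_at_nonneg[OF \<omega>]] 0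
    by (simp add: form_inner_def)
  then show "\<omega> x vs z = 0"
    unfolding vs by (rule form_inner_at_eq_0[OF \<omega>]) (use T vs z in auto)
qed

section \<open>The Yang-Mills functional along a line of connections\<close>

lemma YM_line:
  assumes flat: "flat M F D" and E: "uform M F 1 E"
  shows "YM M F (conn_add D (form_scale F s E)) =
    s\<^sup>2 * form_inner M F 2 (nabla_form M F D E) (nabla_form M F D E) +
    2 * s * s\<^sup>2 * form_inner M F 2 (nabla_form M F D E) (wedge_square E) +
    (s\<^sup>2)\<^sup>2 * form_inner M F 2 (wedge_square E) (wedge_square E)"
  unfolding YM_def
proof (rule form_inner_lincomb[OF uform_nabla_form[OF E] uform_wedge_square[OF E]])
  fix x u v z assume T: "u \<in> tangent_space M x" "v \<in> tangent_space M x" and z: "z \<in> fibre F x"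
  have "curvature M F D x [u, v] z = 0"
    using flat T z by (simp add: flat_def form_eq_def form_zero_def)
  moreover have "wedge_square (form_scale F s E) x [u, v] z = fscale F (of_real (s\<^sup>2))
      (wedge_square E x [u, v] z)"
    using T z antihermitian_fibre[OF uform_1_antihermitian[OF E]]
    by (simp add: wedge_square_def form_scale_def antihermitian_scale[OF uform_1_antihermitian[OF E]]
        fs.scale_right_diff_distrib power2_eq_square)
  ultimately show "curvature M F (conn_add D (form_scale F s E)) x [u, v] z =
    fscale F (of_real s) (nabla_form M F D E x [u, v] z) + fscale F (of_real (s\<^sup>2)) (wedge_square
        E x [u, v] z)"
    by (simp add: curvature_conn_add[OF uform_scale[OF E] T z] nabla_form_1_scale[OF E T z])
qed

text \<open>Moving from \<open>E\<close> to (1 + \<epsilon>) \<open>E\<close> stays on the line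
  through \<open>D\<close> in the direction \<open>e\<close>, at parameter (1 + \<epsilon>) t, so
  \<open>YM_line\<close> applies with the flat \<open>D\<close> as base point. The rescaling to
  \<open>e\<close> gives the three inner products limits as t tends to 0.\<close>

lemma yang_mills_line:
  assumes flat: "flat M F D" and E: "uform M F 1 E" and t: "t > 0"
    and ym: "yang_mills_connection M F (conn_add D E)"
  defines "e \<equiv> form_scale F (1 / t) E"
  shows "form_inner M F 2 (nabla_form M F D e) (nabla_form M F D e) +
    3 * t * form_inner M F 2 (nabla_form M F D e) (wedge_square e) +
    2 * t\<^sup>2 * form_inner M F 2 (wedge_square e) (wedge_square e) = 0"
proof -
  define P where "P = form_inner M F 2 (nabla_form M F D e) (nabla_form M F D e)"
  define Q where "Q = form_inner M F 2 (nabla_form M F D e) (wedge_square e)"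
  define R where "R = form_inner M F 2 (wedge_square e) (wedge_square e)"
  have e: "uform M F 1 e" unfolding e_def by (rule uform_scale[OF E])
  have "conn_add (conn_add D E) (form_scale F \<epsilon> E) = conn_add D (form_scale F ((1 + \<epsilon>) * t) e)" for \<epsilon>
    using t by (simp add: conn_add_def form_scale_def e_def fun_eq_iff fs.scale_left_distrib add.assoc)
  then have YM: "YM M F (conn_add (conn_add D E) (form_scale F \<epsilon> E)) =
      ((1 + \<epsilon>) * t)\<^sup>2 * P + 2 * ((1 + \<epsilon>) * t) * ((1 + \<epsilon>) * t)\<^sup>2 * Q + (((1 + \<epsilon>) * t)\<^sup>2)\<^sup>2 * R" for \<epsilon>
    by (simp only: YM_line[OF flat e] P_def Q_def R_def)
  have "((\<lambda>\<epsilon>. YM M F (conn_add (conn_add D E) (form_scale F \<epsilon> E))) has_real_derivative 0) (at 0)"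
    using ym E unfolding yang_mills_connection_def by blast
  moreover have "((\<lambda>\<epsilon>. YM M F (conn_add (conn_add D E) (form_scale F \<epsilon> E))) has_real_derivative
      2 * t\<^sup>2 * P + 6 * t ^ 3 * Q + 4 * t ^ 4 * R) (at 0)"
    unfolding YM by (auto intro!: derivative_eq_intros simp: algebra_simps power2_eq_square
        power3_eq_cube power4_eq_xxxx)
  ultimately have "2 * t\<^sup>2 * P + 6 * t ^ 3 * Q + 4 * t ^ 4 * R = 0"
    using DERIV_unique by blast
  then have "2 * t\<^sup>2 * (P + 3 * t * Q + 2 * t\<^sup>2 * R) = 0"
    by (simp add: algebra_simps power2_eq_square power3_eq_cube power4_eq_xxxx)
  then show ?thesis using t by (simp add: P_def Q_def R_def)
qed

lemma yang_mills_tangent_closed: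
  assumes flat: "flat M F D" and E: "\<And>t. t > 0 \<Longrightarrow> uform M F 1 (E t)" and E1: "uform M F 1 E1"
    and lim: "form_tendsto M F 1 (\<lambda>t. form_scale F (1 / t) (E t)) E1 (at_right 0)"
    and ym: "\<And>t. t > 0 \<Longrightarrow> yang_mills_connection M F (conn_add D (E t))"
  shows "form_eq M F 2 (nabla_form M F D E1) form_zero"
proof -
  define e where "e = (\<lambda>t. form_scale F (1 / t) (E t))"
  have pos: "\<forall>\<^sub>F t in at_right 0. t > (0::real)" by (rule eventually_at_right_less)
  have ue: "\<forall>\<^sub>F t in at_right 0. uform M F 1 (e t)"
    using pos unfolding e_def by eventually_elim (rule uform_scale[OF E])
  note ul = uniform_limit_form_entry[OF lim[folded e_def] ue E1]
  have un: "\<forall>\<^sub>F t in at_right 0. uform M F 2 (nabla_form M F D (e t))"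
    using ue by eventually_elim (rule uform_nabla_form)
  have uw: "\<forall>\<^sub>F t in at_right 0. uform M F 2 (wedge_square (e t))"
    using ue by eventually_elim (rule uform_wedge_square)
  note n1 = uform_nabla_form[OF E1] and w1 = uform_wedge_square[OF E1]
  have P: "((\<lambda>t. form_inner M F 2 (nabla_form M F D (e t)) (nabla_form M F D (e t))) \<longlongrightarrow>
      form_inner M F 2 (nabla_form M F D E1) (nabla_form M F D E1)) (at_right 0)"
    by (rule form_inner_tendsto[OF un un n1 n1]) (intro conjI ul)
  have Q: "((\<lambda>t. form_inner M F 2 (nabla_form M F D (e t)) (wedge_square (e t))) \<longlongrightarrow>
      form_inner M F 2 (nabla_form M F D E1) (wedge_square E1)) (at_right 0)"
    by (rule form_inner_tendsto[OF un uw n1 w1]) (intro conjI ul)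
  have R: "((\<lambda>t. form_inner M F 2 (wedge_square (e t)) (wedge_square (e t))) \<longlongrightarrow>
      form_inner M F 2 (wedge_square E1) (wedge_square E1)) (at_right 0)"
    by (rule form_inner_tendsto[OF uw uw w1 w1]) (intro conjI ul)
  have "((\<lambda>t. form_inner M F 2 (nabla_form M F D (e t)) (nabla_form M F D (e t)) +
      3 * t * form_inner M F 2 (nabla_form M F D (e t)) (wedge_square (e t)) +
      2 * t\<^sup>2 * form_inner M F 2 (wedge_square (e t)) (wedge_square (e t))) \<longlongrightarrow>
      form_inner M F 2 (nabla_form M F D E1) (nabla_form M F D E1) +
      3 * 0 * form_inner M F 2 (nabla_form M F D E1) (wedge_square E1) +
      2 * 0\<^sup>2 * form_inner M F 2 (wedge_square E1) (wedge_square E1)) (at_right 0)"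
    by (intro tendsto_intros P Q R)
  moreover have "\<forall>\<^sub>F t in at_right 0. form_inner M F 2 (nabla_form M F D (e t)) (nabla_form M F D
      (e t)) +
      3 * t * form_inner M F 2 (nabla_form M F D (e t)) (wedge_square (e t)) +
      2 * t\<^sup>2 * form_inner M F 2 (wedge_square (e t)) (wedge_square (e t)) = 0"
    using pos by eventually_elim (simp only: e_def yang_mills_line[OF flat E _ ym])
  ultimately have "((\<lambda>t. 0) \<longlongrightarrow> form_inner M F 2 (nabla_form M F D E1) (nabla_form M F D E1))
      (at_right (0::real))"
    by (auto elim: Lim_transform_eventually)
  then have "form_inner M F 2 (nabla_form M F D E1) (nabla_form M F D E1) = 0"
    by (simp add: tendsto_const_iff)
  then show ?thesis by (rule form_inner_eq_0[OF n1])
qed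

text \<open>Once a form is a cocycle, its class lies in the quotient by construction.\<close>

lemma cocycle_class: "\<omega> \<in> cocycles M F D k \<Longrightarrow> cohomologous M F D k `` {\<omega>} \<in> cohomology M F D k"
  unfolding cohomology_def by (rule quotientI)

end

theorem proposition6:
  fixes M :: "('m::t2_space, 'n::finite) riem"
    and F :: "('m, 'v::ab_group_add) hbundle"
    and D :: "('m, 'v) conn"
    and E :: "real \<Rightarrow> ('m, 'v) eform"
    and E1 E2 :: "('m, 'v) eform"
  assumes "compact (UNIV :: 'm set)" and "connected (UNIV :: 'm set)"
    and "oriented_riemannian_manifold M"
    and "hermitian_vector_bundle M F"
    and "hermitian_connection M F D" and "flat M F D"
    and "\<And>t. t \<ge> 0 \<Longrightarrow> uform M F 1 (E t)"
    and "form_eq M F 1 (E 0) form_zero"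
    and "uform M F 1 E1" and "uform M F 1 E2"
    and "form_tendsto M F 1 (\<lambda>t. form_scale F (1 / t) (E t)) E1 (at_right 0)"
    and "form_tendsto M F 1
           (\<lambda>t. form_scale F (1 / t\<^sup>2) (form_diff (E t) (form_scale F t E1))) E2 (at_right 0)"
    and "form_bigo M F 1
           (\<lambda>t. form_diff (E t) (form_add (form_scale F t E1) (form_scale F (t\<^sup>2) E2)))
           (\<lambda>t. t ^ 3) (at_right 0)"
    and "\<And>t. t \<ge> 0 \<Longrightarrow> yang_mills_connection M F (conn_add D (E t))"
  shows "E1 \<in> cocycles M F D 1 \<and>
     cohomologous M F D 1 `` {E1} \<in> cohomology M F D 1 \<and>
     (let C = form_add (nabla_form M F D E2) (wedge_square E1) in
        C \<in> cocycles M F D 2 \<and> cohomologous M F D 2 `` {C} \<in> cohomology M F D 2)"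
proof -
  interpret compact_hermitian_bundle_connection M F D
    using assms(1,3,4,5) by unfold_locales
  note E1 = assms(9) and E2 = assms(10)
  have closed: "form_eq M F 2 (nabla_form M F D E1) form_zero"
    by (rule yang_mills_tangent_closed[OF assms(6) _ E1 assms(11)]) (use assms(7,14) in auto)
  then have 1: "E1 \<in> cocycles M F D 1"
    using E1 by (simp add: cocycles_def numeral_2_eq_2)
  let ?C = "form_add (nabla_form M F D E2) (wedge_square E1)"
  note u = uform_nabla_form[OF E2] uform_wedge_square[OF E1]
  have "form_eq M F 3 (nabla_form M F D ?C) form_zero"
    unfolding form_eq_def form_zero_def
  proof (intro allI ballI impI, elim conjE)
    fix x z and vs :: "'m tangent list"
    assume z: "z \<in> fibre F x" and l: "length vs = 3" and T: "set vs \<subseteq> tangent_space M x"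
    obtain a b c where vs: "vs = [a, b, c]" using l by (auto simp: numeral_3_eq_3 length_Suc_conv)
    have "nabla_form M F D (nabla_form M F D E2) x vs z = 0" "nabla_form M F D (wedge_square E1) x
        vs z = 0"
      using nabla_nabla[OF assms(6) E2] nabla_wedge_square[OF E1 closed] z l T
      by (auto simp: form_eq_def form_zero_def)
    then show "nabla_form M F D ?C x vs z = 0"
      using nabla_form_2_add[OF u, of a x b c z] T z by (simp add: vs)
  qed
  then have "?C \<in> cocycles M F D 2"
    using uform_2_form_add[OF u] by (simp add: cocycles_def)
  with 1 show ?thesis by (simp add: Let_def cocycle_class)
qed

end
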